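(* The map $\psi_\infty:\mathcal T'(\infty)\to\Sigma_\iota$, $T\mapsto \overrightarrow{x}_T=(x_j^{(i)})$, defined by $$x_j^{(i)}=\begin{cases}\sum_{k=1}^{i} z_{n+2-i-j}^{k}(T), & 1\le i\le n,\ 2\le i+j\le n+1,\\ 0, & i+j>n+1,\end{cases}$$ is a crystal isomorphism.
   Context: Fix $n$, $I=\{1,\dots,n\}$. Let $\epsilon_1,\dots,\epsilon_{n+1}$ be the standard basis of $\mathbb R^{n+1}$, $\alpha_i=\epsilon_i-\epsilon_{i+1}$, $\omega_i=\epsilon_1+\dots+\epsilon_i$, $P=\bigoplus_{i\in I}\mathbb Z\omega_i$ (integer combinations of the $\epsilon_j$ are regarded in $P$ modulo $\epsilon_1+\dots+\epsilon_{n+1}$), and $\langle\alpha_i^\vee,\epsilon_j\rangle=\delta_{i,j}-\delta_{i+1,j}$. A crystal of type $A_n$ is a set $B$ with maps $\mathrm{wt}:B\to P$, $\tilde e_i,\tilde f_i:B\to B\cup\{0\}$, $\varepsilon_i,\varphi_i:B\to\mathbb Z\cup\{-\infty\}$ ($i\in I$) such that: $\varphi_i(b)=\varepsilon_i(b)+\langle\alpha_i^\vee,\mathrm{wt}(b)\rangle$; if $\tilde e_ib\ne0$ then $\mathrm{wt}(\tilde e_ib)=\mathrm{wt}(b)+\alpha_i$, $\varepsilon_i(\tilde e_ib)=\varepsilon_i(b)-1$, $\varphi_i(\tilde e_ib)=\varphi_i(b)+1$; if $\tilde f_ib\neq0$ then $\mathrm{wt}(\tilde f_ib)=\mathrm{wt}(b)-\alpha_i$,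 $\varepsilon_i(\tilde f_ib)=\varepsilon_i(b)+1$, $\varphi_i(\tilde f_ib)=\varphi_i(b)-1$; $\tilde f_ib=b'$ iff $b=\tilde e_ib'$ for $b,b'\in B$; and $\tilde e_ib=\tilde f_ib=0$ if $\varphi_i(b)=-\infty$. A crystal isomorphism $B_1\to B_2$ is a bijection $B_1\cup\{0\}\to B_2\cup\{0\}$ with $0\mapsto 0$ preserving $\mathrm{wt},\varepsilon_i,\varphi_i$ and commuting with all $\tilde e_i,\tilde f_i$. Marginally large tableaux. A semistandard Young tableau (rows weakly increasing, columns strictly increasing) with $n$ nonempty rows and entries in $\{1,\dots,n+1\}$ is marginally large if for every $i\in I$ the number of $i$-boxes (boxes with entry $i$) in row $i$ exceeds the total number of boxes in row $i+1$ by exactly one (row $n+1$ is empty). An MLT is the infinite tableau obtained from such a tableau by adding, for every $i\in I$, infinitely many $i$-boxes at the left end of row $i$. For an MLT $T$ and $1\le j<i\le n+1$, $y_j^i(T)$ is the number of $i$-boxes in row $j$; $T$ is determined by the (arbitrary) nonnegative integers $y_j^i(T)$. Let $\mathcal T(\infty)$ be the set of MLTs. Crystal structure on $\mathcal T(\infty)$: read the boxes of $T$ by the Far-Eastern reading (columns from right to left, each column from top to bottom); write $+$ for each entry $i$ and $-$ for each entry $i+1$; cancel successively all pairs $(+,-)$ ($+$ before $-$). The remaining sequence of $-$'s followed by $+$'s is the $i$-signature. $\tilde f_iT$ is obtained by changing $i$ to $i+1$ in the box of the leftmost $+$ of the $i$-signature and, if the result is not marginally large, pushing all rows below the changed box to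 the left by one box. $\tilde e_iT$ is obtained by changing $i+1$ to $i$ in the box of the rightmost $-$ and, if the result is not marginally large, pushing all rows below the changed box to the right by one box; $\tilde e_iT=0$ if there is no $-$. Also $\mathrm{wt}(T)=-\sum_{i=1}^n\big(\sum_{k=1}^i\sum_{l=i+1}^{n+1}y_k^l(T)\big)\alpha_i$, $\varepsilon_i(T)$ is the number of $-$'s in the $i$-signature, $\varphi_i(T)=\varepsilon_i(T)+\langle\alpha_i^\vee,\mathrm{wt}(T)\rangle$. Reverse marginally large tableaux (RMLT). $\mathcal T'(\infty)$ is the set of tableaux obtained from MLTs by replacing every entry $a$ by $n+2-a$; $\eta:\mathcal T'(\infty)\to\mathcal T(\infty)$ is the bijection replacing every entry $a$ by $n+2-a$. For $T\in\mathcal T'(\infty)$, $1\le i\le n$, $1\le j\le n+1-i$, put $z_i^j(T)=y_i^{n+2-j}(\eta(T))$, the number of $j$-boxes in row $i$ of $T$; $T$ is determined by these (arbitrary) nonnegative integers. Crystal structure on $\mathcal T'(\infty)$: $\mathrm{wt}(T)=-\sum_{i=1}^n\big(\sum_{j=1}^{n+1-i}\sum_{k=1}^i z_j^k(T)\big)\alpha_i$, $\tilde e_iT=\eta^{-1}(\tilde e_{n+1-i}\eta(T))$, $\tilde f_iT=\eta^{-1}(\tilde f_{n+1-i}\eta(T))$ (with $\eta^{-1}(0)=0$), $\varepsilon_i(T)=\varepsilon_{n+1-i}(\eta(T))$, $\varphi_i(T)=\varphi_{n+1-i}(\eta(T))$. Polyhedral realization. Consider integer sequences $\overrightarrow{x}=(\dots,x_2,x_1)$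 with $x_k=0$ for $k\gg0$; write $x_j^{(i)}=x_{(j-1)n+i}$ for $j\ge1$, $i\in I$, and let $\iota=(\dots,i_2,i_1)$ with $i_{(j-1)n+i}=i$. Then $$\Sigma_\iota=\{\overrightarrow{x}: x_1^{(i)}\ge x_2^{(i-1)}\ge\dots\ge x_i^{(1)}\ge0\ (1\le i\le n),\ x_j^{(i)}=0\ (i+j>n+1)\}.$$ Put $\sigma_k(\overrightarrow{x})=x_k+\sum_{j>k}\langle\alpha_{i_k}^\vee,\alpha_{i_j}\rangle x_j$, $\sigma^{(i)}(\overrightarrow{x})=\max_{k:i_k=i}\sigma_k(\overrightarrow{x})$, $M^{(i)}(\overrightarrow{x})=\{k: i_k=i,\ \sigma_k(\overrightarrow{x})=\sigma^{(i)}(\overrightarrow{x})\}$, and let $\overrightarrow{e_k}$ be the $k$-th unit vector. Crystal structure on $\Sigma_\iota$: $\mathrm{wt}(\overrightarrow{x})=-\sum_{j\ge1}x_j\alpha_{i_j}$; $\tilde f_i\overrightarrow{x}=\overrightarrow{x}+\overrightarrow{e_k}$ with $k=\min M^{(i)}(\overrightarrow{x})$; $\tilde e_i\overrightarrow{x}=\overrightarrow{x}-\overrightarrow{e_k}$ with $k=\max M^{(i)}(\overrightarrow{x})$ if $\sigma^{(i)}(\overrightarrow{x})>0$ and $\tilde e_i\overrightarrow{x}=0$ otherwise; $\varepsilon_i(\overrightarrow{x})=\sigma^{(i)}(\overrightarrow{x})$; $\varphi_i(\overrightarrow{x})=\langle\alpha_i^\vee,\mathrm{wt}(\overrightarrow{x})\rangle+\varepsilon_i(\overrightarrow{x})$.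 *)

theory Defs
  imports
    "HOL-Library.Poly_Mapping"
    "HOL-Library.Product_Lexorder"
    "HOL-Library.Extended"
begin

section \<open>Weights of type A\<close>

text \<open>
  The weight lattice \<open>P\<close> is free on \<open>\<omega>\<^sub>1, \<dots>, \<omega>\<^sub>n\<close>. A weight is a finitely supported function
  \<open>v\<close>, standing for the sum of the \<open>v(i) \<omega>\<^sub>i\<close>; it lies in \<open>P\<close> if its keys lie in \<open>{1..n}\<close>.
\<close>

type_synonym weight = "nat \<Rightarrow>\<^sub>0 int"

definition weight_lattice :: "nat \<Rightarrow> weight set" where
  "weight_lattice n = {v. Poly_Mapping.keys v \<subseteq> {1..n}}"

text \<open>
  \<open>\<omega>\<^sub>0\<close> is the empty sum, and \<open>\<omega>\<^sub>n\<^sub>+\<^sub>1 = \<epsilon>\<^sub>1 + \<dots> + \<epsilon>\<^sub>n\<^sub>+\<^sub>1\<close> is zero in \<open>P\<close>.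
\<close>

definition omega :: "nat \<Rightarrow> nat \<Rightarrow> weight" where
  "omega n i = (if i \<in> {1..n} then Poly_Mapping.single i 1 else 0)"

text \<open>The class in \<open>P\<close> of the \<open>j\<close>-th standard basis vector, for \<open>1 \<le> j \<le> n + 1\<close>.\<close>

definition epsv :: "nat \<Rightarrow> nat \<Rightarrow> weight" where
  "epsv n j = omega n j - omega n (j - 1)"

definition alpha :: "nat \<Rightarrow> nat \<Rightarrow> weight" where
  "alpha n i = epsv n i - epsv n (i + 1)"

text \<open>
  The pairing with the coroot \<open>\<alpha>\<^sub>i\<close>; the lemma \<open>coroot_epsv\<close> relates it to the basis vectors.
\<close>

definition coroot :: "nat \<Rightarrow> weight \<Rightarrow> int" where
  "coroot i v = Poly_Mapping.lookup v i"

lemma coroot_add: "coroot i (v + w) = coroot i v + coroot i w"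
  by (simp add: coroot_def lookup_add)

lemma omega_eq_sum_epsv: "omega n i = (\<Sum>j = 1..i. epsv n j)"
proof (induction i)
  case 0
  then show ?case by (simp add: omega_def)
next
  case (Suc i)
  have "(\<Sum>j = 1..Suc i. epsv n j) = omega n i + epsv n (Suc i)"
    using Suc by simp
  then show ?case by (simp add: epsv_def)
qed

lemma sum_epsv_eq_0: "(\<Sum>j = 1..n + 1. epsv n j) = 0"
  unfolding omega_eq_sum_epsv [symmetric] by (simp add: omega_def)

lemma coroot_epsv:
  assumes "i \<in> {1..n}" "j \<in> {1..n + 1}"
  shows "coroot i (epsv n j) = (if i = j then 1 else 0) - (if i + 1 = j then 1 else 0)"
  using assms
  by (auto simp: coroot_def epsv_def omega_def lookup_minus lookup_single when_def)


section \<open>Crystals\<close>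

text \<open>
  The set \<open>B \<union> {0}\<close> is rendered by the option type, with \<open>None\<close> for \<open>0\<close>. The values of
  \<open>\<epsilon>\<^sub>i\<close> and \<open>\<phi>\<^sub>i\<close> lie in \<open>\<int> \<union> {-\<infinity>}\<close>: the value \<open>\<infinity>\<close> of the type \<open>int extended\<close> is excluded in
  \<open>is_crystal\<close>.
\<close>

record 'b crystal =
  elems :: "'b set"
  wt :: "'b \<Rightarrow> weight"
  e_op :: "nat \<Rightarrow> 'b \<Rightarrow> 'b option"
  f_op :: "nat \<Rightarrow> 'b \<Rightarrow> 'b option"
  veps :: "nat \<Rightarrow> 'b \<Rightarrow> int extended"
  vphi :: "nat \<Rightarrow> 'b \<Rightarrow> int extended"

definition with_zero :: "'b set \<Rightarrow> 'b option set" where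
  "with_zero B = insert None (Some ` B)"

definition is_crystal :: "nat \<Rightarrow> 'b crystal \<Rightarrow> bool" where
  "is_crystal n B \<longleftrightarrow>
     (\<forall>b\<in>elems B. wt B b \<in> weight_lattice n) \<and>
     (\<forall>i\<in>{1..n}.
        (\<forall>b\<in>elems B.
           e_op B i b \<in> with_zero (elems B) \<and> f_op B i b \<in> with_zero (elems B) \<and>
           veps B i b \<noteq> \<infinity> \<and> vphi B i b \<noteq> \<infinity> \<and>
           vphi B i b = veps B i b + Fin (coroot i (wt B b)) \<and>
           (\<forall>b'. e_op B i b = Some b' \<longrightarrow>
              wt B b' = wt B b + alpha n i \<and>
              veps B i b' = veps B i b - 1 \<and> vphi B i b' = vphi B i b + 1) \<and>
           (\<forall>b'. f_op B i b = Some b' \<longrightarrow>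
              wt B b' = wt B b - alpha n i \<and>
              veps B i b' = veps B i b + 1 \<and> vphi B i b' = vphi B i b - 1) \<and>
           (vphi B i b = -\<infinity> \<longrightarrow> e_op B i b = None \<and> f_op B i b = None)) \<and>
        (\<forall>b\<in>elems B. \<forall>b'\<in>elems B. f_op B i b = Some b' \<longleftrightarrow> e_op B i b' = Some b))"

text \<open>
  On \<open>0\<close> the operators take the value \<open>0\<close>, so that \<open>Option.bind x (e_op B i)\<close> is the extension of
  \<open>e_op B i\<close> to \<open>B \<union> {0}\<close>. An isomorphism is a relation between crystals, so both
  structures are required to be crystals.
\<close>

definition crystal_iso ::
  "nat \<Rightarrow> 'b crystal \<Rightarrow> 'c crystal \<Rightarrow> ('b option \<Rightarrow> 'c option) \<Rightarrow> bool" where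
  "crystal_iso n B C \<Psi> \<longleftrightarrow>
     is_crystal n B \<and> is_crystal n C \<and>
     bij_betw \<Psi> (with_zero (elems B)) (with_zero (elems C)) \<and>
     \<Psi> None = None \<and>
     (\<forall>b\<in>elems B. \<forall>c. \<Psi> (Some b) = Some c \<longrightarrow>
        wt C c = wt B b \<and>
        (\<forall>i\<in>{1..n}. veps C i c = veps B i b \<and> vphi C i c = vphi B i b)) \<and>
     (\<forall>x\<in>with_zero (elems B). \<forall>i\<in>{1..n}.
        \<Psi> (Option.bind x (e_op B i)) = Option.bind (\<Psi> x) (e_op C i) \<and>
        \<Psi> (Option.bind x (f_op B i)) = Option.bind (\<Psi> x) (f_op C i))"


section \<open>Marginally large tableaux\<close>

subsection \<open>Finite tableaux, as lists of left-justified rows\<close>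

definition semistandard :: "nat \<Rightarrow> nat list list \<Rightarrow> bool" where
  "semistandard n S \<longleftrightarrow>
     length S = n \<and>
     (\<forall>R\<in>set S. R \<noteq> [] \<and> set R \<subseteq> {1..n + 1} \<and> sorted R) \<and>
     (\<forall>r. r + 1 < n \<longrightarrow>
        length (S ! (r + 1)) \<le> length (S ! r) \<and>
        (\<forall>p < length (S ! (r + 1)). S ! r ! p < S ! (r + 1) ! p))"

text \<open>Rows are numbered from 1, so that row \<open>i\<close> is \<open>S ! (i - 1)\<close>.\<close>

definition marginally_large :: "nat \<Rightarrow> nat list list \<Rightarrow> bool" where
  "marginally_large n S \<longleftrightarrow>
     semistandard n S \<and>
     (\<forall>i\<in>{1..n}. count_list (S ! (i - 1)) i = (if i < n then length (S ! i) else 0) + 1)"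

subsection \<open>Infinite tableaux\<close>

text \<open>
  The rows of an infinite tableau extend indefinitely to the left, so columns are counted from
  the right, starting with 0 for the column of the last box of row 1. A box is a pair
  (column, row), and the lexicographic order on boxes is then the order of the Far-Eastern
  reading. The domain of a tableau is its set of boxes.
\<close>

type_synonym box = "nat \<times> nat"
type_synonym tableau = "box \<rightharpoonup> nat"

definition extend_left :: "nat \<Rightarrow> nat list list \<Rightarrow> tableau" where
  "extend_left n S = (\<lambda>(c, r).
     if r \<notin> {1..n} then None
     else if c < length (S ! 0) then
       (let p = length (S ! 0) - 1 - c
        in if p < length (S ! (r - 1)) then Some (S ! (r - 1) ! p) else None)
     else Some r)"

definition MLT :: "nat \<Rightarrow> tableau set" where
  "MLT n = extend_left n ` {S. marginally_large n S}"

text \<open>The number of \<open>a\<close>-boxes in row \<open>j\<close> (\<open>y\<^sub>j\<^sup>a\<close>); it is used for \<open>j < a\<close>, where it is finite.\<close>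

definition yb :: "tableau \<Rightarrow> nat \<Rightarrow> nat \<Rightarrow> nat" where
  "yb T j a = card {c. T (c, j) = Some a}"

subsection \<open>Signatures\<close>

text \<open>
  Successive cancellation, for positions \<open>p\<close> in a possibly infinite word whose \<open>+\<close> are at the
  positions in \<open>P\<close> and whose \<open>-\<close> are at the positions in \<open>M\<close>: a \<open>+\<close> at \<open>p\<close> and a later \<open>-\<close> at
  \<open>q\<close> cancel once all signs strictly between them have cancelled among themselves.
\<close>

inductive cancels :: "'p::linorder set \<Rightarrow> 'p set \<Rightarrow> 'p \<Rightarrow> 'p \<Rightarrow> bool" for P M where
  "\<lbrakk>p \<in> P; q \<in> M; p < q;
    \<forall>r\<in>P \<union> M. p < r \<and> r < q \<longrightarrow>
      (\<exists>s. p < s \<and> s < q \<and> (cancels P M r s \<or> cancels P M s r))\<rbrakk>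
   \<Longrightarrow> cancels P M p q"

definition boxes :: "tableau \<Rightarrow> nat \<Rightarrow> box set" where
  "boxes T a = {b. T b = Some a}"

definition sig_plus :: "nat \<Rightarrow> tableau \<Rightarrow> box set" where
  "sig_plus i T =
     {p \<in> boxes T i. \<not> (\<exists>q. cancels (boxes T i) (boxes T (i + 1)) p q)}"

definition sig_minus :: "nat \<Rightarrow> tableau \<Rightarrow> box set" where
  "sig_minus i T =
     {q \<in> boxes T (i + 1). \<not> (\<exists>p. cancels (boxes T i) (boxes T (i + 1)) p q)}"

subsection \<open>The crystal of marginally large tableaux\<close>

definition push_left :: "nat \<Rightarrow> tableau \<Rightarrow> tableau" where
  "push_left r T = (\<lambda>(c, r').
     if r < r' then (if c = 0 then None else T (c - 1, r')) else T (c, r'))"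

definition push_right :: "nat \<Rightarrow> tableau \<Rightarrow> tableau" where
  "push_right r T = (\<lambda>(c, r'). if r < r' then T (c + 1, r') else T (c, r'))"

definition MLT_f :: "nat \<Rightarrow> nat \<Rightarrow> tableau \<Rightarrow> tableau option" where
  "MLT_f n i T =
     (let b = (LEAST b. b \<in> sig_plus i T);
          T' = T(b \<mapsto> i + 1)
      in Some (if T' \<in> MLT n then T' else push_left (snd b) T'))"

definition MLT_e :: "nat \<Rightarrow> nat \<Rightarrow> tableau \<Rightarrow> tableau option" where
  "MLT_e n i T =
     (if sig_minus i T = {} then None
      else
        (let b = Max (sig_minus i T);
             T' = T(b \<mapsto> i)
         in Some (if T' \<in> MLT n then T' else push_right (snd b) T')))"

definition MLT_wt :: "nat \<Rightarrow> tableau \<Rightarrow> weight" where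
  "MLT_wt n T =
     - (\<Sum>i = 1..n. frag_cmul (int (\<Sum>k = 1..i. \<Sum>l = i + 1..n + 1. yb T k l)) (alpha n i))"

definition MLT_eps :: "nat \<Rightarrow> tableau \<Rightarrow> int extended" where
  "MLT_eps i T = Fin (int (card (sig_minus i T)))"

definition MLT_phi :: "nat \<Rightarrow> nat \<Rightarrow> tableau \<Rightarrow> int extended" where
  "MLT_phi n i T = MLT_eps i T + Fin (coroot i (MLT_wt n T))"

subsection \<open>The crystal of reverse marginally large tableaux\<close>

definition flip :: "nat \<Rightarrow> tableau \<Rightarrow> tableau" where
  "flip n T = (\<lambda>b. map_option (\<lambda>a. n + 2 - a) (T b))"

definition RMLT :: "nat \<Rightarrow> tableau set" where
  "RMLT n = flip n ` MLT n"

definition eta :: "nat \<Rightarrow> tableau \<Rightarrow> tableau" where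
  "eta n = flip n"

definition eta_inv :: "nat \<Rightarrow> tableau \<Rightarrow> tableau" where
  "eta_inv n = inv_into (RMLT n) (eta n)"

definition zb :: "nat \<Rightarrow> tableau \<Rightarrow> nat \<Rightarrow> nat \<Rightarrow> nat" where
  "zb n T i j = yb (eta n T) i (n + 2 - j)"

definition RMLT_crystal :: "nat \<Rightarrow> tableau crystal" where
  "RMLT_crystal n =
     \<lparr>elems = RMLT n,
      wt = (\<lambda>T. - (\<Sum>i = 1..n.
              frag_cmul (int (\<Sum>j = 1..n + 1 - i. \<Sum>k = 1..i. zb n T j k)) (alpha n i))),
      e_op = (\<lambda>i T. map_option (eta_inv n) (MLT_e n (n + 1 - i) (eta n T))),
      f_op = (\<lambda>i T. map_option (eta_inv n) (MLT_f n (n + 1 - i) (eta n T))),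
      veps = (\<lambda>i T. MLT_eps (n + 1 - i) (eta n T)),
      vphi = (\<lambda>i T. MLT_phi n (n + 1 - i) (eta n T))\<rparr>"


section \<open>The polyhedral realization\<close>

text \<open>
  A sequence \<open>(\<dots>, x\<^sub>2, x\<^sub>1)\<close> is a function on \<open>nat\<close>, of which only the values at positive
  arguments are meaningful; the value at 0 is fixed to be 0.
\<close>

type_synonym intseq = "nat \<Rightarrow> int"

definition sequences :: "intseq set" where
  "sequences = {x. finite {k. x k \<noteq> 0} \<and> x 0 = 0}"

definition iota :: "nat \<Rightarrow> nat \<Rightarrow> nat" where
  "iota n k = (k - 1) mod n + 1"

definition entry :: "nat \<Rightarrow> intseq \<Rightarrow> nat \<Rightarrow> nat \<Rightarrow> int" where
  "entry n x j i = x ((j - 1) * n + i)"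

definition Sigma_iota :: "nat \<Rightarrow> intseq set" where
  "Sigma_iota n =
     {x \<in> sequences.
        (\<forall>i\<in>{1..n}.
           (\<forall>j\<in>{1..<i}. entry n x j (i + 1 - j) \<ge> entry n x (j + 1) (i - j)) \<and>
           entry n x i 1 \<ge> 0) \<and>
        (\<forall>i\<in>{1..n}. \<forall>j\<ge>1. i + j > n + 1 \<longrightarrow> entry n x j i = 0)}"

definition sigma_at :: "nat \<Rightarrow> intseq \<Rightarrow> nat \<Rightarrow> int" where
  "sigma_at n x k =
     x k + (\<Sum>j | k < j \<and> x j \<noteq> 0. coroot (iota n k) (alpha n (iota n j)) * x j)"

text \<open>
  For a sequence in \<open>sequences\<close> the maximum below is over a finite set of values, since almost
  all of them are 0.
\<close>

definition sigma_max :: "nat \<Rightarrow> nat \<Rightarrow> intseq \<Rightarrow> int" where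
  "sigma_max n i x = Max (sigma_at n x ` {k. 1 \<le> k \<and> iota n k = i})"

text \<open>This set is finite if \<open>sigma_max n i x > 0\<close>; its maximum is taken only in this case.\<close>

definition M_set :: "nat \<Rightarrow> nat \<Rightarrow> intseq \<Rightarrow> nat set" where
  "M_set n i x = {k. 1 \<le> k \<and> iota n k = i \<and> sigma_at n x k = sigma_max n i x}"

definition Sigma_f :: "nat \<Rightarrow> nat \<Rightarrow> intseq \<Rightarrow> intseq option" where
  "Sigma_f n i x = (let k = (LEAST k. k \<in> M_set n i x) in Some (x(k := x k + 1)))"

definition Sigma_e :: "nat \<Rightarrow> nat \<Rightarrow> intseq \<Rightarrow> intseq option" where
  "Sigma_e n i x =
     (if sigma_max n i x > 0
      then (let k = Max (M_set n i x) in Some (x(k := x k - 1)))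
      else None)"

definition Sigma_wt :: "nat \<Rightarrow> intseq \<Rightarrow> weight" where
  "Sigma_wt n x = - (\<Sum>j | 1 \<le> j \<and> x j \<noteq> 0. frag_cmul (x j) (alpha n (iota n j)))"

definition Sigma_crystal :: "nat \<Rightarrow> intseq crystal" where
  "Sigma_crystal n =
     \<lparr>elems = Sigma_iota n,
      wt = Sigma_wt n,
      e_op = Sigma_e n,
      f_op = Sigma_f n,
      veps = (\<lambda>i x. Fin (sigma_max n i x)),
      vphi = (\<lambda>i x. Fin (coroot i (Sigma_wt n x)) + Fin (sigma_max n i x))\<rparr>"


section \<open>The map between the two realizations\<close>

text \<open>
  The position \<open>m \<ge> 1\<close> of a sequence is \<open>(j - 1) n + i\<close> for a unique \<open>j \<ge> 1\<close> and \<open>1 \<le> i \<le> n\<close>.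
\<close>

definition psi :: "nat \<Rightarrow> tableau \<Rightarrow> intseq" where
  "psi n T = (\<lambda>m.
     if m = 0 then 0
     else
       (let i = iota n m; j = (m - 1) div n + 1
        in if i + j \<le> n + 1 then int (\<Sum>k = 1..i. zb n T (n + 2 - i - j) k) else 0))"

end

theory Submission
  imports Defs
begin

text \<open>
  Both crystals are compared through one set of coordinates. For a marginally large tableau let
  \<open>N r a\<close>, for \<open>r < a\<close>, be the number of boxes in row \<open>r\<close> with entry at least \<open>a\<close>. Such a profile is
  weakly decreasing in \<open>a\<close> and otherwise arbitrary, and it determines the tableau, because marginal
  largeness fixes the column in which each row starts (\<open>MLT_eq_tab_image\<close>). With \<open>a = n + 1 - i\<close> the
  map \<open>\<psi>\<^sub>\<infinity>\<close> only renames the coordinates: \<open>x\<^sub>j\<^sup>(\<^sup>i\<^sup>) = N (a + 1 - j) (a + 1)\<close> (\<open>psi_flip_tab\<close>). The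
  inequalities defining \<open>\<Sigma>\<^sub>\<iota>\<close> say that profiles are decreasing, whence the map is bijective
  (\<open>bij_betw_seq_of\<close>).

  On tableaux, the operators of colour \<open>a\<close> are governed by the height of the signature word, that is
  the number of minus signs minus the number of plus signs read so far. Surviving minus signs are the
  places where the height reaches a new record. Hence their number is the maximal height, the last
  of them is where the maximum is first reached, and the first surviving plus is where the maximum
  is left for the last time (\<open>card_minus\<close>, \<open>Max_minus\<close>, \<open>Least_plus\<close>). In a marginally large tableau
  the rows \<open>1, \<dots>, a\<close> are read one after the other, each with its minus signs before its plus signs,
  so the height has one peak per row. Afterwards every minus sign, in row \<open>a + 1\<close>, directly follows the
  plus sign above it, and the height stays below the last peak. The height \<open>peak_height N a r\<close> of the
  peak of row \<open>r\<close> is an explicit alternating sum of box numbers. Therefore \<open>f\<close> raises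
  \<open>N r (a + 1)\<close> by one at the last highest peak \<open>r\<close>, and \<open>e\<close> lowers it by one at the first
  highest peak (\<open>MLT_f_argmax\<close>, \<open>MLT_e_argmax\<close>); a push of the lower rows occurs exactly if \<open>r = a < n\<close>.

  On sequences, \<open>\<sigma>\<^sub>k\<close> at the position of \<open>x\<^sub>j\<^sup>(\<^sup>i\<^sup>)\<close> is the same number \<open>peak_height N a (a + 1 - j)\<close>
  (\<open>sigma_at_seq_of\<close>). As the order of positions reverses the order of rows, the first maximum of \<open>\<sigma>\<close>
  is the last highest peak, and the operators agree under the renaming (\<open>Sigma_f_seq_of\<close>,
  \<open>Sigma_e_seq_of\<close>).

  The crystal axioms are proved on the side of sequences, where a change of one entry shifts the
  values of \<open>\<sigma>\<close> in a simple way (\<open>Sigma_f_inverse\<close>, \<open>Sigma_e_inverse\<close>), and carried over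
  to tableaux along the bijection (\<open>crystal_iso_transferI\<close>).
\<close>

section \<open>Cancellation in words of plus and minus signs\<close>

lemma cancelsD:
  assumes "cancels P M p q"
  shows "p \<in> P" "q \<in> M" "p < q"
  using assms by (auto elim: cancels.cases)

text \<open>
  Matching depends only on the relative order of the positions. Hence the boxes of a tableau may be
  replaced by natural numbers, where consecutive positions, and so heights, make sense.
\<close>

lemma cancels_image:
  fixes \<kappa> :: "'p::linorder \<Rightarrow> 'q::linorder"
  assumes "strict_mono_on (P \<union> M) \<kappa>" and "cancels P M p q"
  shows "cancels (\<kappa> ` P) (\<kappa> ` M) (\<kappa> p) (\<kappa> q)"
  using assms(2)
proof (induction rule: cancels.induct)
  case (1 p q)
  have mono: "a < b \<longleftrightarrow> \<kappa> a < \<kappa> b" if "a \<in> P \<union> M" "b \<in> P \<union> M" for a b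
    using assms(1) that by (metis strict_mono_on_less)
  show ?case
  proof (rule cancels.intros)
    show "\<kappa> p \<in> \<kappa> ` P" "\<kappa> q \<in> \<kappa> ` M" using 1 by auto
    show "\<kappa> p < \<kappa> q" using mono 1 by blast
    show "\<forall>r'\<in>\<kappa> ` P \<union> \<kappa> ` M. \<kappa> p < r' \<and> r' < \<kappa> q \<longrightarrow>
      (\<exists>s. \<kappa> p < s \<and> s < \<kappa> q \<and>
        (cancels (\<kappa> ` P) (\<kappa> ` M) r' s \<or> cancels (\<kappa> ` P) (\<kappa> ` M) s r'))"
    proof (intro ballI impI)
      fix r' assume "r' \<in> \<kappa> ` P \<union> \<kappa> ` M" and r': "\<kappa> p < r' \<and> r' < \<kappa> q"
      then obtain r where r: "r \<in> P \<union> M" "r' = \<kappa> r" by auto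
      then have "p < r \<and> r < q" using r' 1(1,2) mono by blast
      then obtain s where s: "p < s" "s < q"
        and c: "cancels P M r s \<and> cancels (\<kappa> ` P) (\<kappa> ` M) (\<kappa> r) (\<kappa> s) \<or>
          cancels P M s r \<and> cancels (\<kappa> ` P) (\<kappa> ` M) (\<kappa> s) (\<kappa> r)"
        using 1(4) r(1) by blast
      from c have "s \<in> P \<union> M" using cancelsD by fast
      then have "\<kappa> p < \<kappa> s" "\<kappa> s < \<kappa> q" using s mono 1(1,2) by blast+
      then show "\<exists>s. \<kappa> p < s \<and> s < \<kappa> q \<and>
        (cancels (\<kappa> ` P) (\<kappa> ` M) r' s \<or> cancels (\<kappa> ` P) (\<kappa> ` M) s r')"
        using c r(2) by blast
    qed
  qed
qed

lemma cancels_image_iff: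
  fixes \<kappa> :: "'p::linorder \<Rightarrow> 'q::linorder"
  assumes mono: "strict_mono_on (P \<union> M) \<kappa>" and p: "p \<in> P \<union> M" and q: "q \<in> P \<union> M"
  shows "cancels (\<kappa> ` P) (\<kappa> ` M) (\<kappa> p) (\<kappa> q) \<longleftrightarrow> cancels P M p q"
proof
  let ?g = "inv_into (P \<union> M) \<kappa>"
  have inj: "inj_on \<kappa> (P \<union> M)" using mono by (rule strict_mono_on_imp_inj_on)
  have inv: "?g (\<kappa> a) = a" if "a \<in> P \<union> M" for a using inj that by (rule inv_into_f_f)
  have mono': "strict_mono_on (\<kappa> ` P \<union> \<kappa> ` M) ?g"
  proof (rule strict_mono_onI)
    fix a b assume "a \<in> \<kappa> ` P \<union> \<kappa> ` M" "b \<in> \<kappa> ` P \<union> \<kappa> ` M" "a < b"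
    then obtain a' b' where "a = \<kappa> a'" "b = \<kappa> b'" "a' \<in> P \<union> M" "b' \<in> P \<union> M" by blast
    with \<open>a < b\<close> show "?g a < ?g b" using inv mono strict_mono_on_less by metis
  qed
  have im: "?g ` \<kappa> ` A = A" if "A \<subseteq> P \<union> M" for A
    using inv that by (force simp: image_image subset_iff)
  assume "cancels (\<kappa> ` P) (\<kappa> ` M) (\<kappa> p) (\<kappa> q)"
  from cancels_image [OF mono' this] show "cancels P M p q"
    using im [of P] im [of M] inv p q by simp
qed (use cancels_image [OF mono] in blast)

text \<open>
  A cancelling pair starts and ends at the same height, and the surviving signs can be read off from
  the maxima of this function.
\<close>

definition height :: "nat set \<Rightarrow> nat set \<Rightarrow> nat \<Rightarrow> int" where
  "height P M k = int (card (M \<inter> {..<k})) - int (card (P \<inter> {..<k}))"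

lemma card_Int_lessThan_Suc:
  fixes A :: "nat set"
  shows "card (A \<inter> {..<Suc k}) = card (A \<inter> {..<k}) + (if k \<in> A then 1 else 0)"
  by (simp add: lessThan_Suc)

lemma card_Int_lessThan_add:
  fixes A :: "nat set"
  assumes "j \<le> k"
  shows "card (A \<inter> {..<k}) = card (A \<inter> {..<j}) + card (A \<inter> {j..<k})"
proof -
  have "A \<inter> {..<k} = A \<inter> {..<j} \<union> A \<inter> {j..<k}" using assms by (auto simp: not_le)
  then show ?thesis by (simp add: card_Un_disjoint disjoint_iff)
qed

lemma height_0 [simp]: "height P M 0 = 0"
  by (simp add: height_def)

lemma height_Suc:
  "height P M (Suc k) =
     height P M k + (if k \<in> M then 1 else 0) - (if k \<in> P then 1 else 0)"
  by (simp add: height_def card_Int_lessThan_Suc)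

lemma height_diff:
  assumes "j \<le> k"
  shows "height P M k = height P M j + int (card (M \<inter> {j..<k})) - int (card (P \<inter> {j..<k}))"
  using card_Int_lessThan_add [OF assms] by (simp add: height_def)

context
  fixes P M :: "nat set"
  assumes disj: "P \<inter> M = {}"
begin

private abbreviation "D \<equiv> height P M"

text \<open>
  A cancelling pair delimits an excursion of the height strictly below its starting value. The upper
  bound is proved from left to right and the equality of the end heights from right to left: at a
  minus (plus) in between, its partner lies inside the interval, and the height jumps back to a
  position that is already known.
\<close>

lemma height_cancels:
  assumes "cancels P M p q"
  shows "D (Suc q) = D p \<and> (\<forall>k. p < k \<and> k \<le> q \<longrightarrow> D k < D p)"
  using assms
proof (induction rule: cancels.induct)
  case (1 p q)
  have Dp: "D (Suc p) = D p - 1" and Dq: "D (Suc q) = D q + 1"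
    using 1(1,2) disj by (auto simp: height_Suc)
  have low: "D k < D p" if "p < k" "k \<le> q" for k
    using that
  proof (induction k rule: less_induct)
    case (less k)
    obtain l where l: "k = Suc l" using less.prems by (cases k) auto
    show ?case
    proof (cases "l = p \<or> l \<notin> M")
      case True
      then show ?thesis
        using l less.IH [of l] less.prems Dp by (cases "l = p") (auto simp: height_Suc)
    next
      case False
      then have "p < l" "l < q" "l \<in> M" using l less.prems by auto
      then obtain s where s: "p < s" "s < q"
        and c: "cancels P M l s \<or> cancels P M s l \<and> D (Suc l) = D s"
        using 1(4) by blast
      have "\<not> cancels P M l s" using cancelsD(1) \<open>l \<in> M\<close> disj by blast
      then have "cancels P M s l" "D k = D s" using c l by auto
      then show ?thesis using less.IH [of s] s l cancelsD(3) less.prems by fastforce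
    qed
  qed
  have high: "D k \<le> D q" if "p < k" "k \<le> q" for k
    using that(2,1)
  proof (induction "q - k" arbitrary: k rule: less_induct)
    case less
    show ?case
    proof (cases "k = q \<or> k \<notin> P")
      case True
      show ?thesis
      proof (cases "k = q")
        case False
        then have "D (Suc k) \<le> D q" using less by auto
        then show ?thesis using True False by (auto simp: height_Suc split: if_splits)
      qed simp
    next
      case False
      then have "p < k" "k < q" "k \<in> P" using less.prems by auto
      then obtain s where s: "p < s" "s < q"
        and c: "cancels P M s k \<or> cancels P M k s \<and> D (Suc s) = D k"
        using 1(4) by blast
      have "\<not> cancels P M s k" using cancelsD(2) \<open>k \<in> P\<close> disj by blast
      then have "cancels P M k s" "D k = D (Suc s)" using c by auto
      then show ?thesis using less.hyps [of "Suc s"] s cancelsD(3) [of P M k s] less.prems by auto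
    qed
  qed
  have "D (Suc p) \<le> D q" using high 1(3) by (simp add: Suc_leI)
  moreover have "D q < D p" using low 1(3) by simp
  ultimately have "D (Suc q) = D p" using Dp Dq by simp
  then show ?case using low by blast
qed

text \<open>
  The height moves by at most one per step, so it takes every intermediate value: this lemma gives
  the last crossing of a level on the way down, the next one the first crossing on the way up.
\<close>

lemma last_height_ge:
  assumes "j \<le> k" "v \<le> D j" "D k < v"
  obtains s where "j \<le> s" "s < k" "s \<in> P" "D s = v" "\<forall>l. s < l \<and> l \<le> k \<longrightarrow> D l < v"
proof -
  define s where "s = (GREATEST s. s \<le> k \<and> v \<le> D s)"
  have s: "s \<le> k \<and> v \<le> D s"
    unfolding s_def by (rule GreatestI_nat [of _ j k]) (use assms in auto)
  have above: "\<not> v \<le> D l" if "s < l" "l \<le> k" for l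
    using that Greatest_le_nat [of "\<lambda>s. s \<le> k \<and> v \<le> D s" l k] unfolding s_def by auto
  have js: "j \<le> s" unfolding s_def by (rule Greatest_le_nat [of _ _ k]) (use assms in auto)
  have "s < k" using s assms(3) by (cases "s = k") auto
  then have "D (Suc s) < v" using above [of "Suc s"] by simp
  then have "s \<in> P" "D s = v" using s by (auto simp: height_Suc split: if_splits)
  then show ?thesis using that js \<open>s < k\<close> above by (simp add: not_le)
qed

lemma first_height_ge:
  assumes "j \<le> k" "D j < v" "v \<le> D k"
  obtains s where "j \<le> s" "s < k" "s \<in> M" "D (Suc s) = v" "\<forall>l. j \<le> l \<and> l \<le> s \<longrightarrow> D l < v"
proof -
  define t where "t = (LEAST t. j \<le> t \<and> v \<le> D t)"
  have t: "j \<le> t \<and> v \<le> D t"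
    unfolding t_def by (rule LeastI [of _ k]) (use assms in auto)
  have below: "\<not> v \<le> D l" if "j \<le> l" "l < t" for l
    using that not_less_Least [of l "\<lambda>t. j \<le> t \<and> v \<le> D t"] unfolding t_def by auto
  have tk: "t \<le> k" unfolding t_def by (rule Least_le) (use assms in auto)
  have "j < t" using t assms(2) by (cases "j = t") auto
  then obtain s where s: "t = Suc s" "j \<le> s" by (cases t) auto
  have "D s < v" using below [of s] s by simp
  then have "s \<in> M" "D (Suc s) = v" using t s by (auto simp: height_Suc split: if_splits)
  then show ?thesis using that s below tk by (simp add: not_le Suc_le_eq less_Suc_eq_le)
qed

text \<open>
  The converse of \<open>height_cancels\<close>. A sign inside the excursion finds its partner at the nearest
  crossing of its own level, to the left for a minus and to the right for a plus; the partner stays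
  inside because the whole excursion is below the level of \<open>p\<close>. The induction is on the length.
\<close>

lemma cancels_if_height:
  assumes "p \<in> P" "q \<in> M" "p < q" "D (Suc q) = D p" "\<forall>k. p < k \<and> k \<le> q \<longrightarrow> D k < D p"
  shows "cancels P M p q"
  using assms
proof (induction "q - p" arbitrary: p q rule: less_induct)
  case less
  have Dp: "D (Suc p) = D p - 1" and Dq: "D (Suc q) = D q + 1"
    using less.prems(1,2) disj by (auto simp: height_Suc)
  show ?case
  proof (rule cancels.intros)
    show "\<forall>r\<in>P \<union> M. p < r \<and> r < q \<longrightarrow>
      (\<exists>s. p < s \<and> s < q \<and> (cancels P M r s \<or> cancels P M s r))"
    proof (intro ballI impI, elim conjE UnE)
      fix r assume r: "p < r" "r < q" "r \<in> M"
      then have "r \<notin> P" using disj by auto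
      have Dr: "D (Suc r) = D r + 1" using r \<open>r \<notin> P\<close> by (simp add: height_Suc)
      have "D (Suc r) \<le> D (Suc p)" using Dp less.prems(5) r by force
      then obtain s where s: "Suc p \<le> s" "s < r" "s \<in> P" "D s = D (Suc r)"
        "\<forall>l. s < l \<and> l \<le> r \<longrightarrow> D l < D (Suc r)"
        using last_height_ge [of "Suc p" r "D (Suc r)"] r Dr by auto
      then have "cancels P M s r" using less.hyps [of r s] r by simp
      then show "\<exists>s. p < s \<and> s < q \<and> (cancels P M r s \<or> cancels P M s r)"
        using s r by (intro exI [of _ s]) auto
    next
      fix r assume r: "p < r" "r < q" "r \<in> P"
      then have "r \<notin> M" using disj by auto
      have Dr: "D (Suc r) = D r - 1" using r \<open>r \<notin> M\<close> by (simp add: height_Suc)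
      have "D r \<le> D q" using Dq less.prems(4,5) r by force
      then obtain s where s: "Suc r \<le> s" "s < q" "s \<in> M" "D (Suc s) = D r"
        "\<forall>l. Suc r \<le> l \<and> l \<le> s \<longrightarrow> D l < D r"
        using first_height_ge [of "Suc r" q "D r"] r Dr by auto
      then have "cancels P M r s" using less.hyps [of s r] r by (simp add: Suc_le_eq)
      then show "\<exists>s. p < s \<and> s < q \<and> (cancels P M r s \<or> cancels P M s r)"
        using s r by (intro exI [of _ s]) auto
    qed
  qed (use less.prems in auto)
qed

text \<open>
  A surviving minus is a place where the height reaches a new record, and dually a surviving plus is
  a place from which the height drops for good.
\<close>

lemma uncancelled_minus_iff:
  assumes "q \<in> M"
  shows "\<not> (\<exists>p. cancels P M p q) \<longleftrightarrow> (\<forall>k\<le>q. D k < D (Suc q))"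
proof
  assume unc: "\<not> (\<exists>p. cancels P M p q)"
  show "\<forall>k\<le>q. D k < D (Suc q)"
  proof (rule ccontr)
    assume "\<not> ?thesis"
    then obtain k where "k \<le> q" "D (Suc q) \<le> D k" by (auto simp: not_less)
    moreover have "D q < D (Suc q)" using assms disj by (auto simp: height_Suc)
    ultimately obtain s where "s < q" "s \<in> P" "D s = D (Suc q)"
      "\<forall>l. s < l \<and> l \<le> q \<longrightarrow> D l < D (Suc q)"
      by (rule last_height_ge)
    then have "cancels P M s q" using cancels_if_height assms by simp
    then show False using unc by blast
  qed
next
  assume "\<forall>k\<le>q. D k < D (Suc q)"
  then show "\<not> (\<exists>p. cancels P M p q)"
    using height_cancels cancelsD(3) by (metis less_imp_le_nat less_irrefl)
qed

lemma uncancelled_plus_iff: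
  assumes "p \<in> P"
  shows "\<not> (\<exists>q. cancels P M p q) \<longleftrightarrow> (\<forall>k>p. D k < D p)"
proof
  assume unc: "\<not> (\<exists>q. cancels P M p q)"
  show "\<forall>k>p. D k < D p"
  proof (rule ccontr)
    assume "\<not> ?thesis"
    then obtain k where "Suc p \<le> k" "D p \<le> D k" by (auto simp: not_less Suc_le_eq)
    moreover have "D (Suc p) < D p" using assms disj by (auto simp: height_Suc)
    ultimately obtain s where "Suc p \<le> s" "s \<in> M" "D (Suc s) = D p"
      "\<forall>l. Suc p \<le> l \<and> l \<le> s \<longrightarrow> D l < D p"
      by (meson first_height_ge)
    then have "cancels P M p s" using cancels_if_height assms by (simp add: Suc_le_eq)
    then show False using unc by blast
  qed
next
  assume "\<forall>k>p. D k < D p"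
  then show "\<not> (\<exists>q. cancels P M p q)"
    using height_cancels cancelsD(3) by (metis less_SucI less_irrefl)
qed

text \<open>
  Each value from 1 to the maximal height is reached for the first time at exactly one surviving
  minus.
\<close>

lemma card_uncancelled_minus:
  assumes max: "\<forall>k. D k \<le> int m" and att: "D l = int m"
  shows "finite {q \<in> M. \<not> (\<exists>p. cancels P M p q)}"
    and "card {q \<in> M. \<not> (\<exists>p. cancels P M p q)} = m"
proof -
  let ?S = "{q \<in> M. \<not> (\<exists>p. cancels P M p q)}"
  have "bij_betw (\<lambda>q. D (Suc q)) ?S {1..int m}"
    unfolding bij_betw_def
  proof
    show "inj_on (\<lambda>q. D (Suc q)) ?S"
    proof (rule linorder_inj_onI')
      fix q q' assume "q \<in> ?S" "q' \<in> ?S" "q < q'"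
      then have "D (Suc q) < D (Suc q')" using uncancelled_minus_iff [of q'] by auto
      then show "D (Suc q) \<noteq> D (Suc q')" by simp
    qed
    show "(\<lambda>q. D (Suc q)) ` ?S = {1..int m}"
    proof (intro equalityI subsetI)
      fix v assume "v \<in> (\<lambda>q. D (Suc q)) ` ?S"
      then obtain q where q: "q \<in> ?S" "v = D (Suc q)" by blast
      then have "D 0 < v" using uncancelled_minus_iff [of q] by auto
      then show "v \<in> {1..int m}" using q max by simp
    next
      fix v assume v: "v \<in> {1..int m}"
      then obtain s where "s \<in> M" "D (Suc s) = v" "\<forall>l\<le>s. D l < v"
        using first_height_ge [of 0 l v] att by auto
      then show "v \<in> (\<lambda>q. D (Suc q)) ` ?S"
        using uncancelled_minus_iff [of s] by (intro image_eqI [of _ _ s]) auto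
    qed
  qed
  then show "finite ?S" "card ?S = m"
    using bij_betw_finite bij_betw_same_card by fastforce+
qed

lemma Max_uncancelled_minus:
  assumes max: "\<forall>k. D k \<le> int m" and q: "q \<in> M" "D (Suc q) = int m" "\<forall>k\<le>q. D k < int m"
  shows "Max {q \<in> M. \<not> (\<exists>p. cancels P M p q)} = q"
proof (rule Max_eqI)
  show "finite {q \<in> M. \<not> (\<exists>p. cancels P M p q)}"
    using card_uncancelled_minus(1) max q(2) by blast
  show "q \<in> {q \<in> M. \<not> (\<exists>p. cancels P M p q)}" using q uncancelled_minus_iff by simp
  fix q' assume "q' \<in> {q \<in> M. \<not> (\<exists>p. cancels P M p q)}"
  then have "\<forall>k\<le>q'. D k < D (Suc q')" using uncancelled_minus_iff by blast
  then have "\<not> Suc q \<le> q'" using max q(2) by (metis not_le)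
  then show "q' \<le> q" by simp
qed

lemma Least_uncancelled_plus:
  assumes max: "\<forall>k. D k \<le> D p" and p: "p \<in> P" "\<forall>k>p. D k < D p"
  shows "(LEAST p. p \<in> {p \<in> P. \<not> (\<exists>q. cancels P M p q)}) = p"
proof (rule Least_equality)
  show "p \<in> {p \<in> P. \<not> (\<exists>q. cancels P M p q)}" using p uncancelled_plus_iff by simp
  fix p' assume "p' \<in> {p \<in> P. \<not> (\<exists>q. cancels P M p q)}"
  then have "\<forall>k>p'. D k < D p'" using uncancelled_plus_iff by blast
  then show "p \<le> p'" using max by (metis not_le)
qed

end

text \<open>
  The same results for positions in any linear order, read through a strictly increasing numbering
  \<open>\<kappa>\<close>. The rightmost surviving minus is where the height first reaches its maximum, and the
  leftmost surviving plus is where the height leaves its maximum for the last time.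
\<close>

context
  fixes P M :: "'p::linorder set" and \<kappa> :: "'p \<Rightarrow> nat"
  assumes mono: "strict_mono_on (P \<union> M) \<kappa>" and disj: "P \<inter> M = {}"
begin

private abbreviation "word_height \<equiv> height (\<kappa> ` P) (\<kappa> ` M)"

private lemma disj': "\<kappa> ` P \<inter> \<kappa> ` M = {}"
proof -
  have "\<kappa> p \<noteq> \<kappa> q" if "p \<in> P" "q \<in> M" for p q
    using strict_mono_on_imp_inj_on [OF mono] that disj by (auto dest: inj_onD)
  then show ?thesis by blast
qed

private lemma key_eqD: "p \<in> P \<union> M \<Longrightarrow> q \<in> P \<union> M \<Longrightarrow> \<kappa> p = \<kappa> q \<Longrightarrow> p = q"
  using strict_mono_on_imp_inj_on [OF mono] by (rule inj_onD)

private lemma le_iff: "p \<in> P \<union> M \<Longrightarrow> q \<in> P \<union> M \<Longrightarrow> \<kappa> p \<le> \<kappa> q \<longleftrightarrow> p \<le> q"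
  using mono by (simp add: strict_mono_on_less_eq)

private lemma uncancelled_minus_image:
  "\<kappa> ` {q \<in> M. \<not> (\<exists>p. cancels P M p q)} =
   {q \<in> \<kappa> ` M. \<not> (\<exists>p. cancels (\<kappa> ` P) (\<kappa> ` M) p q)}"
proof -
  have "(\<exists>p. cancels P M p q) \<longleftrightarrow> (\<exists>p. cancels (\<kappa> ` P) (\<kappa> ` M) p (\<kappa> q))" if q: "q \<in> M" for q
  proof
    assume "\<exists>p. cancels (\<kappa> ` P) (\<kappa> ` M) p (\<kappa> q)"
    then obtain p' where p': "cancels (\<kappa> ` P) (\<kappa> ` M) p' (\<kappa> q)" by blast
    with cancelsD(1) obtain p where "p \<in> P" "p' = \<kappa> p" by blast
    then show "\<exists>p. cancels P M p q" using p' cancels_image_iff [OF mono, of p q] q by blast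
  qed (use cancels_image [OF mono] in blast)
  then show ?thesis by blast
qed

private lemma uncancelled_plus_image:
  "\<kappa> ` {p \<in> P. \<not> (\<exists>q. cancels P M p q)} =
   {p \<in> \<kappa> ` P. \<not> (\<exists>q. cancels (\<kappa> ` P) (\<kappa> ` M) p q)}"
proof -
  have "(\<exists>q. cancels P M p q) \<longleftrightarrow> (\<exists>q. cancels (\<kappa> ` P) (\<kappa> ` M) (\<kappa> p) q)" if p: "p \<in> P" for p
  proof
    assume "\<exists>q. cancels (\<kappa> ` P) (\<kappa> ` M) (\<kappa> p) q"
    then obtain q' where q': "cancels (\<kappa> ` P) (\<kappa> ` M) (\<kappa> p) q'" by blast
    with cancelsD(2) obtain q where "q \<in> M" "q' = \<kappa> q" by blast
    then show "\<exists>q. cancels P M p q" using q' cancels_image_iff [OF mono, of p q] p by blast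
  qed (use cancels_image [OF mono] in blast)
  then show ?thesis by blast
qed

lemma card_minus:
  assumes "\<forall>k. word_height k \<le> int m" "word_height l = int m"
  shows "finite {q \<in> M. \<not> (\<exists>p. cancels P M p q)}"
    and "card {q \<in> M. \<not> (\<exists>p. cancels P M p q)} = m"
proof -
  let ?S = "{q \<in> M. \<not> (\<exists>p. cancels P M p q)}"
  have inj: "inj_on \<kappa> ?S"
    using strict_mono_on_imp_inj_on [OF mono] by (rule inj_on_subset) auto
  note c = card_uncancelled_minus [OF disj' assms]
  show "finite ?S" using c(1) inj unfolding uncancelled_minus_image [symmetric]
    by (rule finite_imageD)
  show "card ?S = m" using c(2) inj unfolding uncancelled_minus_image [symmetric]
    by (simp add: card_image)
qed

lemma Max_minus:
  assumes "\<forall>k. word_height k \<le> int m" "q \<in> M" "word_height (Suc (\<kappa> q)) = int m" "\<forall>k\<le>\<kappa> q. word_height k < int m"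
  shows "Max {q \<in> M. \<not> (\<exists>p. cancels P M p q)} = q"
proof (rule Max_eqI)
  let ?S = "{q \<in> M. \<not> (\<exists>p. cancels P M p q)}"
  have fin: "finite (\<kappa> ` ?S)"
    unfolding uncancelled_minus_image using card_uncancelled_minus(1) [OF disj' assms(1,3)] .
  have max: "Max (\<kappa> ` ?S) = \<kappa> q"
    unfolding uncancelled_minus_image
    by (rule Max_uncancelled_minus [OF disj' assms(1)]) (use assms in auto)
  show "finite ?S" using card_minus(1) [OF assms(1,3)] .
  show "q \<in> ?S"
  proof -
    have "\<kappa> q \<in> \<kappa> ` ?S"
      unfolding uncancelled_minus_image
      using uncancelled_minus_iff [OF disj', of "\<kappa> q"] assms by auto
    then obtain q' where "q' \<in> ?S" "\<kappa> q' = \<kappa> q" by auto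
    then show ?thesis using key_eqD [of q' q] assms(2) by blast
  qed
  fix q' assume "q' \<in> ?S"
  then have "\<kappa> q' \<in> \<kappa> ` ?S" by (rule imageI)
  then have "\<kappa> q' \<le> \<kappa> q" unfolding max [symmetric] by (rule Max_ge [OF fin])
  then show "q' \<le> q" using le_iff \<open>q' \<in> ?S\<close> assms(2) by blast
qed

lemma Least_plus:
  assumes "\<forall>k. word_height k \<le> word_height (\<kappa> p)" "p \<in> P" "\<forall>k>\<kappa> p. word_height k < word_height (\<kappa> p)"
  shows "(LEAST p. p \<in> {p \<in> P. \<not> (\<exists>q. cancels P M p q)}) = p"
proof (rule Least_equality)
  let ?S = "{p \<in> P. \<not> (\<exists>q. cancels P M p q)}"
  have "\<kappa> p \<in> \<kappa> ` ?S"
    unfolding uncancelled_plus_image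
    using uncancelled_plus_iff [OF disj', of "\<kappa> p"] assms by auto
  then obtain p' where "p' \<in> ?S" "\<kappa> p' = \<kappa> p" by auto
  then show "p \<in> ?S"
    using key_eqD [of p' p] assms(2) by blast
  fix p' assume p': "p' \<in> ?S"
  then have "\<kappa> p' \<in> {p \<in> \<kappa> ` P. \<not> (\<exists>q. cancels (\<kappa> ` P) (\<kappa> ` M) p q)}"
    unfolding uncancelled_plus_image [symmetric] by blast
  then have "(LEAST p. p \<in> {p \<in> \<kappa> ` P. \<not> (\<exists>q. cancels (\<kappa> ` P) (\<kappa> ` M) p q)}) \<le> \<kappa> p'"
    by (rule Least_le)
  then have "\<kappa> p \<le> \<kappa> p'"
    using Least_uncancelled_plus [OF disj' assms(1) imageI [OF assms(2)] assms(3)] by simp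
  then show "p \<le> p'" using le_iff p' assms(2) by blast
qed

end

section \<open>Row profiles of marginally large tableaux\<close>

text \<open>
  The coordinates used throughout: \<open>N r a\<close> stands for the number of boxes in row \<open>r\<close> with entry at
  least \<open>a\<close>. It is meaningful for \<open>r < a \<le> n + 1\<close>, since the entries \<open>r\<close> of row \<open>r\<close> are infinitely
  many; the value 0 elsewhere makes a profile unique as a function, and it also supplies the
  boundary terms of the formulas below (row 0, entry \<open>n + 2\<close>).
\<close>

definition profiles :: "nat \<Rightarrow> (nat \<Rightarrow> nat \<Rightarrow> nat) set" where
  "profiles n = {N. (\<forall>r a. N r a \<noteq> 0 \<longrightarrow> 1 \<le> r \<and> r < a \<and> a \<le> n + 1) \<and>
                    (\<forall>r a. r < a \<longrightarrow> N r (Suc a) \<le> N r a)}"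

lemma profile_eq_0:
  assumes "N \<in> profiles n" "r = 0 \<or> a \<le> r \<or> n + 1 < a"
  shows "N r a = 0"
proof (rule ccontr)
  assume "N r a \<noteq> 0"
  then have "1 \<le> r \<and> r < a \<and> a \<le> n + 1" using assms(1) by (simp add: profiles_def)
  with assms(2) show False by auto
qed

lemma profile_antimono:
  assumes "N \<in> profiles n" "r < a" "a \<le> b"
  shows "N r b \<le> N r a"
  using assms(3)
proof (induction b rule: dec_induct)
  case (step b)
  then have "N r (Suc b) \<le> N r b" using assms by (auto simp: profiles_def)
  then show ?case using step by simp
qed simp

text \<open>
  The column, counted from the right, of the last box of row \<open>r\<close>. To the right of the last box of
  row \<open>r + 1\<close>, row \<open>r\<close> has all its entries exceeding \<open>r\<close> and, by marginal largeness, one further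
  entry \<open>r\<close>.
\<close>

definition row_start :: "(nat \<Rightarrow> nat \<Rightarrow> nat) \<Rightarrow> nat \<Rightarrow> nat" where
  "row_start N r = (\<Sum>s = 1..<r. N s (Suc s) + 1)"

lemma row_start_1 [simp]: "row_start N (Suc 0) = 0"
  by (simp add: row_start_def)

lemma row_start_Suc: "1 \<le> r \<Longrightarrow> row_start N (Suc r) = row_start N r + N r (Suc r) + 1"
  by (simp add: row_start_def)

lemma row_start_mono:
  assumes "r \<le> s"
  shows "row_start N r \<le> row_start N s"
  unfolding row_start_def by (rule sum_mono2) (use assms in auto)

lemma row_start_less:
  assumes "1 \<le> r" "r < s"
  shows "row_start N r + N r (Suc r) < row_start N s"
  using row_start_Suc [OF assms(1), of N] row_start_mono [of "Suc r" s N] assms(2) by simp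

text \<open>
  The infinite tableau with profile \<open>N\<close>: going left along row \<open>r\<close> from its last box, the entries
  exceeding \<open>a\<close> come first and occupy \<open>N r (Suc a)\<close> boxes.
\<close>

definition tab :: "nat \<Rightarrow> (nat \<Rightarrow> nat \<Rightarrow> nat) \<Rightarrow> tableau" where
  "tab n N = (\<lambda>(c, r).
     if r \<in> {1..n} \<and> row_start N r \<le> c
     then Some (LEAST a. r \<le> a \<and> row_start N r + N r (Suc a) \<le> c) else None)"

lemma tab_eq_None: "tab n N (c, r) = None \<longleftrightarrow> \<not> (r \<in> {1..n} \<and> row_start N r \<le> c)"
  by (simp add: tab_def)

lemma tab_eq_Some:
  assumes N: "N \<in> profiles n"
  shows "tab n N (c, r) = Some a \<longleftrightarrow>
    r \<in> {1..n} \<and> row_start N r \<le> c \<and> r \<le> a \<and> (a = r \<or> c < row_start N r + N r a) \<and>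
    row_start N r + N r (Suc a) \<le> c" (is "_ \<longleftrightarrow> ?R a")
proof (cases "r \<in> {1..n} \<and> row_start N r \<le> c")
  case True
  let ?Q = "\<lambda>a. r \<le> a \<and> row_start N r + N r (Suc a) \<le> c"
  define l where "l = (LEAST a. ?Q a)"
  \<comment> \<open>beyond the entry \<open>n + 1\<close> the profile vanishes\<close>
  have "?Q (n + r + 1)" using True profile_eq_0 [OF N, of r "Suc (n + r + 1)"] by simp
  then have l: "?Q l" unfolding l_def by (rule LeastI)
  have least: "l \<le> a" if "?Q a" for a unfolding l_def using that by (rule Least_le)
  have "?R l"
  proof -
    have "l = r \<or> c < row_start N r + N r l"
    proof (rule ccontr)
      assume "\<not> ?thesis"
      then have "?Q (l - 1)" "r < l" using l by auto
      then show False using least [of "l - 1"] by auto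
    qed
    then show ?thesis using l True by simp
  qed
  moreover have "a = l" if "?R a"
  proof (rule ccontr)
    assume "a \<noteq> l"
    moreover have "l \<le> a" using least that by blast
    ultimately have "l < a" by simp
    then have "N r a \<le> N r (Suc l)" using profile_antimono [OF N, of r "Suc l" a] l by simp
    then show False using that l \<open>l < a\<close> by auto
  qed
  moreover have "tab n N (c, r) = Some l" using True by (simp add: tab_def l_def)
  ultimately show ?thesis by auto
qed (auto simp: tab_def)

lemma tab_row_antimono:
  assumes N: "N \<in> profiles n"
    and "tab n N (c, r) = Some a" "tab n N (c', r) = Some a'" "c' \<le> c"
  shows "a \<le> a'"
proof (rule ccontr)
  assume "\<not> a \<le> a'"
  then have "N r a \<le> N r (Suc a')"
    using profile_antimono [OF N, of r "Suc a'" a] assms by (auto simp: tab_eq_Some)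
  then show False using assms \<open>\<not> a \<le> a'\<close> by (auto simp: tab_eq_Some)
qed

lemma tab_entry_le:
  assumes "N \<in> profiles n" "tab n N (c, r) = Some a"
  shows "r \<le> a" "a \<le> n + 1"
proof -
  show "r \<le> a" using assms by (simp add: tab_eq_Some)
  show "a \<le> n + 1"
  proof (rule ccontr)
    assume "\<not> a \<le> n + 1"
    then show False using assms profile_eq_0 [OF assms(1), of r a] by (auto simp: tab_eq_Some)
  qed
qed

text \<open>
  Marginal largeness in a form that can be tested at a single box: row \<open>r + 1\<close> begins exactly one
  column to the left of the rightmost \<open>r\<close>-box of row \<open>r\<close>. It shows that certain modified tableaux are
  not marginally large.
\<close>

lemma tab_diagonal_iff:
  assumes N: "N \<in> profiles n" and "1 \<le> r" "r < n"
  shows "tab n N (c, r) = Some r \<longleftrightarrow> tab n N (Suc c, Suc r) \<noteq> None"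
  using assms row_start_Suc [of r N] by (auto simp: tab_eq_Some tab_eq_None)

text \<open>
  The finite tableau behind \<open>tab n N\<close> is the part in the columns below \<open>row_start N (n + 1)\<close>, which
  is the column where the row below the last one would start. Columns are strictly increasing
  because in every column that meets row \<open>r + 1\<close> the entry of row \<open>r\<close> is \<open>r\<close> itself.
\<close>

lemma tab_in_MLT:
  assumes N: "N \<in> profiles n" and n: "1 \<le> n"
  shows "tab n N \<in> MLT n"
proof -
  define t where "t = row_start N (n + 1)"
  define S where
    "S = map (\<lambda>r. map (\<lambda>p. the (tab n N (t - 1 - p, r))) [0..<t - row_start N r]) [1..<n + 1]"
  have len: "length S = n" by (simp add: S_def)
  have row: "S ! (r - 1) = map (\<lambda>p. the (tab n N (t - 1 - p, r))) [0..<t - row_start N r]"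
    if "r \<in> {1..n}" for r
  proof -
    have "r - 1 < n" "[1..<n + 1] ! (r - 1) = r" using that nth_upt [of 1 "r - 1" "n + 1"] by auto
    then show ?thesis unfolding S_def by (subst nth_map) auto
  qed
  have off_t: "row_start N r + N r (Suc r) < t" if "r \<in> {1..n}" for r
    using row_start_less [of r "n + 1" N] that by (simp add: t_def)
  have entry: "tab n N (t - 1 - p, r) = Some (S ! (r - 1) ! p)"
    if "r \<in> {1..n}" "p < t - row_start N r" for r p
  proof -
    have "tab n N (t - 1 - p, r) \<noteq> None" using that by (auto simp: tab_eq_None)
    then show ?thesis using row that by auto
  qed
  have diag: "tab n N (c, r) = Some r \<longleftrightarrow> row_start N r + N r (Suc r) \<le> c" if "r \<in> {1..n}" for r c
    using that N by (auto simp: tab_eq_Some)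
  have row_len: "length (S ! (r - 1)) = t - row_start N r" if "r \<in> {1..n}" for r
    using row that by simp
  have cond: "R \<noteq> [] \<and> set R \<subseteq> {1..n + 1} \<and> sorted R" if "R \<in> set S" for R
  proof -
    from that obtain r where "r \<in> {1..n}" "R = S ! (r - 1)"
      using len by (auto simp: in_set_conv_nth) (metis One_nat_def Suc_leI diff_Suc_1 le_add1
          le_imp_less_Suc less_Suc_eq_le plus_1_eq_Suc)
    note r = this
    have "R \<noteq> []" using row_len [OF r(1)] off_t [OF r(1)] r(2) by auto
    moreover have "set R \<subseteq> {1..n + 1}"
    proof
      fix v assume "v \<in> set R"
      then obtain p where p: "p < t - row_start N r" "v = R ! p"
        using row_len r by (auto simp: in_set_conv_nth)
      then have "tab n N (t - 1 - p, r) = Some v" using entry r by simp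
      then show "v \<in> {1..n + 1}" using tab_entry_le [OF N] r(1) by fastforce
    qed
    moreover have "sorted R"
      unfolding sorted_iff_nth_mono
    proof (intro allI impI)
      fix p q assume "p \<le> q" "q < length R"
      then have "tab n N (t - 1 - p, r) = Some (R ! p)" "tab n N (t - 1 - q, r) = Some (R ! q)"
        using entry r row_len by auto
      then show "R ! p \<le> R ! q" by (rule tab_row_antimono [OF N]) (use \<open>p \<le> q\<close> in simp)
    qed
    ultimately show ?thesis by blast
  qed
  have col: "length (S ! (r + 1)) \<le> length (S ! r) \<and>
    (\<forall>p < length (S ! (r + 1)). S ! r ! p < S ! (r + 1) ! p)" if "r + 1 < n" for r
  proof -
    have r: "r + 1 \<in> {1..n}" "r + 2 \<in> {1..n}" using that by auto
    have off2: "row_start N (r + 2) = row_start N (r + 1) + N (r + 1) (Suc (r + 1)) + 1"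
      using row_start_Suc [of "r + 1" N] by simp
    have l: "length (S ! (r + 1)) = t - row_start N (r + 2)" "length (S ! r) = t - row_start N (r + 1)"
      using row_len [OF r(1)] row_len [OF r(2)] by auto
    have "S ! r ! p < S ! (r + 1) ! p" if p: "p < t - row_start N (r + 2)" for p
    proof -
      have "tab n N (t - 1 - p, r + 1) = Some (S ! r ! p)"
        using entry [OF r(1), of p] p off2 by simp
      moreover have "tab n N (t - 1 - p, r + 1) = Some (r + 1)"
        unfolding diag [OF r(1)] using p off2 by simp
      ultimately have "S ! r ! p = r + 1" by simp
      moreover have "tab n N (t - 1 - p, r + 2) = Some (S ! (r + 1) ! p)"
        using entry [OF r(2), of p] p by simp
      ultimately show ?thesis using tab_entry_le(1) [OF N] by fastforce
    qed
    then show ?thesis using l off2 by simp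
  qed
  have count: "count_list (S ! (r - 1)) r = (if r < n then length (S ! r) else 0) + 1"
    if r: "r \<in> {1..n}" for r
  proof -
    have "count_list (S ! (r - 1)) r = card {p. p < t - row_start N r \<and> S ! (r - 1) ! p = r}"
      using row_len [OF r] by (simp add: count_list_eq_length_filter length_filter_conv_card eq_commute)
    also have "{p. p < t - row_start N r \<and> S ! (r - 1) ! p = r} = {..<t - row_start N r - N r (Suc r)}"
    proof -
      have "S ! (r - 1) ! p = r \<longleftrightarrow> p < t - row_start N r - N r (Suc r)" if p: "p < t - row_start N r" for p
        using entry [OF r p] diag [OF r, of "t - 1 - p"] p by auto
      then show ?thesis by auto
    qed
    also have "card \<dots> = t - row_start N (Suc r) + 1"
      using row_start_Suc [of r N] r off_t [OF r] by simp
    also have "\<dots> = (if r < n then length (S ! r) else 0) + 1"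
      using row_len [of "Suc r"] r by (auto simp: t_def)
    finally show ?thesis .
  qed
  have "marginally_large n S"
    unfolding marginally_large_def semistandard_def using len cond col count by blast
  moreover have "extend_left n S = tab n N"
  proof
    fix b :: box
    obtain c r where b: "b = (c, r)" by (cases b)
    have t: "length (S ! 0) = t" using row_len [of 1] n by simp
    show "extend_left n S b = tab n N b"
    proof (cases "r \<in> {1..n}")
      case r: True
      show ?thesis
      proof (cases "c < t")
        case True
        then have "t - 1 - c < t - row_start N r \<longleftrightarrow> row_start N r \<le> c" "t - 1 - (t - 1 - c) = c"
          using off_t [OF r] by auto
        then show ?thesis
          using True r entry [OF r, of "t - 1 - c"] row_len [OF r] t
          by (auto simp: b extend_left_def tab_def)
      next
        case False
        then have "tab n N (c, r) = Some r" using diag off_t [OF r] r by simp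
        then show ?thesis using False r t by (simp add: b extend_left_def)
      qed
    next
      case False
      then show ?thesis by (auto simp: b extend_left_def tab_def)
    qed
  qed
  ultimately show ?thesis unfolding MLT_def by (metis image_eqI mem_Collect_eq)
qed

lemma sorted_nth_ge_iff:
  fixes xs :: "nat list"
  assumes "sorted xs" "p < length xs"
  shows "a \<le> xs ! p \<longleftrightarrow> length xs \<le> p + card {q. q < length xs \<and> a \<le> xs ! q}"
proof
  let ?A = "{q. q < length xs \<and> a \<le> xs ! q}"
  assume "a \<le> xs ! p"
  then have "{p..<length xs} \<subseteq> ?A" using assms sorted_nth_mono [OF assms(1)] by (auto intro: order_trans)
  then have "card {p..<length xs} \<le> card ?A" by (intro card_mono) auto
  then show "length xs \<le> p + card ?A" by simp
next
  let ?A = "{q. q < length xs \<and> a \<le> xs ! q}"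
  assume le: "length xs \<le> p + card ?A"
  show "a \<le> xs ! p"
  proof (rule ccontr)
    assume "\<not> a \<le> xs ! p"
    then have "\<not> q \<le> p" if "q \<in> ?A" for q
      using sorted_nth_mono [OF assms(1), of q p] assms(2) that by auto
    then have "?A \<subseteq> {Suc p..<length xs}" by (auto simp: not_le Suc_le_eq)
    then have "card ?A \<le> card {Suc p..<length xs}" by (intro card_mono) auto
    then show False using le assms(2) by simp
  qed
qed

text \<open>
  Every marginally large tableau is recovered from its profile: the entries of a sorted row are
  determined by the numbers of large entries, and marginal largeness fixes where each row starts.
\<close>

lemma MLT_eq_tab_image:
  assumes n: "1 \<le> n"
  shows "MLT n = tab n ` profiles n"
proof
  show "tab n ` profiles n \<subseteq> MLT n" using tab_in_MLT n by blast
  show "MLT n \<subseteq> tab n ` profiles n"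
  proof
    fix T assume "T \<in> MLT n"
    then obtain S where ml: "marginally_large n S" and T: "T = extend_left n S"
      by (auto simp: MLT_def)
    define N where "N = (\<lambda>r a. if r \<in> {1..n} \<and> r < a
      then card {p. p < length (S ! (r - 1)) \<and> a \<le> S ! (r - 1) ! p} else 0)"
    have len: "length S = n"
      and rows: "\<And>R. R \<in> set S \<Longrightarrow> R \<noteq> [] \<and> set R \<subseteq> {1..n + 1} \<and> sorted R"
      and cols: "\<And>r. r + 1 < n \<Longrightarrow> length (S ! (r + 1)) \<le> length (S ! r) \<and>
        (\<forall>p < length (S ! (r + 1)). S ! r ! p < S ! (r + 1) ! p)"
      and count: "\<And>r. r \<in> {1..n} \<Longrightarrow>
        count_list (S ! (r - 1)) r = (if r < n then length (S ! r) else 0) + 1"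
      using ml by (auto simp: marginally_large_def semistandard_def)
    have row: "sorted (S ! (r - 1))"
      "p < length (S ! (r - 1)) \<Longrightarrow> S ! (r - 1) ! p \<in> {1..n + 1}" if "r \<in> {1..n}" for r p
      using rows [of "S ! (r - 1)"] that len nth_mem by force+
    have ge: "r \<le> S ! (r - 1) ! p" if "1 \<le> r" "r \<le> n" "p < length (S ! (r - 1))" for r p
      using that
    proof (induction r rule: dec_induct)
      case base
      then show ?case using row(2) [of 1 p] by simp
    next
      case (step r)
      then obtain r' where r': "r = r' + 1" by (metis add.commute le_Suc_ex)
      have "p < length (S ! (r' + 1))" "r' + 1 < n" using step.prems r' by auto
      then have "S ! r' ! p < S ! (r' + 1) ! p" "p < length (S ! r')" using cols [of r'] by auto
      moreover have "r \<le> S ! (r - 1) ! p" using step r' calculation by simp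
      ultimately show ?case using r' by simp
    qed
    have prof: "N \<in> profiles n"
      unfolding profiles_def
    proof (intro CollectI conjI allI impI)
      fix r a assume "N r a \<noteq> 0"
      then have r: "r \<in> {1..n}" "r < a"
        and "card {p. p < length (S ! (r - 1)) \<and> a \<le> S ! (r - 1) ! p} \<noteq> 0"
        unfolding N_def by presburger+
      then have "{p. p < length (S ! (r - 1)) \<and> a \<le> S ! (r - 1) ! p} \<noteq> {}"
        by (metis card.empty)
      then obtain p where "p < length (S ! (r - 1))" "a \<le> S ! (r - 1) ! p" by blast
      then have "a \<le> n + 1" using row(2) [OF r(1), of p] by simp
      then show "1 \<le> r" "r < a" "a \<le> n + 1" using r by auto
    next
      fix r a :: nat
      assume "r < a"
      then show "N r (Suc a) \<le> N r a" by (auto simp: N_def intro!: card_mono)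
    qed
    have N_row: "a \<le> S ! (r - 1) ! p \<longleftrightarrow> length (S ! (r - 1)) \<le> p + N r a"
      if "r \<in> {1..n}" "r < a" "p < length (S ! (r - 1))" for r a p
      using sorted_nth_ge_iff [OF row(1)] that by (simp add: N_def)
    have length_row: "length (S ! (r - 1)) = N r (Suc r) + (if r < n then length (S ! r) else 0) + 1"
      if r: "r \<in> {1..n}" for r
    proof -
      let ?R = "S ! (r - 1)"
      have "?R ! p = r \<or> Suc r \<le> ?R ! p" if "p < length ?R" for p
        using ge [of r p] r that by (simp add: Suc_le_eq) linarith
      then have "{..<length ?R} = {p. p < length ?R \<and> ?R ! p = r} \<union> {p. p < length ?R \<and> Suc r \<le> ?R ! p}"
        by blast
      then have "card {..<length ?R} = card {p. p < length ?R \<and> ?R ! p = r} +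
          card {p. p < length ?R \<and> Suc r \<le> ?R ! p}"
        by (simp add: card_Un_disjoint disjoint_iff)
      also have "card {p. p < length ?R \<and> ?R ! p = r} = count_list ?R r"
        by (simp add: count_list_eq_length_filter length_filter_conv_card eq_commute)
      also have "card {p. p < length ?R \<and> Suc r \<le> ?R ! p} = N r (Suc r)"
        using r by (simp add: N_def)
      finally show ?thesis using count [OF r] by simp
    qed
    have row_start_row: "row_start N r + length (S ! (r - 1)) = length (S ! 0)" if "1 \<le> r" "r \<le> n" for r
      using that
    proof (induction r rule: dec_induct)
      case (step r)
      then show ?case using length_row [of r] row_start_Suc [of r N] by simp
    qed simp
    have "extend_left n S = tab n N"
    proof
      fix b :: box
      obtain c r where b: "b = (c, r)" by (cases b)
      show "extend_left n S b = tab n N b"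
      proof (cases "r \<in> {1..n}")
        case r: True
        let ?R = "S ! (r - 1)"
        have offr: "row_start N r + length ?R = length (S ! 0)" using row_start_row r by simp
        show ?thesis
        proof (cases "c < length (S ! 0)")
          case True
          let ?p = "length (S ! 0) - 1 - c"
          show ?thesis
          proof (cases "?p < length ?R")
            case p: True
            define v where "v = ?R ! ?p"
            have "r \<le> v" using ge r p by (simp add: v_def)
            moreover have "row_start N r \<le> c" using p offr True by linarith
            moreover have "v = r \<or> c < row_start N r + N r v"
            proof (cases "r < v")
              case True
              then have "length ?R \<le> ?p + N r v" using N_row [OF r, of v ?p] p by (simp add: v_def)
              then show ?thesis using offr \<open>c < length (S ! 0)\<close> by linarith
            qed (use \<open>r \<le> v\<close> in simp)
            moreover have "row_start N r + N r (Suc v) \<le> c"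
            proof -
              have "\<not> length ?R \<le> ?p + N r (Suc v)"
                using N_row [OF r, of "Suc v" ?p] p \<open>r \<le> v\<close> by (simp add: v_def)
              then show ?thesis using offr \<open>c < length (S ! 0)\<close> by linarith
            qed
            ultimately have "tab n N (c, r) = Some (?R ! ?p)"
              unfolding tab_eq_Some [OF prof] v_def using r by blast
            then show ?thesis using True p r by (simp add: b extend_left_def)
          next
            case False
            then have "c < row_start N r" using offr True by simp
            then show ?thesis using False True r by (simp add: b extend_left_def tab_def)
          qed
        next
          case False
          then have "tab n N (c, r) = Some r"
            unfolding tab_eq_Some [OF prof] using r offr length_row [OF r] by simp
          then show ?thesis using False r by (simp add: b extend_left_def)
        qed
      next
        case False
        then show ?thesis by (auto simp: b extend_left_def tab_def)
      qed
    qed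
    then show "T \<in> tab n ` profiles n" using T prof by blast
  qed
qed

section \<open>Changing one box\<close>

text \<open>
  One more entry at least \<open>a\<close> in row \<open>r\<close>. For \<open>a = i + 1\<close> this is the change of one \<open>i\<close>-box of row
  \<open>r\<close> into an \<open>(i + 1)\<close>-box.
\<close>

definition bump :: "(nat \<Rightarrow> nat \<Rightarrow> nat) \<Rightarrow> nat \<Rightarrow> nat \<Rightarrow> nat \<Rightarrow> nat \<Rightarrow> nat" where
  "bump N r a = N(r := (N r)(a := Suc (N r a)))"

text \<open>
  The rightmost \<open>i\<close>-box of row \<open>r\<close>, provided that row \<open>r\<close> has an \<open>i\<close>-box.
\<close>

definition pivot :: "(nat \<Rightarrow> nat \<Rightarrow> nat) \<Rightarrow> nat \<Rightarrow> nat \<Rightarrow> box" where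
  "pivot N i r = (row_start N r + N r (Suc i), r)"

text \<open>
  Only a change in row \<open>i\<close> itself creates a new entry exceeding the row index; it moves all lower
  rows one column to the left.
\<close>

lemma row_start_bump:
  assumes "1 \<le> r"
  shows "row_start (bump N r (Suc i)) s = row_start N s + (if r = i \<and> r < s then 1 else 0)"
proof -
  have "row_start (bump N r (Suc i)) s = (\<Sum>t = 1..<s. (N t (Suc t) + 1) + (if t = r \<and> r = i then 1 else 0))"
    unfolding row_start_def by (rule sum.cong) (auto simp: bump_def)
  also have "\<dots> = row_start N s + (\<Sum>t = 1..<s. if t = r then (if r = i then 1 else 0) else 0)"
    unfolding row_start_def sum.distrib by (intro arg_cong2 [where f = "(+)"] sum.cong) auto
  also have "(\<Sum>t = 1..<s. if t = r then (if r = i then 1 else 0) else 0) =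
      (if r = i \<and> r < s then 1 else (0::nat))"
    using assms by (subst sum.delta) auto
  finally show ?thesis .
qed

context
  fixes n N r i
  assumes N: "N \<in> profiles n" and N': "bump N r (Suc i) \<in> profiles n"
    and r: "1 \<le> r" "r \<le> i" and i: "i \<le> n"
begin

lemma tab_pivot: "tab n N (pivot N i r) = Some i"
proof -
  have "r = i \<or> Suc (N r (Suc i)) \<le> N r i"
    using profile_antimono [OF N', of r i "Suc i"] r by (cases "r < i") (simp_all add: bump_def)
  then show ?thesis using r i by (auto simp: pivot_def tab_eq_Some [OF N])
qed

lemma tab_bump_upper:
  assumes "s \<le> r \<or> r < i"
  shows "tab n (bump N r (Suc i)) (c, s) = ((tab n N)(pivot N i r \<mapsto> i + 1)) (c, s)"
proof (cases "(c, s) = pivot N i r")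
  case True
  have "N r (Suc (Suc i)) \<le> N r (Suc i)" using profile_antimono [OF N, of r "Suc i"] r by simp
  then show ?thesis
    using True r i by (auto simp: pivot_def tab_eq_Some [OF N'] row_start_bump) (auto simp: bump_def)
next
  case False
  have row_start: "row_start (bump N r (Suc i)) s = row_start N s" using assms r by (auto simp: row_start_bump)
  have "tab n (bump N r (Suc i)) (c, s) = Some v \<longleftrightarrow> tab n N (c, s) = Some v" for v
  proof (cases "s = r \<and> (v = i \<or> v = Suc i)")
    case True
    then show ?thesis
      using False row_start r
      unfolding tab_eq_Some [OF N] tab_eq_Some [OF N'] by (auto simp: pivot_def bump_def)
  next
    case False
    then show ?thesis
      using row_start unfolding tab_eq_Some [OF N] tab_eq_Some [OF N'] by (auto simp: bump_def)
  qed
  then have "tab n (bump N r (Suc i)) (c, s) = tab n N (c, s)" by (metis not_Some_eq)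
  then show ?thesis using False by simp
qed

lemma tab_bump_lower:
  assumes "r = i" "i < s"
  shows "tab n (bump N r (Suc i)) (c, s) = (if c = 0 then None else tab n N (c - 1, s))"
proof -
  have row_start: "row_start (bump N r (Suc i)) s = Suc (row_start N s)" using assms r by (simp add: row_start_bump)
  have row: "bump N r (Suc i) s = N s" using assms by (simp add: bump_def)
  have "Suc k \<le> c \<longleftrightarrow> k \<le> c - 1" if "c \<noteq> 0" for k using that by auto
  then show ?thesis using row_start row by (auto simp: tab_def)
qed

lemma tab_bump:
  assumes "r < i \<or> i = n"
  shows "tab n (bump N r (Suc i)) = (tab n N)(pivot N i r \<mapsto> i + 1)"
proof
  fix b :: box
  obtain c s where b: "b = (c, s)" by (cases b)
  show "tab n (bump N r (Suc i)) b = ((tab n N)(pivot N i r \<mapsto> i + 1)) b"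
  proof (cases "s \<le> r \<or> r < i")
    case True
    then show ?thesis unfolding b by (rule tab_bump_upper)
  next
    case False
    then show ?thesis using assms r i by (auto simp: b pivot_def tab_def)
  qed
qed

text \<open>
  In row \<open>i\<close> the change of one box must be accompanied by a push of the lower rows; if \<open>i = n\<close> there
  are no lower rows, and \<open>tab_bump\<close> applies as well.
\<close>

lemma tab_bump_diagonal:
  assumes "r = i"
  shows "tab n (bump N r (Suc i)) = push_left i ((tab n N)(pivot N i r \<mapsto> i + 1))"
    and "tab n N = push_right i ((tab n (bump N r (Suc i)))(pivot N i r \<mapsto> i))"
proof -
  show "tab n (bump N r (Suc i)) = push_left i ((tab n N)(pivot N i r \<mapsto> i + 1))"
  proof
    fix b :: box
    obtain c s where b: "b = (c, s)" by (cases b)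
    show "tab n (bump N r (Suc i)) b = push_left i ((tab n N)(pivot N i r \<mapsto> i + 1)) b"
    proof (cases "s \<le> i")
      case True
      then show ?thesis unfolding b using tab_bump_upper [of s c] assms by (simp add: push_left_def)
    next
      case False
      then show ?thesis unfolding b using tab_bump_lower [OF assms, of s c] assms
        by (simp add: push_left_def pivot_def)
    qed
  qed
  show "tab n N = push_right i ((tab n (bump N r (Suc i)))(pivot N i r \<mapsto> i))"
  proof
    fix b :: box
    obtain c s where b: "b = (c, s)" by (cases b)
    show "tab n N b = push_right i ((tab n (bump N r (Suc i)))(pivot N i r \<mapsto> i)) b"
    proof (cases "s \<le> i")
      case True
      then show ?thesis unfolding b using tab_bump_upper [of s c] tab_pivot assms
        by (simp add: push_right_def)
    next
      case False
      then show ?thesis unfolding b using tab_bump_lower [OF assms, of s "Suc c"] assms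
        by (simp add: push_right_def pivot_def)
    qed
  qed
qed

text \<open>
  The case distinction in the definition of the operators is decided by the row of the changed box:
  above row \<open>i\<close> the result is marginally large, whereas in row \<open>i < n\<close> the box of row \<open>i + 1\<close> to the
  lower left of the changed box contradicts \<open>tab_diagonal_iff\<close>.
\<close>

lemma MLT_f_tab:
  assumes "(LEAST b. b \<in> sig_plus i (tab n N)) = pivot N i r"
  shows "MLT_f n i (tab n N) = Some (tab n (bump N r (Suc i)))"
proof -
  have n: "1 \<le> n" using r i by simp
  let ?T = "(tab n N)(pivot N i r \<mapsto> i + 1)"
  show ?thesis
  proof (cases "r < i \<or> i = n")
    case True
    then have "?T = tab n (bump N r (Suc i))" by (rule tab_bump [symmetric])
    then show ?thesis using assms tab_in_MLT [OF N' n] by (simp add: MLT_f_def Let_def)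
  next
    case False
    then have ri: "r = i" "i < n" using r i by auto
    have "?T \<notin> MLT n"
    proof
      assume "?T \<in> MLT n"
      then obtain N2 where N2: "N2 \<in> profiles n" "?T = tab n N2"
        using MLT_eq_tab_image [OF n] by auto
      let ?c = "row_start N i + N i (Suc i)"
      have "?T (?c, i) \<noteq> Some i" by (simp add: pivot_def ri)
      moreover have "?T (Suc ?c, Suc i) \<noteq> None"
        using r ri by (simp add: pivot_def tab_def row_start_Suc)
      ultimately show False
        using tab_diagonal_iff [OF N2(1), of i ?c] r ri unfolding N2(2) by blast
    qed
    then show ?thesis using assms tab_bump_diagonal(1) ri
      by (simp add: MLT_f_def Let_def pivot_def)
  qed
qed

lemma MLT_e_tab:
  assumes "sig_minus i (tab n (bump N r (Suc i))) \<noteq> {}"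
    and "Max (sig_minus i (tab n (bump N r (Suc i)))) = pivot N i r"
  shows "MLT_e n i (tab n (bump N r (Suc i))) = Some (tab n N)"
proof -
  have n: "1 \<le> n" using r i by simp
  let ?T = "(tab n (bump N r (Suc i)))(pivot N i r \<mapsto> i)"
  show ?thesis
  proof (cases "r < i \<or> i = n")
    case True
    then have "?T = tab n N" using tab_bump tab_pivot by (simp add: fun_upd_idem)
    then show ?thesis using assms tab_in_MLT [OF N n] by (simp add: MLT_e_def Let_def)
  next
    case False
    then have ri: "r = i" "i < n" using r i by auto
    have "?T \<notin> MLT n"
    proof
      assume "?T \<in> MLT n"
      then obtain N2 where N2: "N2 \<in> profiles n" "?T = tab n N2"
        using MLT_eq_tab_image [OF n] by auto
      let ?c = "row_start N i + N i (Suc i)"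
      have "?T (?c, i) = Some i" by (simp add: pivot_def ri)
      moreover have "?T (Suc ?c, Suc i) = None"
      proof -
        have "row_start (bump N r (Suc i)) (Suc i) = row_start N i + N i (Suc i) + 2"
          using row_start_bump [OF r(1), of N i "Suc i"] row_start_Suc [of i N] r ri by simp
        then show ?thesis using ri by (simp add: pivot_def tab_def)
      qed
      ultimately show False
        using tab_diagonal_iff [OF N2(1), of i ?c] r ri unfolding N2(2) by auto
    qed
    then show ?thesis using assms tab_bump_diagonal(2) ri
      by (simp add: MLT_e_def Let_def pivot_def)
  qed
qed

end

section \<open>Signatures of marginally large tableaux\<close>

text \<open>
  The height of the \<open>i\<close>-signature word just after the \<open>(i + 1)\<close>-boxes of row \<open>r\<close>. Each row \<open>s \<le> r\<close>
  contributes its \<open>(i + 1)\<close>-boxes positively, and the previous row \<open>s - 1\<close> its \<open>i\<close>-boxes negatively.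
  The same numbers are the values \<open>\<sigma>\<^sub>k\<close> of the polyhedral realization.
\<close>

definition peak_height :: "(nat \<Rightarrow> nat \<Rightarrow> nat) \<Rightarrow> nat \<Rightarrow> nat \<Rightarrow> int" where
  "peak_height N i r = (\<Sum>s = 1..r. (int (N s (i + 1)) - int (N s (i + 2))) -
                         (int (N (s - 1) i) - int (N (s - 1) (i + 1))))"

lemma peak_height_0 [simp]: "peak_height N i 0 = 0"
  by (simp add: peak_height_def)

lemma peak_height_Suc:
  "peak_height N i (Suc r) = peak_height N i r + (int (N (Suc r) (i + 1)) - int (N (Suc r) (i + 2))) -
     (int (N r i) - int (N r (i + 1)))"
  by (simp add: peak_height_def)

lemma peak_height_1_nonneg:
  assumes "N \<in> profiles n" "1 \<le> i"
  shows "0 \<le> peak_height N i 1"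
  using profile_eq_0 [OF assms(1), of 0] profile_antimono [OF assms(1), of 1 "i + 1" "i + 2"] assms(2)
  by (simp add: peak_height_def)

definition argmax_first :: "(nat \<Rightarrow> nat \<Rightarrow> nat) \<Rightarrow> nat \<Rightarrow> nat \<Rightarrow> bool" where
  "argmax_first N i r \<longleftrightarrow> r \<in> {1..i} \<and> (\<forall>s\<in>{1..i}. peak_height N i s \<le> peak_height N i r) \<and>
     (\<forall>s. 1 \<le> s \<and> s < r \<longrightarrow> peak_height N i s < peak_height N i r)"

definition argmax_last :: "(nat \<Rightarrow> nat \<Rightarrow> nat) \<Rightarrow> nat \<Rightarrow> nat \<Rightarrow> bool" where
  "argmax_last N i r \<longleftrightarrow> r \<in> {1..i} \<and> (\<forall>s\<in>{1..i}. peak_height N i s \<le> peak_height N i r) \<and>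
     (\<forall>s. r < s \<and> s \<le> i \<longrightarrow> peak_height N i s < peak_height N i r)"

lemma finite_argmax:
  fixes f :: "nat \<Rightarrow> int"
  assumes "finite S" "S \<noteq> {}"
  defines "A \<equiv> {r \<in> S. \<forall>s\<in>S. f s \<le> f r}"
  shows "finite A" "A \<noteq> {}"
proof -
  show "finite A" using assms by simp
  have "Max (f ` S) \<in> f ` S" using assms by (intro Max_in) auto
  then obtain r where "r \<in> S" "f r = Max (f ` S)" by auto
  then have "r \<in> A" using assms by simp
  then show "A \<noteq> {}" by blast
qed

lemma ex_argmax_first:
  assumes "1 \<le> i"
  shows "\<exists>r. argmax_first N i r"
proof -
  let ?A = "{r \<in> {1..i}. \<forall>s\<in>{1..i}. peak_height N i s \<le> peak_height N i r}"
  have A: "finite ?A" "?A \<noteq> {}" using finite_argmax [of "{1..i}" "peak_height N i"] assms by auto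
  define r where "r = Min ?A"
  have "r \<in> ?A" unfolding r_def using A by (rule Min_in)
  then have r: "r \<in> {1..i}" "\<forall>s\<in>{1..i}. peak_height N i s \<le> peak_height N i r" by blast+
  have "peak_height N i s < peak_height N i r" if "1 \<le> s" "s < r" for s
  proof (rule ccontr)
    assume "\<not> ?thesis"
    then have "peak_height N i r \<le> peak_height N i s" by simp
    then have "\<forall>t\<in>{1..i}. peak_height N i t \<le> peak_height N i s" using r(2) by (meson order_trans)
    then have "s \<in> ?A" using r(1) that by simp
    then have "r \<le> s" unfolding r_def using A(1) by (rule Min_le [rotated])
    then show False using that by simp
  qed
  then show ?thesis unfolding argmax_first_def using r by blast
qed

lemma ex_argmax_last:
  assumes "1 \<le> i"
  shows "\<exists>r. argmax_last N i r"
proof -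
  let ?A = "{r \<in> {1..i}. \<forall>s\<in>{1..i}. peak_height N i s \<le> peak_height N i r}"
  have A: "finite ?A" "?A \<noteq> {}" using finite_argmax [of "{1..i}" "peak_height N i"] assms by auto
  define r where "r = Max ?A"
  have "r \<in> ?A" unfolding r_def using A by (rule Max_in)
  then have r: "r \<in> {1..i}" "\<forall>s\<in>{1..i}. peak_height N i s \<le> peak_height N i r" by blast+
  have "peak_height N i s < peak_height N i r" if "r < s" "s \<le> i" for s
  proof (rule ccontr)
    assume "\<not> ?thesis"
    then have "peak_height N i r \<le> peak_height N i s" by simp
    then have "\<forall>t\<in>{1..i}. peak_height N i t \<le> peak_height N i s" using r(2) by (meson order_trans)
    then have "s \<in> ?A" using r(1) that by simp
    then have "s \<le> r" unfolding r_def using A(1) by (rule Max_ge [rotated])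
    then show False using that by simp
  qed
  then show ?thesis unfolding argmax_last_def using r by blast
qed

text \<open>
  At the last maximum the box to be changed exists: if \<open>r < i\<close>, the peak of the next row
  can only be lower if row \<open>r\<close> contains \<open>i\<close>-boxes. Dually, the peak of row \<open>r\<close> can only exceed the previous one if row
  \<open>r\<close> contains \<open>(i + 1)\<close>-boxes. This keeps the operators inside the set of profiles.
\<close>

lemma argmax_last_room:
  assumes N: "N \<in> profiles n" and r: "argmax_last N i r"
  shows "r = i \<or> N r (Suc i) < N r i"
proof (cases "r = i")
  case False
  then have "peak_height N i (Suc r) < peak_height N i r" using r by (auto simp: argmax_last_def)
  moreover have "N (Suc r) (i + 2) \<le> N (Suc r) (i + 1)"
    using profile_antimono [OF N, of "Suc r" "i + 1" "i + 2"] False r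
    by (auto simp: argmax_last_def)
  ultimately show ?thesis by (simp add: peak_height_Suc)
qed simp

lemma argmax_first_room:
  assumes N: "N \<in> profiles n" and r: "argmax_first N i r" "0 < peak_height N i r"
  shows "N r (Suc (Suc i)) < N r (Suc i)"
proof -
  obtain q where q: "r = Suc q" using r(1) by (cases r) (auto simp: argmax_first_def)
  have "peak_height N i q < peak_height N i r"
    using r q by (cases q) (auto simp: argmax_first_def)
  moreover have "N q (i + 1) \<le> N q i"
  proof (cases "q = 0")
    case False
    then show ?thesis
      using profile_antimono [OF N, of q i "i + 1"] r(1) q by (auto simp: argmax_first_def)
  qed (use profile_eq_0 [OF N] in simp)
  ultimately show ?thesis by (simp add: q peak_height_Suc)
qed

lemma bump_in_profiles:
  assumes N: "N \<in> profiles n" and r: "argmax_last N i r" and i: "i \<le> n"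
  shows "bump N r (Suc i) \<in> profiles n"
proof -
  have "bump N r (Suc i) s (Suc a) \<le> bump N r (Suc i) s a" if "s < a" for s a
    using that argmax_last_room [OF N r] profile_antimono [OF N, of s a "Suc a"]
    by (auto simp: bump_def)
  moreover have "1 \<le> s \<and> s < a \<and> a \<le> n + 1" if "bump N r (Suc i) s a \<noteq> 0" for s a
  proof (cases "s = r \<and> a = Suc i")
    case False
    then have "N s a \<noteq> 0" using that by (auto simp: bump_def split: if_splits)
    then show ?thesis using N by (simp add: profiles_def)
  qed (use r i in \<open>auto simp: argmax_last_def\<close>)
  ultimately show ?thesis unfolding profiles_def by blast
qed

lemma unbump_in_profiles:
  assumes N: "N \<in> profiles n" and r: "argmax_first N i r" "0 < peak_height N i r"
  obtains N' where "N' \<in> profiles n" "N = bump N' r (Suc i)"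
proof
  let ?N' = "N(r := (N r)(Suc i := N r (Suc i) - 1))"
  note room = argmax_first_room [OF N r]
  have "?N' s (Suc a) \<le> ?N' s a" if "s < a" for s a
    using that room profile_antimono [OF N, of s a "Suc a"] by auto
  moreover have "1 \<le> s \<and> s < a \<and> a \<le> n + 1" if "?N' s a \<noteq> 0" for s a
  proof -
    have "N s a \<noteq> 0" using that by (auto split: if_splits)
    then show ?thesis using N by (simp add: profiles_def)
  qed
  ultimately show "?N' \<in> profiles n" unfolding profiles_def by blast
  show "N = bump ?N' r (Suc i)" using room by (simp add: bump_def fun_eq_iff)
qed

text \<open>
  The position of a box in the Far-Eastern reading. The factor \<open>n + 1\<close> makes it strictly increasing
  for row numbers up to \<open>n\<close>.
\<close>

definition key :: "nat \<Rightarrow> box \<Rightarrow> nat" where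
  "key n = (\<lambda>(c, r). c * (n + 1) + r)"

lemma key_less_iff:
  assumes "r \<le> n"
  shows "key n (c, r) < d * (n + 1) \<longleftrightarrow> c < d"
proof
  assume "key n (c, r) < d * (n + 1)"
  then have "c * (n + 1) < d * (n + 1)" by (simp add: key_def)
  then show "c < d" by (simp only: mult_less_cancel2)
next
  assume "c < d"
  then have "Suc c * (n + 1) \<le> d * (n + 1)" by (intro mult_le_mono1) simp
  then show "key n (c, r) < d * (n + 1)" using assms by (simp add: key_def)
qed

lemma key_strict_mono:
  assumes "(c, r) < (c', r')" "r \<le> n"
  shows "key n (c, r) < key n (c', r')"
proof (cases "c < c'")
  case True
  then have "key n (c, r) < c' * (n + 1)" using key_less_iff assms by blast
  also have "\<dots> \<le> key n (c', r')" by (simp add: key_def)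
  finally show ?thesis .
next
  case False
  then show ?thesis using assms(1) by (auto simp: key_def less_prod_def)
qed

text \<open>
  The \<open>i\<close>-signature word of \<open>tab n N\<close>. The columns from \<open>row_start N r\<close> up to \<open>row_start N (r + 1)\<close>,
  for \<open>r \<le> i\<close>, form a region in which only row \<open>r\<close> contributes: all its minus signs come first, then
  its plus signs. The height thus rises up to the peak of the region and falls afterwards. To the
  left of the last region, row \<open>i\<close> contributes plus signs only and row \<open>i + 1\<close>, if there is one, may
  contribute a minus sign only directly below a plus sign.
\<close>

context
  fixes n i N
  assumes N: "N \<in> profiles n" and i: "1 \<le> i" "i \<le> n"
begin

private abbreviation "T \<equiv> tab n N"
private abbreviation "P \<equiv> key n ` boxes T i"
private abbreviation "M \<equiv> key n ` boxes T (i + 1)"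
private abbreviation "ht \<equiv> height P M"
private abbreviation "start r \<equiv> row_start N r * (n + 1)"
private abbreviation "peak r \<equiv> key n (pivot N i r)"

private lemma boxes_T:
  "(c, s) \<in> boxes T a \<longleftrightarrow> s \<in> {1..n} \<and> row_start N s \<le> c \<and> s \<le> a \<and>
    (a = s \<or> c < row_start N s + N s a) \<and> row_start N s + N s (Suc a) \<le> c"
  by (simp add: boxes_def tab_eq_Some [OF N])

private lemma key_mono: "strict_mono_on (boxes T i \<union> boxes T (i + 1)) (key n)"
proof (rule strict_mono_onI)
  fix b b' assume "b \<in> boxes T i \<union> boxes T (i + 1)" and "b < b'"
  then show "key n b < key n b'"
    using boxes_T key_strict_mono by (cases b; cases b') fastforce
qed

private lemma boxes_disj: "boxes T i \<inter> boxes T (i + 1) = {}"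
  by (auto simp: boxes_def)

private lemma row_end:
  assumes "s < r" "1 \<le> s" "s < a"
  shows "row_start N s + N s a < row_start N r"
  using row_start_less [OF assms(2,1), of N] profile_antimono [OF N, of s "Suc s" a] assms(3) by simp

text \<open>
  Rows below \<open>r\<close> have not started yet, and a higher row \<open>s\<close> has only entries \<open>s\<close> left, which are
  smaller than \<open>i\<close>.
\<close>

private lemma row_unique:
  assumes "(c, s) \<in> boxes T a" "a = i \<or> a = i + 1" "1 \<le> r" "r \<le> i" "row_start N r \<le> c" "c < row_start N (Suc r)"
  shows "s = r"
proof (rule ccontr)
  have s: "1 \<le> s" "row_start N s \<le> c" "a = s \<or> c < row_start N s + N s a" "s \<le> a"
    using assms(1) by (auto simp: boxes_T)
  assume "s \<noteq> r"
  moreover have "\<not> r < s" using s(2) assms(6) row_start_mono [of "Suc r" s N] by auto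
  ultimately have "s < r" by simp
  then show False using row_end [of s r a] s assms by auto
qed

text \<open>
  Row \<open>i\<close> has infinitely many \<open>i\<close>-boxes, but exactly one of them lies in its own region; this is
  the exceptional value in the second part.
\<close>

private lemma boxes_T_row:
  assumes "1 \<le> r" "r \<le> i"
  shows "row_start N r \<le> c \<and> c < row_start N (Suc r) \<and> (c, r) \<in> boxes T (i + 1) \<longleftrightarrow>
      row_start N r + N r (i + 2) \<le> c \<and> c < row_start N r + N r (i + 1)"
    and "row_start N r \<le> c \<and> c < row_start N (Suc r) \<and> (c, r) \<in> boxes T i \<longleftrightarrow>
      row_start N r + N r (i + 1) \<le> c \<and> c < row_start N r + (if r = i then N r (i + 1) + 1 else N r i)"
  using assms i row_end [of r "Suc r" "i + 1"] row_end [of r "Suc r" i] row_start_Suc [of r N]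
  by (auto simp: boxes_T)

private lemma signs_region:
  assumes r: "1 \<le> r" "r \<le> i"
  shows "M \<inter> {start r..<start (Suc r)} =
      (\<lambda>c. key n (c, r)) ` {row_start N r + N r (i + 2)..<row_start N r + N r (i + 1)}"
    and "P \<inter> {start r..<start (Suc r)} =
      (\<lambda>c. key n (c, r)) ` {row_start N r + N r (i + 1)..<
        row_start N r + (if r = i then N r (i + 1) + 1 else N r i)}"
proof -
  have signs: "key n ` boxes T a \<inter> {start r..<start (Suc r)} =
      (\<lambda>c. key n (c, r)) ` {c. row_start N r \<le> c \<and> c < row_start N (Suc r) \<and> (c, r) \<in> boxes T a}"
    if a: "a = i \<or> a = i + 1" for a
  proof -
    have in_region: "key n (c, s) \<in> {start r..<start (Suc r)} \<longleftrightarrow> row_start N r \<le> c \<and> c < row_start N (Suc r)"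
      if "(c, s) \<in> boxes T a" for c s
    proof -
      have "s \<le> n" using that by (simp add: boxes_T)
      then show ?thesis
        unfolding atLeastLessThan_iff using key_less_iff by (metis not_less)
    qed
    show ?thesis
    proof (intro equalityI subsetI)
      fix x assume x: "x \<in> key n ` boxes T a \<inter> {start r..<start (Suc r)}"
      then obtain c s where cs: "(c, s) \<in> boxes T a" "x = key n (c, s)" by auto
      then have "row_start N r \<le> c \<and> c < row_start N (Suc r)" using in_region x by blast
      moreover from this have "s = r" using row_unique [OF cs(1) a r] by blast
      ultimately
      show "x \<in> (\<lambda>c. key n (c, r)) ` {c. row_start N r \<le> c \<and> c < row_start N (Suc r) \<and> (c, r) \<in> boxes T a}"
        using cs by blast
    next
      fix x
      assume "x \<in> (\<lambda>c. key n (c, r)) ` {c. row_start N r \<le> c \<and> c < row_start N (Suc r) \<and> (c, r) \<in> boxes T a}"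
      then show "x \<in> key n ` boxes T a \<inter> {start r..<start (Suc r)}" using in_region by blast
    qed
  qed
  have interval: "{c. a \<le> c \<and> c < b} = {a..<b}" for a b :: nat by auto
  show "M \<inter> {start r..<start (Suc r)} =
      (\<lambda>c. key n (c, r)) ` {row_start N r + N r (i + 2)..<row_start N r + N r (i + 1)}"
    using signs [OF disjI2 [OF refl]] unfolding boxes_T_row(1) [OF r] interval .
  show "P \<inter> {start r..<start (Suc r)} =
      (\<lambda>c. key n (c, r)) ` {row_start N r + N r (i + 1)..<
        row_start N r + (if r = i then N r (i + 1) + 1 else N r i)}"
    using signs [OF disjI1 [OF refl]] unfolding boxes_T_row(2) [OF r] interval .
qed

private lemma key_row_less: "key n (c, r) < key n (c', r) \<longleftrightarrow> c < c'"
  by (simp add: key_def del: mult_Suc_right)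

private lemma start_le_peak: "start r \<le> peak r"
  by (simp add: key_def pivot_def add_mult_distrib del: mult_Suc_right)

private lemma peak_less_start:
  assumes "1 \<le> r" "r \<le> i"
  shows "peak r < start (Suc r)"
  unfolding pivot_def
  using key_less_iff [of r n "row_start N r + N r (Suc i)" "row_start N (Suc r)"] i
    row_end [of r "Suc r" "Suc i"] assms by simp

private lemma signs_around_peak:
  assumes r: "1 \<le> r" "r \<le> i"
  shows "P \<inter> {start r..<peak r} = {}" and "M \<inter> {peak r..<start (Suc r)} = {}"
    and "M \<inter> {start r..<peak r} = M \<inter> {start r..<start (Suc r)}"
    and "P \<inter> {peak r..<start (Suc r)} = P \<inter> {start r..<start (Suc r)}"
proof -
  have p: "\<not> x < peak r" if "x \<in> P \<inter> {start r..<start (Suc r)}" for x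
    using that unfolding signs_region(2) [OF r] by (auto simp: pivot_def key_row_less)
  have m: "x < peak r" if "x \<in> M \<inter> {start r..<start (Suc r)}" for x
    using that unfolding signs_region(1) [OF r] by (auto simp: pivot_def key_row_less)
  note le = start_le_peak [of r] peak_less_start [OF r]
  show "P \<inter> {start r..<peak r} = {}" using p le by fastforce
  show "M \<inter> {peak r..<start (Suc r)} = {}" using m le by fastforce
  show "M \<inter> {start r..<peak r} = M \<inter> {start r..<start (Suc r)}" using m le by fastforce
  show "P \<inter> {peak r..<start (Suc r)} = P \<inter> {start r..<start (Suc r)}" using p le by fastforce
qed

private lemma height_le_if_no_plus:
  assumes "j \<le> k" "P \<inter> {j..<k} = {}"
  shows "ht j \<le> ht k"
  using height_diff [OF assms(1), of P M] assms(2) by simp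

private lemma height_ge_if_no_minus:
  assumes "j \<le> k" "M \<inter> {j..<k} = {}"
  shows "ht k \<le> ht j"
  using height_diff [OF assms(1), of P M] assms(2) by simp

private lemma card_key_row: "card ((\<lambda>c. key n (c, r)) ` {a..<b}) = b - a"
proof -
  have "inj_on (\<lambda>c. key n (c, r)) {a..<b}" by (rule inj_onI) (metis key_row_less nat_neq_iff)
  then show ?thesis by (simp add: card_image)
qed

private lemma height_peak_start:
  assumes r: "1 \<le> r" "r \<le> i"
  shows "ht (peak r) = ht (start r) + int (N r (i + 1)) - int (N r (i + 2))"
proof -
  have "card (M \<inter> {start r..<peak r}) = N r (i + 1) - N r (i + 2)"
    unfolding signs_around_peak(3) [OF r] signs_region(1) [OF r] card_key_row by simp
  moreover have "N r (i + 2) \<le> N r (i + 1)"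
    using profile_antimono [OF N, of r "i + 1" "i + 2"] r by simp
  ultimately show ?thesis
    using height_diff [OF start_le_peak, of P M r] signs_around_peak(1) [OF r] by simp
qed

private lemma height_start_peak:
  assumes r: "1 \<le> r" "r < i"
  shows "ht (start (Suc r)) = ht (peak r) - (int (N r i) - int (N r (i + 1)))"
proof -
  have r': "1 \<le> r" "r \<le> i" using r by auto
  have "card (P \<inter> {peak r..<start (Suc r)}) = N r i - N r (i + 1)"
    unfolding signs_around_peak(4) [OF r'] signs_region(2) [OF r'] card_key_row using r by simp
  moreover have "N r (i + 1) \<le> N r i"
    using profile_antimono [OF N, of r i "i + 1"] r by simp
  ultimately show ?thesis
    using height_diff [of "peak r" "start (Suc r)" P M] peak_less_start [OF r']
      signs_around_peak(2) [OF r'] by simp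
qed

private lemma height_peak:
  assumes "1 \<le> r" "r \<le> i"
  shows "ht (peak r) = peak_height N i r"
  using assms
proof (induction r rule: dec_induct)
  case base
  then show ?case
    using height_peak_start [of 1] profile_eq_0 [OF N, of 0] by (simp add: peak_height_def numeral_2_eq_2)
next
  case (step r)
  then show ?case
    using height_peak_start [of "Suc r"] height_start_peak [of r] by (simp add: peak_height_Suc)
qed

private lemma height_region:
  assumes r: "1 \<le> r" "r \<le> i" and k: "start r \<le> k" "k < start (Suc r)"
  shows "ht k \<le> peak_height N i r"
proof (cases "k \<le> peak r")
  case True
  then have "P \<inter> {k..<peak r} = {}" using signs_around_peak(1) [OF r] k by fastforce
  then show ?thesis using height_le_if_no_plus [OF True] height_peak [OF r] by simp
next
  case False
  then have "M \<inter> {peak r..<k} = {}" using signs_around_peak(2) [OF r] k by fastforce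
  then show ?thesis using height_ge_if_no_minus [of "peak r" k] False height_peak [OF r] by simp
qed

private lemma peak_plus:
  assumes "1 \<le> r" "r \<le> i" "r = i \<or> N r (i + 1) < N r i"
  shows "pivot N i r \<in> boxes T i"
  using assms i by (auto simp: pivot_def boxes_T)

text \<open>
  The plus sign at the last peak is never compensated: every later minus sign is an \<open>(i + 1)\<close>-box of
  row \<open>i + 1\<close>, and it is immediately preceded by the \<open>i\<close>-box above it.
\<close>

private lemma height_after_last_peak:
  assumes "peak i < k"
  shows "ht k < peak_height N i i"
  using assms
proof (induction k rule: less_induct)
  case (less k)
  then obtain l where l: "k = Suc l" by (cases k) auto
  have peak: "peak i \<in> P" "ht (peak i) = peak_height N i i" using peak_plus [of i] height_peak [of i] i by auto
  show ?case
  proof (cases "l \<in> M")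
    case False
    show ?thesis
    proof (cases "l = peak i")
      case True
      then show ?thesis using False peak by (simp add: l height_Suc)
    next
      case False
      then have "ht l < peak_height N i i" using less l by simp
      then show ?thesis using \<open>l \<notin> M\<close> by (simp add: l height_Suc)
    qed
  next
    case True
    then obtain c s where cs: "(c, s) \<in> boxes T (i + 1)" "l = key n (c, s)" by auto
    have "peak i \<le> l" using less.prems l by simp
    have "l \<notin> {peak i..<start (Suc i)}" using signs_around_peak(2) [of i] True i by blast
    then have "start (Suc i) \<le> l" using \<open>peak i \<le> l\<close> by simp
    moreover have "s \<le> n" using cs by (simp add: boxes_T)
    ultimately have c: "row_start N (Suc i) \<le> c" using key_less_iff [of s n c "row_start N (Suc i)"] cs(2) by simp
    have "\<not> s \<le> i"
    proof
      assume "s \<le> i"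
      then have "c < row_start N s + N s (i + 1)" "1 \<le> s" using cs(1) by (auto simp: boxes_T)
      then show False using row_end [of s "Suc i" "i + 1"] \<open>s \<le> i\<close> c by simp
    qed
    then have s: "s = Suc i" using cs(1) by (auto simp: boxes_T)
    have "(c, i) \<in> boxes T i" using c i row_start_Suc [of i N] by (simp add: boxes_T)
    \<comment> \<open>the plus sign directly above the minus sign at \<open>l\<close>\<close>
    define j where "j = key n (c, i)"
    have "j \<in> P" using \<open>(c, i) \<in> boxes T i\<close> by (simp add: j_def)
    have lj: "l = Suc j" by (simp add: cs(2) s j_def key_def)
    have "peak i < j" using c row_start_Suc [of i N] i by (simp add: j_def pivot_def key_row_less)
    have "\<not> j \<in> M"
      using \<open>j \<in> P\<close> boxes_disj strict_mono_on_imp_inj_on [OF key_mono]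
      by (auto simp: inj_on_def)
    moreover have "l \<notin> P"
      using True boxes_disj strict_mono_on_imp_inj_on [OF key_mono]
      by (auto simp: inj_on_def)
    ultimately have "ht k = ht j" using \<open>j \<in> P\<close> True by (simp add: l lj height_Suc)
    then show ?thesis using less.IH [of j] \<open>peak i < j\<close> l lj by simp
  qed
qed

private lemma region_cases:
  obtains r where "1 \<le> r" "r \<le> i" "start r \<le> k" "k < start (Suc r)" | "start (Suc i) \<le> k"
proof -
  have "\<exists>r. 1 \<le> r \<and> r \<le> j \<and> start r \<le> k \<and> k < start (Suc r)" if "1 \<le> j" "k < start (Suc j)" for j
    using that
  proof (induction j rule: dec_induct)
    case base
    then show ?case by auto
  next
    case (step j)
    then show ?case by (cases "k < start (Suc j)") (force simp: le_Suc_eq not_less)+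
  qed
  then show ?thesis using that i by (meson not_less)
qed

private lemma height_bound:
  assumes "\<forall>s\<in>{1..i}. peak_height N i s \<le> m"
  shows "ht k \<le> m"
proof (cases rule: region_cases [of k])
  case (1 r)
  then have "peak_height N i r \<le> m" using assms by simp
  then show ?thesis using height_region [OF 1] by simp
next
  case 2
  then show ?thesis using height_after_last_peak [of k] peak_less_start [of i] i assms by force
qed

text \<open>
  The height leaves its maximum for good at the last highest peak.
\<close>

lemma Least_sig_plus_tab:
  assumes r: "argmax_last N i r"
  shows "(LEAST b. b \<in> sig_plus i T) = pivot N i r"
proof -
  have r': "1 \<le> r" "r \<le> i" and max: "\<forall>s\<in>{1..i}. peak_height N i s \<le> peak_height N i r"
    and last: "\<And>s. r < s \<Longrightarrow> s \<le> i \<Longrightarrow> peak_height N i s < peak_height N i r"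
    using r by (auto simp: argmax_last_def)
  have b: "pivot N i r \<in> boxes T i" using peak_plus [OF r'] argmax_last_room [OF N r] by simp
  note hp = height_peak [OF r']
  have later: "ht k < ht (peak r)" if k: "peak r < k" for k
  proof (cases rule: region_cases [of k])
    case (1 s)
    have "\<not> s < r"
    proof
      assume "s < r"
      then have "start (Suc s) \<le> start r" by (intro mult_le_mono1 row_start_mono) simp
      then show False using 1 k start_le_peak [of r] by simp
    qed
    show ?thesis
    proof (cases "s = r")
      case True
      then have "M \<inter> {Suc (peak r)..<k} = {}" using signs_around_peak(2) [OF r'] 1 by fastforce
      then have "ht k \<le> ht (Suc (peak r))" using height_ge_if_no_minus k by (simp add: Suc_le_eq)
      moreover have "peak r \<notin> M" "peak r \<in> P"
        using signs_around_peak(2) [OF r'] peak_less_start [OF r'] b by auto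
      ultimately show ?thesis by (simp add: height_Suc)
    next
      case False
      then show ?thesis
        using last [of s] \<open>\<not> s < r\<close> 1 height_region [of s k] hp by simp
    qed
  next
    case 2
    then have "ht k < peak_height N i i" using height_after_last_peak [of k] peak_less_start [of i] i by simp
    then show ?thesis using max i hp by force
  qed
  show ?thesis
    unfolding sig_plus_def
  proof (rule Least_plus [OF key_mono boxes_disj])
    show "\<forall>k. ht k \<le> ht (peak r)" using height_bound [OF max] hp by simp
    show "\<forall>k>peak r. ht k < ht (peak r)" using later by blast
  qed (rule b)
qed

lemma sig_minus_tab:
  assumes max: "\<forall>s\<in>{1..i}. peak_height N i s \<le> peak_height N i r" and r: "r \<in> {1..i}"
  shows "finite (sig_minus i T)" "int (card (sig_minus i T)) = peak_height N i r"
proof -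
  have m: "int (nat (peak_height N i r)) = peak_height N i r" using peak_height_1_nonneg [OF N i(1)] max i by force
  have le: "\<forall>k. ht k \<le> int (nat (peak_height N i r))" using height_bound [OF max] m by simp
  have att: "ht (peak r) = int (nat (peak_height N i r))" using height_peak [of r] r m by simp
  show "finite (sig_minus i T)"
    unfolding sig_minus_def by (rule card_minus(1) [OF key_mono boxes_disj le att])
  show "int (card (sig_minus i T)) = peak_height N i r"
    using card_minus(2) [OF key_mono boxes_disj le att] m unfolding sig_minus_def by simp
qed

text \<open>
  The height first reaches its maximum at the first highest peak, with the leftmost \<open>(i + 1)\<close>-box of
  that row.
\<close>

lemma Max_sig_minus_tab:
  assumes r: "argmax_first N i r" and pos: "0 < peak_height N i r"
  shows "Max (sig_minus i T) = (row_start N r + N r (Suc i) - 1, r)"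
proof -
  have r': "1 \<le> r" "r \<le> i" and max: "\<forall>s\<in>{1..i}. peak_height N i s \<le> peak_height N i r"
    and first: "\<And>s. 1 \<le> s \<Longrightarrow> s < r \<Longrightarrow> peak_height N i s < peak_height N i r"
    using r by (auto simp: argmax_first_def)
  define q where "q = (row_start N r + N r (Suc i) - 1, r)"
  have room: "N r (i + 2) < N r (i + 1)" using argmax_first_room [OF N r pos] by simp
  have q: "q \<in> boxes T (i + 1)"
    using room r' i by (auto simp: q_def boxes_T)
  have q_less: "key n q < peak r" using room by (simp add: q_def pivot_def key_row_less)
  have "start r \<le> (row_start N r + N r (Suc i) - 1) * (n + 1)"
    using room by (intro mult_le_mono1) simp
  then have start_q: "start r \<le> key n q" unfolding q_def key_def prod.case by (rule trans_le_add1)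
  have "M \<inter> {Suc (key n q)..<peak r} = {}"
  proof -
    have "x \<le> key n q" if x: "x \<in> M \<inter> {start r..<start (Suc r)}" for x
    proof -
      obtain c where "x = key n (c, r)" "c < row_start N r + N r (i + 1)"
        using x unfolding signs_region(1) [OF r'] by auto
      then have "\<not> key n q < x" unfolding q_def by (simp add: key_row_less)
      then show ?thesis by simp
    qed
    then show ?thesis using signs_around_peak(3) [OF r'] start_q by fastforce
  qed
  moreover have "P \<inter> {Suc (key n q)..<peak r} = {}"
    using signs_around_peak(1) [OF r'] start_q by fastforce
  ultimately have hq: "ht (Suc (key n q)) = peak_height N i r"
    using height_diff [of "Suc (key n q)" "peak r" P M] height_peak [OF r'] q_less by simp
  have m: "int (nat (peak_height N i r)) = peak_height N i r" using pos by simp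
  have before: "ht k < peak_height N i r" if k: "k \<le> key n q" for k
  proof (cases rule: region_cases [of k])
    case (1 s)
    have "\<not> r < s"
    proof
      assume "r < s"
      then have "start (Suc r) \<le> start s" by (intro mult_le_mono1 row_start_mono) simp
      then show False using 1 k q_less peak_less_start [OF r'] by simp
    qed
    show ?thesis
    proof (cases "s = r")
      case True
      then have "P \<inter> {k..<key n q} = {}" using signs_around_peak(1) [OF r'] q_less 1 by fastforce
      then have "ht k \<le> ht (key n q)" using height_le_if_no_plus k by simp
      moreover have "key n q \<notin> P"
        using signs_around_peak(1) [OF r'] q_less start_q by fastforce
      moreover have "key n q \<in> M" using q by simp
      ultimately show ?thesis using hq by (simp add: height_Suc)
    next
      case False
      then show ?thesis
        using first [of s] \<open>\<not> r < s\<close> 1 height_region [of s k] by simp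
    qed
  next
    case 2
    have "start (Suc r) \<le> start (Suc i)" using r' by (intro mult_le_mono1 row_start_mono) simp
    then show ?thesis using 2 k q_less peak_less_start [OF r'] by simp
  qed
  show ?thesis
    unfolding sig_minus_def q_def [symmetric]
  proof (rule Max_minus [OF key_mono boxes_disj, where m = "nat (peak_height N i r)"])
    show "\<forall>k. ht k \<le> int (nat (peak_height N i r))" using height_bound [OF max] m by simp
    show "\<forall>k\<le>key n q. ht k < int (nat (peak_height N i r))" using before m by simp
  qed (use q hq m in auto)
qed

end

lemma MLT_eps_tab:
  assumes "N \<in> profiles n" "1 \<le> i" "i \<le> n" "argmax_last N i r"
  shows "MLT_eps i (tab n N) = Fin (peak_height N i r)"
  using sig_minus_tab(2) [OF assms(1-3), of r] assms(4)
  by (simp add: MLT_eps_def argmax_last_def)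

lemma MLT_f_argmax:
  assumes "N \<in> profiles n" "1 \<le> i" "i \<le> n" "argmax_last N i r"
  shows "MLT_f n i (tab n N) = Some (tab n (bump N r (Suc i)))"
  using assms MLT_f_tab [OF assms(1) bump_in_profiles [OF assms(1,4,3)]] Least_sig_plus_tab
  by (simp add: argmax_last_def)

lemma MLT_e_argmax:
  assumes N: "N \<in> profiles n" "bump N r (Suc i) \<in> profiles n" and i: "1 \<le> i" "i \<le> n"
    and r: "argmax_first (bump N r (Suc i)) i r" "0 < peak_height (bump N r (Suc i)) i r"
  shows "MLT_e n i (tab n (bump N r (Suc i))) = Some (tab n N)"
proof -
  have r': "1 \<le> r" "r \<le> i" "\<forall>s\<in>{1..i}. peak_height (bump N r (Suc i)) i s \<le> peak_height (bump N r (Suc i)) i r"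
    using r by (auto simp: argmax_first_def)
  have "sig_minus i (tab n (bump N r (Suc i))) \<noteq> {}"
    using sig_minus_tab(2) [OF N(2) i r'(3)] r(2) r' by auto
  moreover have "Max (sig_minus i (tab n (bump N r (Suc i)))) = pivot N i r"
    unfolding Max_sig_minus_tab [OF N(2) i r]
    using row_start_bump [OF r'(1), of N i r] by (simp add: pivot_def bump_def)
  ultimately show ?thesis by (rule MLT_e_tab [OF N r'(1,2) i(2)])
qed

lemma MLT_e_None:
  assumes "N \<in> profiles n" "1 \<le> i" "i \<le> n" "argmax_first N i r" "peak_height N i r \<le> 0"
  shows "MLT_e n i (tab n N) = None"
proof -
  have "finite (sig_minus i (tab n N))" "int (card (sig_minus i (tab n N))) = peak_height N i r"
    using sig_minus_tab [OF assms(1-3), of r] assms(4) by (auto simp: argmax_first_def)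
  then have "finite (sig_minus i (tab n N)) \<and> card (sig_minus i (tab n N)) = 0" using assms(5) by linarith
  then have "sig_minus i (tab n N) = {}" using card_0_eq by blast
  then show ?thesis by (simp add: MLT_e_def)
qed

section \<open>The crystal structure on integer sequences\<close>

text \<open>
  The index of \<open>x\<^sub>j\<^sup>(\<^sup>i\<^sup>)\<close> in a sequence.
\<close>

definition seq_pos :: "nat \<Rightarrow> nat \<Rightarrow> nat \<Rightarrow> nat" where
  "seq_pos n j i = (j - 1) * n + i"

lemma iota_seq_pos:
  assumes "1 \<le> i" "i \<le> n"
  shows "iota n (seq_pos n j i) = i"
proof -
  obtain i' where "i = Suc i'" using assms by (cases i) auto
  then show ?thesis using assms by (simp add: seq_pos_def iota_def)
qed

lemma seq_pos_div:
  assumes "1 \<le> i" "i \<le> n"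
  shows "(seq_pos n j i - 1) div n = j - 1"
proof -
  obtain i' where "i = Suc i'" using assms by (cases i) auto
  then show ?thesis using assms by (simp add: seq_pos_def)
qed

lemma seq_pos_cases:
  assumes "1 \<le> n" "1 \<le> k"
  obtains j i where "k = seq_pos n j i" "1 \<le> j" "1 \<le> i" "i \<le> n"
proof
  show "k = seq_pos n ((k - 1) div n + 1) (iota n k)"
    using assms div_mult_mod_eq [of "k - 1" n] by (simp add: seq_pos_def iota_def)
  show "iota n k \<le> n" using assms by (simp add: iota_def Suc_le_eq)
qed (auto simp: iota_def)

lemma seq_pos_le_iff:
  assumes "1 \<le> n" "1 \<le> j" "1 \<le> j'"
  shows "seq_pos n j i \<le> seq_pos n j' i \<longleftrightarrow> j \<le> j'"
  using assms by (auto simp: seq_pos_def)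

lemma entry_seq_pos: "entry n x j i = x (seq_pos n j i)"
  by (simp add: entry_def seq_pos_def)

lemma coroot_alpha:
  assumes "a \<in> {1..n}" "b \<in> {1..n}"
  shows "coroot a (alpha n b) =
    (if a = b then 2 else 0) - (if a = b + 1 then 1 else 0) - (if b = a + 1 then 1 else 0)"
proof -
  have "Poly_Mapping.lookup (omega n c) a = (if a = c then 1 else 0)" for c
    using assms(1) by (auto simp: omega_def lookup_single when_def)
  then show ?thesis
    unfolding coroot_def alpha_def epsv_def lookup_minus using assms by auto
qed

lemma sigma_at_sum:
  assumes "finite F" "\<forall>j\<in>F. k < j" "\<forall>j>k. x j \<noteq> 0 \<longrightarrow> j \<in> F"
  shows "sigma_at n x k = x k + (\<Sum>j\<in>F. coroot (iota n k) (alpha n (iota n j)) * x j)"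
  unfolding sigma_at_def
  by (intro arg_cong2 [where f = "(+)"] refl sum.mono_neutral_left) (use assms in auto)

text \<open>
  \<open>\<sigma>\<^sub>k\<close> is linear, although its defining sum ranges over the support of the sequence.
\<close>

lemma sigma_at_update:
  assumes x: "x \<in> sequences"
  shows "sigma_at n (x(m := x m + d)) k = sigma_at n x k + (if k = m then d else 0) +
    (if k < m then coroot (iota n k) (alpha n (iota n m)) * d else 0)"
proof -
  let ?c = "\<lambda>j. coroot (iota n k) (alpha n (iota n j))"
  let ?F = "{j. k < j \<and> (x j \<noteq> 0 \<or> j = m)}"
  have "finite {j. x j \<noteq> 0}" using x by (simp add: sequences_def)
  then have fin: "finite ?F" using finite_subset [of ?F "insert m {j. x j \<noteq> 0}"] by auto
  have "(\<Sum>j\<in>?F. ?c j * (x(m := x m + d)) j) =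
      (\<Sum>j\<in>?F. ?c j * x j + (if j = m then ?c m * d else 0))"
    by (rule sum.cong) (auto simp: distrib_left)
  also have "\<dots> = (\<Sum>j\<in>?F. ?c j * x j) + (if k < m then ?c m * d else 0)"
    using fin by (simp add: sum.distrib sum.delta)
  finally have sum: "(\<Sum>j\<in>?F. ?c j * (x(m := x m + d)) j) =
      (\<Sum>j\<in>?F. ?c j * x j) + (if k < m then ?c m * d else 0)" .
  have "sigma_at n x k = x k + (\<Sum>j\<in>?F. ?c j * x j)"
    by (rule sigma_at_sum [OF fin]) auto
  moreover have "sigma_at n (x(m := x m + d)) k =
      (x(m := x m + d)) k + (\<Sum>j\<in>?F. ?c j * (x(m := x m + d)) j)"
    by (rule sigma_at_sum [OF fin]) auto
  ultimately show ?thesis unfolding sum by simp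
qed

lemma sigma_at_eq_0:
  assumes "\<forall>j\<ge>k. x j = 0"
  shows "sigma_at n x k = 0"
  using assms sigma_at_sum [of "{}" k x n] by auto

lemma sequences_bound:
  assumes "x \<in> sequences"
  obtains B where "\<forall>j>B. x j = 0"
proof -
  have "finite {k. x k \<noteq> 0}" using assms by (simp add: sequences_def)
  then obtain B where "\<forall>k\<in>{k. x k \<noteq> 0}. k \<le> B" using finite_nat_set_iff_bounded_le by blast
  then show ?thesis using that by (metis mem_Collect_eq not_le)
qed

lemma sequences_update:
  assumes "x \<in> sequences" "1 \<le> m"
  shows "x(m := v) \<in> sequences"
proof -
  have "{k. (x(m := v)) k \<noteq> 0} \<subseteq> insert m {k. x k \<noteq> 0}" by auto
  moreover have "finite (insert m {k. x k \<noteq> 0})" using assms(1) by (simp add: sequences_def)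
  ultimately have "finite {k. (x(m := v)) k \<noteq> 0}" by (rule finite_subset)
  moreover have "(x(m := v)) 0 = 0" using assms by (simp add: sequences_def)
  ultimately show ?thesis unfolding sequences_def by blast
qed

text \<open>
  The crystal axioms rest on the way in which a change of one entry shifts the values of \<open>\<sigma>\<close>. The
  colour of a position \<open>k\<close> is \<open>iota n k\<close>. A change of the entry at \<open>m\<close> by \<open>d\<close> changes \<open>\<sigma>\<^sub>k\<close>, for positions \<open>k\<close> of
  the same colour, by \<open>d\<close> for \<open>k = m\<close>, by \<open>2 d\<close> for \<open>k < m\<close> and not at all for \<open>k > m\<close>.
\<close>

context
  fixes n i :: nat
  assumes i: "1 \<le> i" "i \<le> n"
begin

lemma ex_zero_sigma_at:
  assumes "x \<in> sequences"
  obtains B where "\<forall>k>B. sigma_at n x k = 0"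
    "\<exists>k. 1 \<le> k \<and> iota n k = i \<and> sigma_at n x k = 0"
proof -
  obtain B where "\<forall>j>B. x j = 0" using sequences_bound [OF assms] .
  then have z: "\<forall>k>B. sigma_at n x k = 0" using sigma_at_eq_0 by simp
  have "(B + 1) * 1 \<le> (B + 1) * n" using i by (intro mult_le_mono2) simp
  then have "B < seq_pos n (B + 2) i" using i by (simp add: seq_pos_def)
  moreover have "iota n (seq_pos n (B + 2) i) = i" by (rule iota_seq_pos [OF i])
  moreover have "1 \<le> seq_pos n (B + 2) i" using i by (simp add: seq_pos_def)
  ultimately show ?thesis using that z by blast
qed

lemma finite_sigma_at:
  assumes "x \<in> sequences"
  shows "finite (sigma_at n x ` {k. 1 \<le> k \<and> iota n k = i})"
proof -
  obtain B where "\<forall>k>B. sigma_at n x k = 0" using ex_zero_sigma_at [OF assms] by metis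
  then have "sigma_at n x k \<in> insert 0 (sigma_at n x ` {..B})" for k by (cases "k \<le> B") auto
  then have "sigma_at n x ` {k. 1 \<le> k \<and> iota n k = i} \<subseteq> insert 0 (sigma_at n x ` {..B})" by blast
  then show ?thesis using finite_subset by blast
qed

lemma sigma_at_le_max:
  assumes "x \<in> sequences" "1 \<le> k" "iota n k = i"
  shows "sigma_at n x k \<le> sigma_max n i x"
  unfolding sigma_max_def by (rule Max_ge [OF finite_sigma_at [OF assms(1)]]) (use assms in auto)

lemma sigma_max_eqI:
  assumes "x \<in> sequences" "1 \<le> k" "iota n k = i" "sigma_at n x k = m"
    and "\<And>l. 1 \<le> l \<Longrightarrow> iota n l = i \<Longrightarrow> sigma_at n x l \<le> m"
  shows "sigma_max n i x = m"
  unfolding sigma_max_def by (rule Max_eqI [OF finite_sigma_at [OF assms(1)]]) (use assms in auto)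

lemma sigma_max_nonneg:
  assumes "x \<in> sequences"
  shows "0 \<le> sigma_max n i x"
  using ex_zero_sigma_at [OF assms] sigma_at_le_max [OF assms] by metis

lemma M_set_nonempty:
  assumes "x \<in> sequences"
  shows "M_set n i x \<noteq> {}"
proof -
  have "sigma_max n i x \<in> sigma_at n x ` {k. 1 \<le> k \<and> iota n k = i}"
    unfolding sigma_max_def
    using ex_zero_sigma_at [OF assms] by (intro Max_in finite_sigma_at assms) blast
  then show ?thesis by (auto simp: M_set_def)
qed

lemma finite_M_set:
  assumes "x \<in> sequences" "0 < sigma_max n i x"
  shows "finite (M_set n i x)"
proof -
  obtain B where "\<forall>k>B. sigma_at n x k = 0" using ex_zero_sigma_at [OF assms(1)] by metis
  then have "\<not> B < k" if "k \<in> M_set n i x" for k using that assms(2) by (auto simp: M_set_def)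
  then have "M_set n i x \<subseteq> {..B}" by (auto simp: not_less)
  then show ?thesis using finite_subset by blast
qed

lemma Sigma_f_eqI:
  assumes "k \<in> M_set n i x" "\<And>l. l \<in> M_set n i x \<Longrightarrow> k \<le> l"
  shows "Sigma_f n i x = Some (x(k := x k + 1))"
proof -
  have "(LEAST k. k \<in> M_set n i x) = k" using assms by (rule Least_equality)
  then show ?thesis by (simp add: Sigma_f_def)
qed

lemma Sigma_e_eqI:
  assumes "x \<in> sequences" "0 < sigma_max n i x"
    and "k \<in> M_set n i x" "\<And>l. l \<in> M_set n i x \<Longrightarrow> l \<le> k"
  shows "Sigma_e n i x = Some (x(k := x k - 1))"
proof -
  have "Max (M_set n i x) = k" using finite_M_set [OF assms(1,2)] assms by (intro Max_eqI) auto
  then show ?thesis using assms(2) by (simp add: Sigma_e_def)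
qed

lemma sigma_at_update_same:
  assumes "x \<in> sequences" "iota n m = i" "iota n k = i"
  shows "sigma_at n (x(m := x m + d)) k =
    sigma_at n x k + (if k = m then d else if k < m then 2 * d else 0)"
  using sigma_at_update [OF assms(1), of n m d k] coroot_alpha [of i n i] i assms by auto

text \<open>
  At the first maximum \<open>k\<close> of \<open>\<sigma>\<close>, the smaller positions have values at most the maximum minus one
  and gain 2, so that \<open>k\<close> becomes the last position of a maximum that is larger by one. Hence the
  operator lowering the entry at the last maximum undoes the step, and conversely.
\<close>

lemma Sigma_f_inverse:
  assumes x: "x \<in> sequences" and y: "Sigma_f n i x = Some y"
  shows "y \<in> sequences" "sigma_max n i y = sigma_max n i x + 1" "Sigma_e n i y = Some x"
    "\<exists>k. iota n k = i \<and> 1 \<le> k \<and> y = x(k := x k + 1)"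
proof -
  define k where "k = (LEAST k. k \<in> M_set n i x)"
  obtain l0 where "l0 \<in> M_set n i x" using M_set_nonempty [OF x] by blast
  then have "k \<in> M_set n i x" unfolding k_def by (rule LeastI)
  then have k: "1 \<le> k" "iota n k = i" "sigma_at n x k = sigma_max n i x" by (auto simp: M_set_def)
  have beyond: "k \<le> l" if "l \<in> M_set n i x" for l unfolding k_def using that by (rule Least_le)
  have less: "sigma_at n x l < sigma_max n i x" if l: "1 \<le> l" "iota n l = i" "l < k" for l
  proof -
    have "l \<notin> M_set n i x" using beyond [of l] l(3) by auto
    then have "sigma_at n x l \<noteq> sigma_max n i x" using l(1,2) unfolding M_set_def by blast
    then show ?thesis using sigma_at_le_max [OF x l(1,2)] by simp
  qed
  have yk: "y = x(k := x k + 1)" using y by (simp add: Sigma_f_def k_def Let_def)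
  then show ex: "\<exists>k. iota n k = i \<and> 1 \<le> k \<and> y = x(k := x k + 1)" using k by blast
  show ys: "y \<in> sequences" unfolding yk using x k(1) by (rule sequences_update)
  have at: "sigma_at n y l = sigma_at n x l + (if l = k then 1 else if l < k then 2 else 0)"
    if "iota n l = i" for l
    using sigma_at_update_same [OF x k(2) that, of 1] by (simp add: yk)
  show max: "sigma_max n i y = sigma_max n i x + 1"
  proof (rule sigma_max_eqI [OF ys k(1,2)])
    show "sigma_at n y k = sigma_max n i x + 1" using at k by simp
    fix l assume l: "1 \<le> l" "iota n l = i"
    then show "sigma_at n y l \<le> sigma_max n i x + 1"
      using at [of l] sigma_at_le_max [OF x l] less [of l] by auto
  qed
  have "Sigma_e n i y = Some (y(k := y k - 1))"
  proof (rule Sigma_e_eqI [OF ys])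
    show "0 < sigma_max n i y" using max sigma_max_nonneg [OF x] by simp
    show "k \<in> M_set n i y" using k at max by (simp add: M_set_def)
    fix l assume l: "l \<in> M_set n i y"
    show "l \<le> k"
    proof (rule ccontr)
      assume "\<not> l \<le> k"
      moreover have "1 \<le> l" "iota n l = i" "sigma_at n y l = sigma_max n i y"
        using l by (auto simp: M_set_def)
      ultimately show False using at [of l] max sigma_at_le_max [OF x, of l] by simp
    qed
  qed
  then show "Sigma_e n i y = Some x" by (simp add: yk)
qed

lemma Sigma_e_inverse:
  assumes x: "x \<in> sequences" and y: "Sigma_e n i x = Some y"
  shows "y \<in> sequences" "sigma_max n i y = sigma_max n i x - 1" "Sigma_f n i y = Some x"
    "\<exists>k. iota n k = i \<and> 1 \<le> k \<and> y = x(k := x k - 1)"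
proof -
  have pos: "0 < sigma_max n i x" using y by (auto simp: Sigma_e_def split: if_splits)
  define k where "k = Max (M_set n i x)"
  note fin = finite_M_set [OF x pos]
  have "k \<in> M_set n i x" unfolding k_def using M_set_nonempty [OF x] fin by (rule Max_in [rotated])
  then have k: "1 \<le> k" "iota n k = i" "sigma_at n x k = sigma_max n i x" by (auto simp: M_set_def)
  have beyond: "l \<le> k" if "l \<in> M_set n i x" for l unfolding k_def using fin that by (rule Max_ge)
  have less: "sigma_at n x l < sigma_max n i x" if l: "1 \<le> l" "iota n l = i" "k < l" for l
  proof -
    have "l \<notin> M_set n i x" using beyond [of l] l(3) by auto
    then have "sigma_at n x l \<noteq> sigma_max n i x" using l(1,2) unfolding M_set_def by blast
    then show ?thesis using sigma_at_le_max [OF x l(1,2)] by simp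
  qed
  have yk: "y = x(k := x k + - 1)" using y pos by (simp add: Sigma_e_def k_def Let_def)
  then show ex: "\<exists>k. iota n k = i \<and> 1 \<le> k \<and> y = x(k := x k - 1)" using k by auto
  show ys: "y \<in> sequences" unfolding yk using x k(1) by (rule sequences_update)
  have at: "sigma_at n y l = sigma_at n x l - (if l = k then 1 else if l < k then 2 else 0)"
    if "iota n l = i" for l
    using sigma_at_update_same [OF x k(2) that, of "- 1"] unfolding yk by simp
  show max: "sigma_max n i y = sigma_max n i x - 1"
  proof (rule sigma_max_eqI [OF ys k(1,2)])
    show "sigma_at n y k = sigma_max n i x - 1" using at k by simp
    fix l assume l: "1 \<le> l" "iota n l = i"
    then show "sigma_at n y l \<le> sigma_max n i x - 1"
      using at [of l] sigma_at_le_max [OF x l] less [of l] by (cases l k rule: linorder_cases) auto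
  qed
  have "Sigma_f n i y = Some (y(k := y k + 1))"
  proof (rule Sigma_f_eqI)
    show "k \<in> M_set n i y" using k at max by (simp add: M_set_def)
    fix l assume l: "l \<in> M_set n i y"
    show "k \<le> l"
    proof (rule ccontr)
      assume "\<not> k \<le> l"
      moreover have "1 \<le> l" "iota n l = i" "sigma_at n y l = sigma_max n i y"
        using l by (auto simp: M_set_def)
      ultimately show False using at [of l] max sigma_at_le_max [OF x, of l] by simp
    qed
  qed
  then show "Sigma_f n i y = Some x" by (simp add: yk)
qed

end

lemma Sigma_wt_sum:
  assumes "finite F" "\<forall>j\<in>F. 1 \<le> j" "\<forall>j\<ge>1. x j \<noteq> 0 \<longrightarrow> j \<in> F"
  shows "Sigma_wt n x = - (\<Sum>j\<in>F. frag_cmul (x j) (alpha n (iota n j)))"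
  unfolding Sigma_wt_def
  by (intro arg_cong [where f = uminus] sum.mono_neutral_left) (use assms in auto)

lemma Sigma_wt_update:
  assumes x: "x \<in> sequences" and "1 \<le> m"
  shows "Sigma_wt n (x(m := x m + d)) = Sigma_wt n x - frag_cmul d (alpha n (iota n m))"
proof -
  let ?F = "insert m {j. 1 \<le> j \<and> x j \<noteq> 0}"
  have fin: "finite ?F"
    using x by (auto simp: sequences_def intro: rev_finite_subset)
  have "(\<Sum>j\<in>?F. frag_cmul ((x(m := x m + d)) j) (alpha n (iota n j))) =
      (\<Sum>j\<in>?F. frag_cmul (x j) (alpha n (iota n j)) +
        (if j = m then frag_cmul d (alpha n (iota n m)) else 0))"
    by (rule sum.cong) (auto simp: frag_cmul_distrib)
  also have "\<dots> = (\<Sum>j\<in>?F. frag_cmul (x j) (alpha n (iota n j))) +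
      frag_cmul d (alpha n (iota n m))"
    unfolding sum.distrib using fin by (subst sum.delta) auto
  finally show ?thesis
    using Sigma_wt_sum [OF fin, of x n] Sigma_wt_sum [OF fin, of "x(m := x m + d)" n] assms(2)
    by auto
qed

lemma Sigma_wt_in_lattice: "Sigma_wt n x \<in> weight_lattice n"
proof -
  have "Poly_Mapping.lookup (Sigma_wt n x) k = 0" if k: "k \<notin> {1..n}" for k
  proof -
    have "Poly_Mapping.lookup (omega n c) k = 0" for c
      using k by (auto simp: omega_def lookup_single when_def)
    then have "Poly_Mapping.lookup (alpha n b) k = 0" for b
      unfolding alpha_def epsv_def lookup_minus by simp
    then show ?thesis by (simp add: Sigma_wt_def lookup_sum)
  qed
  then show ?thesis
    unfolding weight_lattice_def by (auto simp: in_keys_iff simp del: atLeastAtMost_iff)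
qed

text \<open>
  What remains to be shown for the polyhedral realization is that the operators preserve it.
\<close>

lemma Sigma_crystal_is_crystal:
  assumes f: "\<And>i x y. i \<in> {1..n} \<Longrightarrow> x \<in> Sigma_iota n \<Longrightarrow> Sigma_f n i x = Some y \<Longrightarrow> y \<in> Sigma_iota n"
    and e: "\<And>i x y. i \<in> {1..n} \<Longrightarrow> x \<in> Sigma_iota n \<Longrightarrow> Sigma_e n i x = Some y \<Longrightarrow> y \<in> Sigma_iota n"
  shows "is_crystal n (Sigma_crystal n)"
proof -
  have seq: "x \<in> sequences" if "x \<in> Sigma_iota n" for x using that by (simp add: Sigma_iota_def)
  have f_step: "Sigma_wt n y = Sigma_wt n x - alpha n i \<and>
      sigma_max n i y = sigma_max n i x + 1 \<and> Sigma_e n i y = Some x"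
    if "i \<in> {1..n}" "x \<in> Sigma_iota n" "Sigma_f n i x = Some y" for i x y
  proof -
    have i: "1 \<le> i" "i \<le> n" using that by auto
    note inv = Sigma_f_inverse [OF i seq [OF that(2)] that(3)]
    obtain k where "iota n k = i" "1 \<le> k" "y = x(k := x k + 1)" using inv(4) by blast
    then show ?thesis using inv Sigma_wt_update [OF seq [OF that(2)], of k n 1] by simp
  qed
  have e_step: "Sigma_wt n y = Sigma_wt n x + alpha n i \<and>
      sigma_max n i y = sigma_max n i x - 1 \<and> Sigma_f n i y = Some x"
    if "i \<in> {1..n}" "x \<in> Sigma_iota n" "Sigma_e n i x = Some y" for i x y
  proof -
    have i: "1 \<le> i" "i \<le> n" using that by auto
    note inv = Sigma_e_inverse [OF i seq [OF that(2)] that(3)]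
    obtain k where "iota n k = i" "1 \<le> k" "y = x(k := x k - 1)" using inv(4) by blast
    then show ?thesis using inv Sigma_wt_update [OF seq [OF that(2)], of k n "- 1"] by simp
  qed
  have pair: "coroot i (alpha n i) = 2" if "i \<in> {1..n}" for i using coroot_alpha [of i n i] that by simp
  have coroot_diff: "coroot i (v - w) = coroot i v - coroot i w" for i v w
    by (simp add: coroot_def lookup_minus)
  have zero: "z \<in> with_zero B" if "\<And>y. z = Some y \<Longrightarrow> y \<in> B" for z and B :: "intseq set"
    using that by (cases z) (auto simp: with_zero_def)
  have op: "e_op (Sigma_crystal n) = Sigma_e n" "f_op (Sigma_crystal n) = Sigma_f n"
    "elems (Sigma_crystal n) = Sigma_iota n" "wt (Sigma_crystal n) = Sigma_wt n"
    "veps (Sigma_crystal n) = (\<lambda>i x. Fin (sigma_max n i x))"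
    "vphi (Sigma_crystal n) = (\<lambda>i x. Fin (coroot i (Sigma_wt n x)) + Fin (sigma_max n i x))"
    by (simp_all add: Sigma_crystal_def)
  show ?thesis
    unfolding is_crystal_def op
  proof (intro conjI ballI allI impI)
    fix i x y assume h: "i \<in> {1..n}" "x \<in> Sigma_iota n" "Sigma_e n i x = Some y"
    note s = e_step [OF h]
    show "Sigma_wt n y = Sigma_wt n x + alpha n i"
      "Fin (sigma_max n i y) = Fin (sigma_max n i x) - 1"
      "Fin (coroot i (Sigma_wt n y)) + Fin (sigma_max n i y) =
        Fin (coroot i (Sigma_wt n x)) + Fin (sigma_max n i x) + 1"
      using s pair [OF h(1)] by (simp_all add: coroot_add one_extended_def)
  next
    fix i x y assume h: "i \<in> {1..n}" "x \<in> Sigma_iota n" "Sigma_f n i x = Some y"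
    note s = f_step [OF h]
    show "Sigma_wt n y = Sigma_wt n x - alpha n i"
      "Fin (sigma_max n i y) = Fin (sigma_max n i x) + 1"
      "Fin (coroot i (Sigma_wt n y)) + Fin (sigma_max n i y) =
        Fin (coroot i (Sigma_wt n x)) + Fin (sigma_max n i x) - 1"
      using s pair [OF h(1)] by (simp_all add: coroot_diff one_extended_def)
  next
    fix i x y assume h: "i \<in> {1..n}" "x \<in> Sigma_iota n" "y \<in> Sigma_iota n"
    show "Sigma_f n i x = Some y \<longleftrightarrow> Sigma_e n i y = Some x"
      using f_step [OF h(1,2)] e_step [OF h(1,3)] by blast
  next
    fix i x assume h: "i \<in> {1..n}" "x \<in> Sigma_iota n"
    show "Sigma_e n i x \<in> with_zero (Sigma_iota n)" by (rule zero) (rule e [OF h])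
    show "Sigma_f n i x \<in> with_zero (Sigma_iota n)" by (rule zero) (rule f [OF h])
  qed (auto simp: Sigma_wt_in_lattice)
qed

section \<open>The polyhedral realization in terms of row profiles\<close>

text \<open>
  The sequence with \<open>x\<^sub>j\<^sup>(\<^sup>i\<^sup>) = N (a + 1 - j) (a + 1)\<close> for \<open>a = n + 1 - i\<close>. Truncated
  subtraction yields row 0, hence the value 0, for \<open>i + j > n + 1\<close>.
\<close>

definition seq_of :: "nat \<Rightarrow> (nat \<Rightarrow> nat \<Rightarrow> nat) \<Rightarrow> intseq" where
  "seq_of n N m = (if m = 0 then 0
     else int (N (n + 1 - iota n m - (m - 1) div n) (n + 2 - iota n m)))"

lemma seq_of_seq_pos:
  assumes "1 \<le> i" "i \<le> n" "1 \<le> j"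
  shows "seq_of n N (seq_pos n j i) = int (N (n + 2 - i - j) (n + 2 - i))"
proof -
  have "seq_pos n j i \<noteq> 0" using assms by (simp add: seq_pos_def)
  moreover have "n + 1 - i - (j - 1) = n + 2 - i - j" using assms by simp
  ultimately show ?thesis
    unfolding seq_of_def iota_seq_pos [OF assms(1,2)] seq_pos_div [OF assms(1,2)] by simp
qed

lemma seq_of_bump:
  assumes "1 \<le> r" "r \<le> a" "a \<le> n"
  shows "seq_of n (bump N r (Suc a)) =
    (seq_of n N)(seq_pos n (a + 1 - r) (n + 1 - a) :=
       seq_of n N (seq_pos n (a + 1 - r) (n + 1 - a)) + 1)"
proof
  fix m
  show "seq_of n (bump N r (Suc a)) m =
    ((seq_of n N)(seq_pos n (a + 1 - r) (n + 1 - a) :=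
       seq_of n N (seq_pos n (a + 1 - r) (n + 1 - a)) + 1)) m"
  proof (cases "m = 0")
    case True
    then show ?thesis using assms by (simp add: seq_of_def seq_pos_def)
  next
    case False
    then obtain j i where m: "m = seq_pos n j i" "1 \<le> j" "1 \<le> i" "i \<le> n"
      using seq_pos_cases [of n m] assms by auto
    have "m = seq_pos n (a + 1 - r) (n + 1 - a) \<longleftrightarrow> i = n + 1 - a \<and> j = a + 1 - r"
    proof
      assume eq: "m = seq_pos n (a + 1 - r) (n + 1 - a)"
      have "i = n + 1 - a"
        using iota_seq_pos [of i n j] iota_seq_pos [of "n + 1 - a" n "a + 1 - r"] m eq assms by simp
      moreover have "j - 1 = a + 1 - r - 1"
        using seq_pos_div [of i n j] seq_pos_div [of "n + 1 - a" n "a + 1 - r"] m eq assms by simp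
      ultimately show "i = n + 1 - a \<and> j = a + 1 - r" using m assms by simp
    qed (use m in auto)
    moreover have "n + 2 - i = Suc a \<and> n + 2 - i - j = r \<longleftrightarrow> i = n + 1 - a \<and> j = a + 1 - r"
      using m assms by auto
    moreover have "seq_of n (bump N r (Suc a)) m = seq_of n N m +
        (if n + 2 - i - j = r \<and> n + 2 - i = Suc a then 1 else 0)"
      using seq_of_seq_pos [OF m(3,4,2)] unfolding m(1) by (simp add: bump_def)
    ultimately show ?thesis by auto
  qed
qed

lemma profiles_eqI:
  assumes "N \<in> profiles n" "N' \<in> profiles n"
    and "\<And>r a. 1 \<le> r \<Longrightarrow> r < a \<Longrightarrow> a \<le> n + 1 \<Longrightarrow> N r a = N' r a"
  shows "N = N'"
proof (intro ext)
  fix r a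
  show "N r a = N' r a"
  proof (cases "1 \<le> r \<and> r < a \<and> a \<le> n + 1")
    case False
    then have "r = 0 \<or> a \<le> r \<or> n + 1 < a" by auto
    then show ?thesis using profile_eq_0 assms(1,2) by metis
  qed (use assms(3) in blast)
qed

lemma seq_of_support:
  assumes n: "1 \<le> n" and N: "N \<in> profiles n" and m: "seq_of n N m \<noteq> 0"
  obtains j i where "m = seq_pos n j i" "1 \<le> j" "j \<le> n" "1 \<le> i" "i \<le> n"
proof -
  have "m \<noteq> 0" using m by (auto simp: seq_of_def split: if_splits)
  then obtain j i where ji: "m = seq_pos n j i" "1 \<le> j" "1 \<le> i" "i \<le> n"
    using seq_pos_cases [of n m] n by auto
  have "n + 2 - i - j \<noteq> 0"
  proof
    assume "n + 2 - i - j = 0"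
    then have "seq_of n N m = 0"
      unfolding ji(1) seq_of_seq_pos [OF ji(3,4,2)] using profile_eq_0 [OF N, of 0] by simp
    then show False using m by simp
  qed
  then have "j \<le> n" using ji by simp
  then show thesis using that ji by blast
qed

lemma seq_of_support_image:
  assumes "1 \<le> n" "N \<in> profiles n" "seq_of n N m \<noteq> 0"
  shows "m \<in> (\<lambda>(i, j). seq_pos n j i) ` ({1..n} \<times> {1..n})"
proof -
  obtain j i where "m = seq_pos n j i" "1 \<le> j" "j \<le> n" "1 \<le> i" "i \<le> n"
    using seq_of_support [OF assms] .
  then have "m = (\<lambda>(i, j). seq_pos n j i) (i, j)" "(i, j) \<in> {1..n} \<times> {1..n}" by simp_all
  then show ?thesis by (rule image_eqI)
qed

lemma seq_of_in_Sigma_iota: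
  assumes n: "1 \<le> n" and N: "N \<in> profiles n"
  shows "seq_of n N \<in> Sigma_iota n"
proof -
  have entry: "entry n (seq_of n N) j i = int (N (n + 2 - i - j) (n + 2 - i))"
    if "1 \<le> i" "i \<le> n" "1 \<le> j" for i j
    using seq_of_seq_pos [OF that] by (simp add: entry_seq_pos)
  have "{m. seq_of n N m \<noteq> 0} \<subseteq> (\<lambda>(i, j). seq_pos n j i) ` ({1..n} \<times> {1..n})"
    using seq_of_support_image [OF n N] by blast
  then have "finite {m. seq_of n N m \<noteq> 0}" by (rule finite_subset) simp
  moreover have "seq_of n N 0 = 0" by (simp add: seq_of_def)
  ultimately have "seq_of n N \<in> sequences" unfolding sequences_def by blast
  moreover have "entry n (seq_of n N) (j + 1) (i - j) \<le> entry n (seq_of n N) j (i + 1 - j)"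
    if "i \<in> {1..n}" "j \<in> {1..<i}" for i j
  proof -
    have "n + 2 - (i - j) - (j + 1) = n + 1 - i" "n + 2 - (i + 1 - j) - j = n + 1 - i"
      "n + 2 - (i + 1 - j) \<le> n + 2 - (i - j)" "n + 1 - i < n + 2 - (i + 1 - j)"
      using that by auto
    then show ?thesis
      using that entry [of "i - j" "j + 1"] entry [of "i + 1 - j" j]
        profile_antimono [OF N, of "n + 1 - i" "n + 2 - (i + 1 - j)" "n + 2 - (i - j)"]
      by auto
  qed
  moreover have "entry n (seq_of n N) j i = 0" if "i \<in> {1..n}" "1 \<le> j" "n + 1 < i + j" for i j
    using that entry [of i j] profile_eq_0 [OF N, of "n + 2 - i - j"] by auto
  moreover have "0 \<le> entry n (seq_of n N) i 1" if "i \<in> {1..n}" for i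
    using that entry [of 1 i] n by auto
  ultimately show ?thesis unfolding Sigma_iota_def by blast
qed

text \<open>
  The chain of inequalities belonging to \<open>i\<close> expresses that row \<open>n + 1 - i\<close> of the profile is
  nonnegative and weakly decreasing.
\<close>

lemma bij_betw_seq_of:
  assumes n: "1 \<le> n"
  shows "bij_betw (seq_of n) (profiles n) (Sigma_iota n)"
  unfolding bij_betw_def
proof
  show "inj_on (seq_of n) (profiles n)"
  proof (rule inj_onI)
    fix N N' assume N: "N \<in> profiles n" "N' \<in> profiles n" and eq: "seq_of n N = seq_of n N'"
    show "N = N'"
    proof (rule profiles_eqI [OF N])
      fix r a :: nat assume ra: "1 \<le> r" "r < a" "a \<le> n + 1"
      then have "n + 2 - (n + 2 - a) - (a - r) = r" "n + 2 - (n + 2 - a) = a" by auto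
      then show "N r a = N' r a"
        using seq_of_seq_pos [of "n + 2 - a" n "a - r" N] seq_of_seq_pos [of "n + 2 - a" n "a - r" N']
          eq ra by auto
    qed
  qed
  show "seq_of n ` profiles n = Sigma_iota n"
  proof
    show "seq_of n ` profiles n \<subseteq> Sigma_iota n" using seq_of_in_Sigma_iota [OF n] by blast
    show "Sigma_iota n \<subseteq> seq_of n ` profiles n"
    proof
      fix x assume x: "x \<in> Sigma_iota n"
      have chain: "entry n x (j + 1) (i - j) \<le> entry n x j (i + 1 - j)"
        if "1 \<le> i" "i \<le> n" "1 \<le> j" "j < i" for i j
        using x that by (auto simp: Sigma_iota_def)
      have bottom: "0 \<le> entry n x i 1" if "1 \<le> i" "i \<le> n" for i
        using x that by (auto simp: Sigma_iota_def)
      have zero: "entry n x j i = 0" if "1 \<le> i" "i \<le> n" "1 \<le> j" "n + 1 < i + j" for i j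
        using x that by (auto simp: Sigma_iota_def)
      have nonneg: "0 \<le> entry n x j (i + 1 - j)" if "1 \<le> j" "j \<le> i" "i \<le> n" for i j
        using that(2,1)
      proof (induction j rule: inc_induct)
        case base
        then show ?case using bottom [of i] that by simp
      next
        case (step j)
        then show ?case using chain [of i j] that by auto
      qed
      define N where "N = (\<lambda>r a. if 1 \<le> r \<and> r < a \<and> a \<le> n + 1
        then nat (entry n x (a - r) (n + 2 - a)) else 0)"
      have "N \<in> profiles n"
        unfolding profiles_def
      proof (intro CollectI conjI allI impI)
        fix r a :: nat assume "r < a"
        show "N r (Suc a) \<le> N r a"
        proof (cases "1 \<le> r \<and> a \<le> n")
          case True
          then have "n + 1 - r - (a - r) = n + 2 - Suc a" "n + 1 - r + 1 - (a - r) = n + 2 - a"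
            "a - r + 1 = Suc a - r"
            using \<open>r < a\<close> by auto
          then show ?thesis
            using chain [of "n + 1 - r" "a - r"] True \<open>r < a\<close> by (auto simp: N_def intro: nat_mono)
        qed (auto simp: N_def)
      qed (auto simp: N_def split: if_splits)
      moreover have "seq_of n N = x"
      proof
        fix m
        show "seq_of n N m = x m"
        proof (cases "m = 0")
          case True
          then show ?thesis using x by (simp add: seq_of_def Sigma_iota_def sequences_def)
        next
          case False
          then obtain j i where m: "m = seq_pos n j i" "1 \<le> j" "1 \<le> i" "i \<le> n"
            using seq_pos_cases [of n m] n by auto
          show ?thesis
          proof (cases "i + j \<le> n + 1")
            case True
            have "0 \<le> entry n x j i" using nonneg [of j "i + j - 1"] m True by simp
            moreover have e: "n + 2 - i - (n + 2 - i - j) = j" "n + 2 - (n + 2 - i) = i"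
              using True m by auto
            moreover have c: "1 \<le> n + 2 - i - j" "n + 2 - i - j < n + 2 - i" "n + 2 - i \<le> n + 1"
              using True m by auto
            have "N (n + 2 - i - j) (n + 2 - i) = nat (entry n x j i)"
              by (simp only: N_def c e simp_thms if_True)
            ultimately have "int (N (n + 2 - i - j) (n + 2 - i)) = entry n x j i" by simp
            then show ?thesis
              unfolding m(1) seq_of_seq_pos [OF m(3,4,2)] by (simp add: entry_seq_pos)
          next
            case False
            then have "x m = 0" using zero [of i j] m by (simp add: entry_seq_pos)
            moreover have "n + 2 - i - j = 0" using False by simp
            ultimately show ?thesis using m seq_of_seq_pos [OF m(3,4,2), of N] by (simp add: N_def)
          qed
        qed
      qed
      ultimately show "x \<in> seq_of n ` profiles n" by blast
    qed
  qed
qed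

text \<open>
  Between two consecutive positions of colour \<open>i\<close> every other colour occurs once, and
  only the neighbouring colours \<open>i - 1\<close> and \<open>i + 1\<close> contribute.
\<close>

lemma sigma_at_seq_pos_diff:
  assumes x: "x \<in> sequences" and i: "1 \<le> i" "i \<le> n" and j: "1 \<le> j"
  shows "sigma_at n x (seq_pos n j i) - sigma_at n x (seq_pos n (j + 1) i) =
    x (seq_pos n j i) + x (seq_pos n (j + 1) i)
    - (if 1 < i then x (seq_pos n (j + 1) (i - 1)) else 0)
    - (if i < n then x (seq_pos n j (i + 1)) else 0)"
proof -
  let ?k = "seq_pos n j i"
  have next_pos: "seq_pos n (j + 1) i = ?k + n" using j by (cases j) (auto simp: seq_pos_def)
  obtain B0 where B0: "\<forall>l>B0. x l = 0" using sequences_bound [OF x] .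
  define B where "B = B0 + ?k + n"
  have B: "\<forall>l>B. x l = 0" "?k + n \<le> B" using B0 by (auto simp: B_def)
  define f where "f l = coroot i (alpha n (iota n l)) * x l" for l
  have at: "sigma_at n x k = x k + sum f {k<..B}" if "iota n k = i" for k
  proof -
    have "sigma_at n x k = x k + (\<Sum>j\<in>{k<..B}. coroot (iota n k) (alpha n (iota n j)) * x j)"
      by (rule sigma_at_sum) (use B in \<open>auto simp: not_less [symmetric]\<close>)
    then show ?thesis by (simp add: f_def that)
  qed
  have "{?k<..B} = {?k<..?k + n} \<union> {?k + n<..B}" using B(2) by auto
  then have sum_eq: "sum f {?k<..B} = sum f {?k<..?k + n} + sum f {?k + n<..B}"
    by (simp add: sum.union_disjoint)
  then have diff: "sigma_at n x ?k - sigma_at n x (?k + n) = x ?k - x (?k + n) + sum f {?k<..?k + n}"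
  proof -
    have "iota n ?k = i" "iota n (?k + n) = i"
      using iota_seq_pos [OF i, of j] iota_seq_pos [OF i, of "j + 1"] next_pos by simp_all
    then show ?thesis using at [of ?k] at [of "?k + n"] sum_eq by simp
  qed
  \<comment> \<open>\<open>g b\<close> is the only position of colour \<open>b\<close> in the interval of length \<open>n\<close> after \<open>?k\<close>\<close>
  define g where "g b = (if b \<le> i then seq_pos n (j + 1) b else seq_pos n j b)" for b
  have g_iota: "iota n (g b) = b" if "b \<in> {1..n}" for b
    using that iota_seq_pos by (simp add: g_def)
  have inj: "inj_on g {1..n}" using g_iota by (metis inj_onI)
  have "g b \<in> {?k<..?k + n}" if "b \<in> {1..n}" for b
    using that i j by (cases j) (auto simp: g_def seq_pos_def)
  then have "g ` {1..n} \<subseteq> {?k<..?k + n}" by blast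
  then have "g ` {1..n} = {?k<..?k + n}"
    using card_image [OF inj] by (intro card_subset_eq) auto
  then have "sum f {?k<..?k + n} = (\<Sum>b = 1..n. f (g b))"
    using sum.reindex [OF inj, of f] by (simp add: o_def)
  also have "\<dots> = (\<Sum>b = 1..n. (if b = i then 2 * x (g b) else 0)
      - (if b = i - 1 then x (g b) else 0) - (if b = i + 1 then x (g b) else 0))"
  proof (rule sum.cong [OF refl])
    fix b assume b: "b \<in> {1..n}"
    then have "f (g b) = coroot i (alpha n b) * x (g b)" by (simp add: f_def g_iota)
    moreover have "i = b + 1 \<longleftrightarrow> b = i - 1" using b i by auto
    ultimately show "f (g b) = (if b = i then 2 * x (g b) else 0)
      - (if b = i - 1 then x (g b) else 0) - (if b = i + 1 then x (g b) else 0)"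
      using coroot_alpha [of i n b] b i by auto
  qed
  also have "\<dots> = 2 * x (g i) - (if 1 < i then x (g (i - 1)) else 0)
      - (if i < n then x (g (i + 1)) else 0)"
    unfolding sum_subtractf using i by (auto simp: sum.delta)
  finally have "sum f {?k<..?k + n} = \<dots>" .
  then show ?thesis using diff unfolding next_pos [symmetric] by (simp add: g_def)
qed

text \<open>
  The link between the two crystals: \<open>\<sigma>\<^sub>k\<close> is the height of a peak of the signature word. Larger
  positions \<open>k\<close> correspond to higher rows, so that the first maximum of \<open>\<sigma>\<close> is the last highest
  peak. Both sides vanish for large \<open>j\<close> and have the same differences.
\<close>

lemma sigma_at_seq_of:
  assumes N: "N \<in> profiles n" and i: "1 \<le> i" "i \<le> n" and j: "1 \<le> j"
  shows "sigma_at n (seq_of n N) (seq_pos n j i) = peak_height N (n + 1 - i) (n + 2 - i - j)"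
proof -
  let ?x = "seq_of n N"
  let ?a = "n + 1 - i"
  have x: "?x \<in> sequences" using seq_of_in_Sigma_iota [OF _ N] i by (simp add: Sigma_iota_def)
  have vanish: "sigma_at n ?x (seq_pos n j i) = 0" if "n < j" for j
  proof (rule sigma_at_eq_0, intro allI impI)
    fix m assume m: "seq_pos n j i \<le> m"
    have "1 \<le> m" using m i by (simp add: seq_pos_def)
    then obtain j' i' where m': "m = seq_pos n j' i'" "1 \<le> j'" "1 \<le> i'" "i' \<le> n"
      using seq_pos_cases [of n m] i by auto
    have "n * n \<le> (j - 1) * n" using that by (intro mult_le_mono1) simp
    then have "n * n < m" using m i unfolding seq_pos_def by linarith
    have "n < j'"
    proof (rule ccontr)
      assume "\<not> n < j'"
      then have "(j' - 1) * n \<le> (n - 1) * n" by (intro mult_le_mono1) simp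
      then have "m \<le> (n - 1) * n + n" using m'(1,4) unfolding seq_pos_def by linarith
      also have "\<dots> = n * n" using i by (cases n) auto
      finally show False using \<open>n * n < m\<close> by simp
    qed
    then have "n + 2 - i' - j' = 0" using m' by simp
    then show "?x m = 0"
      unfolding m'(1) seq_of_seq_pos [OF m'(3,4,2)] using profile_eq_0 [OF N, of 0] by simp
  qed
  show ?thesis
  proof (cases "n < j")
    case True
    then show ?thesis using vanish [OF True] i by simp
  next
    case False
    then have "j \<le> n + 1" by simp
    then show ?thesis using j
    proof (induction j rule: inc_induct)
      case base
      then show ?case using vanish [of "n + 1"] i by simp
    next
      case (step j)
      have pos: "?x (seq_pos n j' i') = int (N (n + 2 - i' - j') (n + 2 - i'))"
        if "1 \<le> i'" "i' \<le> n" "1 \<le> j'" for i' j'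
        using seq_of_seq_pos that .
      have left: "(if 1 < i then ?x (seq_pos n (j + 1) (i - 1)) else 0) =
          int (N (n + 2 - i - j) (?a + 2))"
      proof (cases "1 < i")
        case True
        then have "n + 2 - (i - 1) - (j + 1) = n + 2 - i - j" "n + 2 - (i - 1) = ?a + 2"
          using i by auto
        then show ?thesis using pos [of "i - 1" "j + 1"] True i by simp
      next
        case False
        then show ?thesis using profile_eq_0 [OF N, of "n + 2 - i - j" "n + 2"] i by simp
      qed
      have right: "(if i < n then ?x (seq_pos n j (i + 1)) else 0) = int (N (n + 1 - i - j) ?a)"
      proof (cases "i < n")
        case True
        then show ?thesis using pos [of "i + 1" j] i step.prems by simp
      next
        case False
        then show ?thesis using profile_eq_0 [OF N, of "n + 1 - i - j" ?a] i step.prems by simp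
      qed
      have here: "?x (seq_pos n j i) = int (N (n + 2 - i - j) (?a + 1))"
        "?x (seq_pos n (j + 1) i) = int (N (n + 1 - i - j) (?a + 1))"
        using pos [of i j] pos [of i "j + 1"] i step.prems by (simp_all add: Suc_diff_le)
      have "sigma_at n ?x (seq_pos n j i) = peak_height N ?a (n + 1 - i - j) +
          int (N (n + 2 - i - j) (?a + 1)) + int (N (n + 1 - i - j) (?a + 1)) -
          int (N (n + 2 - i - j) (?a + 2)) - int (N (n + 1 - i - j) ?a)"
        using sigma_at_seq_pos_diff [OF x i, of j] step i unfolding left right here by simp
      also have "\<dots> = peak_height N ?a (n + 2 - i - j)"
      proof (cases "i + j \<le> n + 1")
        case True
        then have "n + 2 - i - j = Suc (n + 1 - i - j)" by simp
        then show ?thesis using peak_height_Suc [of N ?a "n + 1 - i - j"] by simp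
      next
        case False
        then have "n + 2 - i - j = 0" "n + 1 - i - j = 0" by auto
        then show ?thesis using profile_eq_0 [OF N, of 0] by simp
      qed
      finally show ?case .
    qed
  qed
qed

text \<open>
  The operators of colour \<open>i\<close> on the sequence of a profile change the profile in the same way as the
  operators of colour \<open>a = n + 1 - i\<close> on its tableau. Positions without a row, with \<open>j > a\<close>, have
  \<open>\<sigma>\<close>-value 0 and never exceed the peak of row 1, which is nonnegative; they attain the
  maximum only if it is 0, when the lowering operator vanishes.
\<close>

context
  fixes n i N
  assumes N: "N \<in> profiles n" and i: "1 \<le> i" "i \<le> n"
begin

private abbreviation "a \<equiv> n + 1 - i"
private abbreviation "x \<equiv> seq_of n N"

private lemma x_sequences: "x \<in> sequences"
  using seq_of_in_Sigma_iota [OF _ N] i by (simp add: Sigma_iota_def)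

private lemma colour_cases:
  assumes "1 \<le> k" "iota n k = i"
  obtains j where "k = seq_pos n j i" "1 \<le> j" "sigma_at n x k = peak_height N a (a + 1 - j)"
proof -
  obtain j i' where k: "k = seq_pos n j i'" "1 \<le> j" "1 \<le> i'" "i' \<le> n"
    using seq_pos_cases [of n k] assms(1) i by auto
  then have "i' = i" using iota_seq_pos [of i' n j] assms(2) by simp
  moreover have "n + 2 - i - j = a + 1 - j" using i by simp
  ultimately show ?thesis using that k sigma_at_seq_of [OF N i k(2)] by simp
qed

private lemma sigma_at_row:
  assumes "r \<in> {1..a}"
  shows "sigma_at n x (seq_pos n (a + 1 - r) i) = peak_height N a r"
proof -
  have "1 \<le> a + 1 - r" "n + 2 - i - (a + 1 - r) = r" using assms i by auto
  then show ?thesis using sigma_at_seq_of [OF N i] by metis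
qed

private lemma peak_height_le_max:
  assumes "\<forall>s\<in>{1..a}. peak_height N a s \<le> peak_height N a r" "s \<le> a"
  shows "peak_height N a s \<le> peak_height N a r"
proof (cases "s = 0")
  case True
  have "0 \<le> peak_height N a 1" using peak_height_1_nonneg [OF N, of a] i by simp
  also have "\<dots> \<le> peak_height N a r" using assms(1) i by simp
  finally show ?thesis using True by simp
qed (use assms in simp)

lemma sigma_max_seq_of:
  assumes max: "\<forall>s\<in>{1..a}. peak_height N a s \<le> peak_height N a r" and r: "r \<in> {1..a}"
  shows "sigma_max n i x = peak_height N a r"
proof (rule sigma_max_eqI [OF i x_sequences])
  show "1 \<le> seq_pos n (a + 1 - r) i" using i by (simp add: seq_pos_def)
  show "iota n (seq_pos n (a + 1 - r) i) = i" by (rule iota_seq_pos [OF i])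
  show "sigma_at n x (seq_pos n (a + 1 - r) i) = peak_height N a r" by (rule sigma_at_row [OF r])
  fix k assume "1 \<le> k" "iota n k = i"
  then obtain j where "1 \<le> j" "sigma_at n x k = peak_height N a (a + 1 - j)" by (rule colour_cases)
  then show "sigma_at n x k \<le> peak_height N a r" using peak_height_le_max [OF max] by simp
qed

private lemma M_set_row:
  assumes "\<forall>s\<in>{1..a}. peak_height N a s \<le> peak_height N a r" "r \<in> {1..a}"
  shows "seq_pos n (a + 1 - r) i \<in> M_set n i x"
  unfolding M_set_def sigma_max_seq_of [OF assms]
proof (intro CollectI conjI)
  show "1 \<le> seq_pos n (a + 1 - r) i" using i by (simp add: seq_pos_def)
qed (rule iota_seq_pos [OF i] sigma_at_row [OF assms(2)])+

private lemma M_set_cases: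
  assumes max: "\<forall>s\<in>{1..a}. peak_height N a s \<le> peak_height N a r" and r: "r \<in> {1..a}" and k: "k \<in> M_set n i x"
  obtains j where "k = seq_pos n j i" "1 \<le> j" "peak_height N a (a + 1 - j) = peak_height N a r"
proof -
  have "1 \<le> k" "iota n k = i" and eq: "sigma_at n x k = peak_height N a r"
    using k unfolding M_set_def sigma_max_seq_of [OF max r] by auto
  then obtain j where "k = seq_pos n j i" "1 \<le> j" "sigma_at n x k = peak_height N a (a + 1 - j)"
    using colour_cases by metis
  then show ?thesis using that eq by simp
qed

lemma Sigma_f_seq_of:
  assumes r: "argmax_last N a r"
  shows "Sigma_f n i x = Some (seq_of n (bump N r (Suc a)))"
proof -
  have r': "r \<in> {1..a}" and max: "\<forall>s\<in>{1..a}. peak_height N a s \<le> peak_height N a r"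
    and last: "\<And>s. r < s \<Longrightarrow> s \<le> a \<Longrightarrow> peak_height N a s < peak_height N a r"
    using r unfolding argmax_last_def by blast+
  let ?k = "seq_pos n (a + 1 - r) i"
  have "Sigma_f n i x = Some (x(?k := x ?k + 1))"
  proof (rule Sigma_f_eqI [OF i])
    show "?k \<in> M_set n i x" by (rule M_set_row [OF max r'])
    fix l assume "l \<in> M_set n i x"
    then obtain j where j: "l = seq_pos n j i" "1 \<le> j" "peak_height N a (a + 1 - j) = peak_height N a r"
      by (rule M_set_cases [OF max r'])
    have "a + 1 - j \<le> a" using j(2) by simp
    then have "\<not> r < a + 1 - j" using last j(3) by (metis less_irrefl)
    then have "a + 1 - r \<le> j" by simp
    moreover have "1 \<le> n" "1 \<le> a + 1 - r" using r' i by auto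
    ultimately show "?k \<le> l" unfolding j(1) using seq_pos_le_iff j(2) by blast
  qed
  also have "x(?k := x ?k + 1) = seq_of n (bump N r (Suc a))"
    using seq_of_bump [of r a n N] r' i by simp
  finally show ?thesis .
qed

lemma Sigma_e_seq_of:
  assumes r: "argmax_first N a r" "0 < peak_height N a r" and N': "N = bump N' r (Suc a)"
  shows "Sigma_e n i x = Some (seq_of n N')"
proof -
  have r': "r \<in> {1..a}" and max: "\<forall>s\<in>{1..a}. peak_height N a s \<le> peak_height N a r"
    and first: "\<And>s. 1 \<le> s \<Longrightarrow> s < r \<Longrightarrow> peak_height N a s < peak_height N a r"
    using r(1) unfolding argmax_first_def by blast+
  let ?k = "seq_pos n (a + 1 - r) i"
  have "Sigma_e n i x = Some (x(?k := x ?k - 1))"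
  proof (rule Sigma_e_eqI [OF i x_sequences])
    show "0 < sigma_max n i x" using sigma_max_seq_of [OF max r'] r(2) by simp
    show "?k \<in> M_set n i x" by (rule M_set_row [OF max r'])
    fix l assume "l \<in> M_set n i x"
    then obtain j where j: "l = seq_pos n j i" "1 \<le> j" "peak_height N a (a + 1 - j) = peak_height N a r"
      by (rule M_set_cases [OF max r'])
    then have "a + 1 - j \<noteq> 0" using r(2) by (metis peak_height_0 less_irrefl)
    then have "1 \<le> a + 1 - j" by linarith
    then have "\<not> a + 1 - j < r" using first j(3) by (metis less_irrefl)
    then have "j \<le> a + 1 - r" using \<open>a + 1 - j \<noteq> 0\<close> by simp
    moreover have "1 \<le> n" "1 \<le> a + 1 - r" using r' i by auto
    ultimately show "l \<le> ?k" unfolding j(1) using seq_pos_le_iff j(2) by blast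
  qed
  also have "x(?k := x ?k - 1) = seq_of n N'"
    using seq_of_bump [of r a n N'] r' i by (simp add: N' fun_eq_iff)
  finally show ?thesis .
qed

lemma Sigma_e_seq_of_None:
  assumes "argmax_first N a r" "peak_height N a r \<le> 0"
  shows "Sigma_e n i x = None"
  using sigma_max_seq_of [of r] assms by (simp add: argmax_first_def Sigma_e_def)

end

section \<open>Weights\<close>

lemma yb_tab:
  assumes N: "N \<in> profiles n" and r: "1 \<le> r" "r \<le> n" "r < a"
  shows "int (yb (tab n N) r a) = int (N r a) - int (N r (Suc a))"
proof -
  have "{c. tab n N (c, r) = Some a} = {row_start N r + N r (Suc a)..<row_start N r + N r a}"
    using r by (auto simp: tab_eq_Some [OF N])
  then show ?thesis
    using profile_antimono [OF N, of r a "Suc a"] r by (simp add: yb_def)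
qed

lemma sum_yb_tab:
  assumes N: "N \<in> profiles n" and r: "1 \<le> r" "r \<le> n" "r < n + 2 - i"
  shows "(\<Sum>k = 1..i. yb (tab n N) r (n + 2 - k)) = N r (n + 2 - i)"
proof -
  have "(\<Sum>k = 1..i. int (yb (tab n N) r (n + 2 - k))) = int (N r (n + 2 - i))"
    using r(3)
  proof (induction i)
    case 0
    then show ?case using profile_eq_0 [OF N] by simp
  next
    case (Suc i)
    then have "Suc (n + 2 - Suc i) = n + 2 - i" by simp
    then show ?case using Suc yb_tab [OF N r(1,2) Suc.prems] by simp
  qed
  then show ?thesis by (simp flip: of_nat_sum)
qed

text \<open>
  The number of boxes with entry exceeding \<open>a\<close> in the rows up to \<open>a\<close>. It is the coefficient of
  \<open>- \<alpha>\<^sub>a\<close> in the weight of the tableau.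
\<close>

definition boxes_above :: "(nat \<Rightarrow> nat \<Rightarrow> nat) \<Rightarrow> nat \<Rightarrow> int" where
  "boxes_above N a = (\<Sum>r = 1..a. int (N r (Suc a)))"

lemma MLT_wt_tab:
  assumes N: "N \<in> profiles n"
  shows "MLT_wt n (tab n N) = - (\<Sum>a = 1..n. frag_cmul (boxes_above N a) (alpha n a))"
proof -
  have "int (\<Sum>k = 1..a. \<Sum>l = a + 1..n + 1. yb (tab n N) k l) = boxes_above N a"
    if a: "a \<in> {1..n}" for a
  proof -
    have "(\<Sum>l = a + 1..n + 1. int (yb (tab n N) k l)) = int (N k (Suc a))"
      if k: "k \<in> {1..a}" for k
    proof -
      have "(\<Sum>l = a + 1..n + 1. int (yb (tab n N) k l)) =
          (\<Sum>l = a + 1..n + 1. int (N k l) - int (N k (Suc l)))"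
        using yb_tab [OF N, of k] k a by (intro sum.cong) auto
      also have "\<dots> = int (N k (a + 1)) - int (N k (Suc (n + 1)))"
        using sum_Suc_diff [of "a + 1" "n + 1" "\<lambda>l. - int (N k l)"] a by simp
      also have "\<dots> = int (N k (Suc a))" using profile_eq_0 [OF N, of k "Suc (n + 1)"] by simp
      finally show ?thesis .
    qed
    then show ?thesis by (simp add: boxes_above_def of_nat_sum del: sum.cl_ivl_Suc)
  qed
  then show ?thesis unfolding MLT_wt_def by (intro arg_cong [where f = uminus] sum.cong) auto
qed

lemma Sigma_wt_seq_of:
  assumes n: "1 \<le> n" and N: "N \<in> profiles n"
  shows "Sigma_wt n (seq_of n N) =
    - (\<Sum>i = 1..n. frag_cmul (boxes_above N (n + 1 - i)) (alpha n i))"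
proof -
  let ?x = "seq_of n N"
  let ?S = "{1..n} \<times> {1..n}"
  let ?p = "\<lambda>(i, j). seq_pos n j i"
  have inj: "inj_on ?p ?S"
  proof (rule inj_onI, clarify)
    fix i j i' j' assume h: "i \<in> {1..n}" "j \<in> {1..n}" "i' \<in> {1..n}" "j' \<in> {1..n}"
      and eq: "seq_pos n j i = seq_pos n j' i'"
    have "i = i'" using iota_seq_pos [of i n j] iota_seq_pos [of i' n j'] h eq by simp
    moreover have "j - 1 = j' - 1" using seq_pos_div [of i n j] seq_pos_div [of i' n j'] h eq by simp
    ultimately show "i = i' \<and> j = j'" using h by auto
  qed
  have "Sigma_wt n ?x = - (\<Sum>m\<in>?p ` ?S. frag_cmul (?x m) (alpha n (iota n m)))"
  proof (rule Sigma_wt_sum)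
    show "\<forall>m\<in>?p ` ?S. 1 \<le> m" by (auto simp: seq_pos_def)
    show "\<forall>m\<ge>1. ?x m \<noteq> 0 \<longrightarrow> m \<in> ?p ` ?S"
      using seq_of_support_image [OF n N] by blast
  qed simp
  also have "(\<Sum>m\<in>?p ` ?S. frag_cmul (?x m) (alpha n (iota n m))) =
      (\<Sum>(i, j)\<in>?S. frag_cmul (?x (seq_pos n j i)) (alpha n i))"
    unfolding sum.reindex [OF inj] by (rule sum.cong) (auto simp: iota_seq_pos)
  also have "\<dots> = (\<Sum>i = 1..n. \<Sum>j = 1..n. frag_cmul (?x (seq_pos n j i)) (alpha n i))"
    by (simp add: sum.cartesian_product)
  also have "\<dots> = (\<Sum>i = 1..n. frag_cmul (boxes_above N (n + 1 - i)) (alpha n i))"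
  proof (rule sum.cong [OF refl])
    fix i assume i: "i \<in> {1..n}"
    have "(\<Sum>j = 1..n. ?x (seq_pos n j i)) = (\<Sum>j = 1..n. int (N (n + 2 - i - j) (n + 2 - i)))"
      using seq_of_seq_pos [of i n] i by (intro sum.cong) auto
    also have "\<dots> = (\<Sum>j = 1..n + 1 - i. int (N (n + 2 - i - j) (n + 2 - i)))"
      using i profile_eq_0 [OF N, of 0] by (intro sum.mono_neutral_right) auto
    also have "\<dots> = (\<Sum>r = 1..n + 1 - i. int (N r (n + 2 - i)))"
      by (rule sum.reindex_bij_witness [of _ "\<lambda>r. n + 2 - i - r" "\<lambda>j. n + 2 - i - j"]) auto
    also have "\<dots> = boxes_above N (n + 1 - i)"
      using i by (simp add: boxes_above_def Suc_diff_le)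
    finally have eq: "(\<Sum>j = 1..n. ?x (seq_pos n j i)) = boxes_above N (n + 1 - i)" .
    have frag_sum: "(\<Sum>j\<in>S. frag_cmul (f j) v) = frag_cmul (sum f S) v" if "finite S" for f S and v :: weight
      using that by (induction S rule: finite_induct) (simp_all add: frag_cmul_distrib)
    show "(\<Sum>j = 1..n. frag_cmul (?x (seq_pos n j i)) (alpha n i)) =
      frag_cmul (boxes_above N (n + 1 - i)) (alpha n i)"
      unfolding frag_sum [OF finite_atLeastAtMost] eq by (rule refl)
  qed
  finally show ?thesis .
qed

text \<open>
  The weight of a reverse tableau arises from that of its image under \<open>\<eta>\<close> by the automorphism
  \<open>a \<mapsto> n + 1 - a\<close> of the Dynkin diagram, which preserves the Cartan matrix.
\<close>

lemma coroot_diagram_symmetry: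
  assumes "i \<in> {1..n}"
  shows "coroot (n + 1 - i) (- (\<Sum>a = 1..n. frag_cmul (w a) (alpha n a))) =
    coroot i (- (\<Sum>j = 1..n. frag_cmul (w (n + 1 - j)) (alpha n j)))"
proof -
  have lin: "coroot i (- (\<Sum>a = 1..n. frag_cmul (w a) (alpha n a))) =
      - (\<Sum>a = 1..n. w a * coroot i (alpha n a))" for i and w :: "nat \<Rightarrow> int"
    by (simp add: coroot_def lookup_sum)
  have "(\<Sum>a = 1..n. w a * coroot (n + 1 - i) (alpha n a)) =
      (\<Sum>j = 1..n. w (n + 1 - j) * coroot i (alpha n j))"
  proof (rule sum.reindex_bij_witness [of _ "\<lambda>j. n + 1 - j" "\<lambda>a. n + 1 - a"])
    fix a assume a: "a \<in> {1..n}"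
    have mem: "n + 1 - a \<in> {1..n}" "n + 1 - i \<in> {1..n}" using a assms by auto
    have "i = n + 1 - a \<longleftrightarrow> n + 1 - i = a" "i = n + 1 - a + 1 \<longleftrightarrow> a = n + 1 - i + 1"
      "n + 1 - a = i + 1 \<longleftrightarrow> n + 1 - i = a + 1"
      using a assms by auto
    then have "coroot i (alpha n (n + 1 - a)) = coroot (n + 1 - i) (alpha n a)"
      unfolding coroot_alpha [OF assms mem(1)] coroot_alpha [OF mem(2) a] by simp
    then show "w (n + 1 - (n + 1 - a)) * coroot i (alpha n (n + 1 - a)) =
        w a * coroot (n + 1 - i) (alpha n a)" using a by simp
  qed auto
  then show ?thesis unfolding lin by simp
qed

section \<open>The isomorphism\<close>

text \<open>
  The crystal axioms are inherited along a bijection that respects all structure maps, so they have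
  to be verified only on one side.
\<close>

lemma crystal_iso_transferI:
  assumes C: "is_crystal n C" and bij: "bij_betw g (elems B) (elems C)"
    and wt: "\<And>b. b \<in> elems B \<Longrightarrow> wt C (g b) = wt B b"
    and eps: "\<And>i b. i \<in> {1..n} \<Longrightarrow> b \<in> elems B \<Longrightarrow> veps C i (g b) = veps B i b"
    and phi: "\<And>i b. i \<in> {1..n} \<Longrightarrow> b \<in> elems B \<Longrightarrow> vphi C i (g b) = vphi B i b"
    and e_in: "\<And>i b. i \<in> {1..n} \<Longrightarrow> b \<in> elems B \<Longrightarrow> e_op B i b \<in> with_zero (elems B)"
    and f_in: "\<And>i b. i \<in> {1..n} \<Longrightarrow> b \<in> elems B \<Longrightarrow> f_op B i b \<in> with_zero (elems B)"
    and e: "\<And>i b. i \<in> {1..n} \<Longrightarrow> b \<in> elems B \<Longrightarrow> map_option g (e_op B i b) = e_op C i (g b)"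
    and f: "\<And>i b. i \<in> {1..n} \<Longrightarrow> b \<in> elems B \<Longrightarrow> map_option g (f_op B i b) = f_op C i (g b)"
  shows "crystal_iso n B C (map_option g)"
proof -
  have gC: "g b \<in> elems C" if "b \<in> elems B" for b using bij that by (rule bij_betw_apply)
  have inj: "b = b'" if "g b = g b'" "b \<in> elems B" "b' \<in> elems B" for b b'
    using bij that by (auto simp: bij_betw_def dest: inj_onD)
  have e_Some: "e_op B i b = Some b' \<longleftrightarrow> e_op C i (g b) = Some (g b')"
    if "i \<in> {1..n}" "b \<in> elems B" "b' \<in> elems B" for i b b'
    using e [OF that(1,2)] e_in [OF that(1,2)] inj [of _ b'] that(3)
    by (cases "e_op B i b") (auto simp: with_zero_def)
  have f_Some: "f_op B i b = Some b' \<longleftrightarrow> f_op C i (g b) = Some (g b')"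
    if "i \<in> {1..n}" "b \<in> elems B" "b' \<in> elems B" for i b b'
    using f [OF that(1,2)] f_in [OF that(1,2)] inj [of _ b'] that(3)
    by (cases "f_op B i b") (auto simp: with_zero_def)
  have e_elem: "b' \<in> elems B" if "i \<in> {1..n}" "b \<in> elems B" "e_op B i b = Some b'" for i b b'
    using e_in [OF that(1,2)] that(3) by (auto simp: with_zero_def)
  have f_elem: "b' \<in> elems B" if "i \<in> {1..n}" "b \<in> elems B" "f_op B i b = Some b'" for i b b'
    using f_in [OF that(1,2)] that(3) by (auto simp: with_zero_def)
  have crystal_B: "is_crystal n B"
    unfolding is_crystal_def
  proof (intro conjI ballI allI impI)
    fix b assume b: "b \<in> elems B"
    show "wt B b \<in> weight_lattice n" using C gC [OF b] wt [OF b] unfolding is_crystal_def by metis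
  next
    fix i b assume h: "i \<in> {1..n}" "b \<in> elems B"
    note c = eps [OF h] phi [OF h] wt [OF h(2)]
    have c_ax: "veps C i (g b) \<noteq> \<infinity>" "vphi C i (g b) \<noteq> \<infinity>"
      "vphi C i (g b) = veps C i (g b) + Fin (coroot i (wt C (g b)))"
      "vphi C i (g b) = -\<infinity> \<longrightarrow> e_op C i (g b) = None \<and> f_op C i (g b) = None"
      using C h(1) gC [OF h(2)] unfolding is_crystal_def by blast+
    show "e_op B i b \<in> with_zero (elems B)" "f_op B i b \<in> with_zero (elems B)"
      using e_in [OF h] f_in [OF h] .
    show "veps B i b \<noteq> \<infinity>" "vphi B i b \<noteq> \<infinity>"
      "vphi B i b = veps B i b + Fin (coroot i (wt B b))"
      using c_ax(1-3) c by simp_all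
    show "e_op B i b = None" "f_op B i b = None" if "vphi B i b = -\<infinity>"
      using that c_ax(4) c e [OF h] f [OF h] by simp_all
    fix b'
    {
      assume s: "e_op B i b = Some b'"
      note b' = e_elem [OF h s]
      have "e_op C i (g b) = Some (g b')" using e_Some h b' s by blast
      then have "wt C (g b') = wt C (g b) + alpha n i \<and>
          veps C i (g b') = veps C i (g b) - 1 \<and> vphi C i (g b') = vphi C i (g b) + 1"
        using C h(1) gC [OF h(2)] unfolding is_crystal_def by blast
      then show "wt B b' = wt B b + alpha n i"
        "veps B i b' = veps B i b - 1" "vphi B i b' = vphi B i b + 1"
        using c eps [OF h(1) b'] phi [OF h(1) b'] wt [OF b'] by simp_all
    next
      assume s: "f_op B i b = Some b'"
      note b' = f_elem [OF h s]
      have "f_op C i (g b) = Some (g b')" using f_Some h b' s by blast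
      then have "wt C (g b') = wt C (g b) - alpha n i \<and>
          veps C i (g b') = veps C i (g b) + 1 \<and> vphi C i (g b') = vphi C i (g b) - 1"
        using C h(1) gC [OF h(2)] unfolding is_crystal_def by blast
      then show "wt B b' = wt B b - alpha n i"
        "veps B i b' = veps B i b + 1" "vphi B i b' = vphi B i b - 1"
        using c eps [OF h(1) b'] phi [OF h(1) b'] wt [OF b'] by simp_all
    }
  next
    fix i b b' assume h: "i \<in> {1..n}" "b \<in> elems B" "b' \<in> elems B"
    have "f_op C i (g b) = Some (g b') \<longleftrightarrow> e_op C i (g b') = Some (g b)"
      using C h(1) gC [OF h(2)] gC [OF h(3)] unfolding is_crystal_def by blast
    then show "f_op B i b = Some b' \<longleftrightarrow> e_op B i b' = Some b"
      using f_Some [OF h] e_Some [OF h(1,3,2)] by simp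
  qed
  have "bij_betw (map_option g) (with_zero (elems B)) (with_zero (elems C))"
    unfolding bij_betw_def
  proof
    show "inj_on (map_option g) (with_zero (elems B))"
      using inj by (auto simp: inj_on_def with_zero_def)
    show "map_option g ` with_zero (elems B) = with_zero (elems C)"
      using bij by (auto simp: bij_betw_def with_zero_def image_image)
  qed
  then show ?thesis
    unfolding crystal_iso_def
    using crystal_B C wt eps phi e f by (auto simp: with_zero_def)
qed

text \<open>
  Entries do not exceed \<open>n + 1\<close>, so the truncated subtraction in \<open>flip\<close> is an involution on them.
\<close>

lemma flip_flip_tab:
  assumes N: "N \<in> profiles n"
  shows "flip n (flip n (tab n N)) = tab n N"
proof
  fix b :: box
  obtain c r where b: "b = (c, r)" by (cases b)
  show "flip n (flip n (tab n N)) b = tab n N b"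
    using tab_entry_le(2) [OF N, of c r] by (cases "tab n N (c, r)") (auto simp: b flip_def)
qed

lemma RMLT_eq:
  assumes "1 \<le> n"
  shows "RMLT n = (\<lambda>N. flip n (tab n N)) ` profiles n"
  by (simp add: RMLT_def MLT_eq_tab_image [OF assms] image_image)

lemma eta_inv_tab:
  assumes n: "1 \<le> n" and N: "N \<in> profiles n"
  shows "eta_inv n (tab n N) = flip n (tab n N)"
  unfolding eta_inv_def
proof (rule inv_into_f_eq)
  show "inj_on (eta n) (RMLT n)"
    unfolding RMLT_eq [OF n] by (rule inj_onI) (auto simp: eta_def flip_flip_tab)
  show "flip n (tab n N) \<in> RMLT n" using N unfolding RMLT_eq [OF n] by blast
  show "eta n (flip n (tab n N)) = tab n N" by (simp add: eta_def flip_flip_tab [OF N])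
qed

lemma sum_zb_tab:
  assumes N: "N \<in> profiles n" and r: "1 \<le> r" "r < n + 2 - i" "1 \<le> i"
  shows "(\<Sum>k = 1..i. zb n (flip n (tab n N)) r k) = N r (n + 2 - i)"
  using sum_yb_tab [OF N, of r i] r by (simp add: zb_def eta_def flip_flip_tab [OF N])

text \<open>
  In terms of profiles \<open>\<psi>\<^sub>\<infinity>\<close> is a mere change of notation, since the sum of the \<open>z\<close> over
  \<open>1 \<le> k \<le> i\<close> counts the boxes of one row of the unreversed tableau with entry at least
  \<open>n + 2 - i\<close>.
\<close>

lemma psi_flip_tab:
  assumes n: "1 \<le> n" and N: "N \<in> profiles n"
  shows "psi n (flip n (tab n N)) = seq_of n N"
proof
  fix m
  show "psi n (flip n (tab n N)) m = seq_of n N m"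
  proof (cases "m = 0")
    case True
    then show ?thesis by (simp add: psi_def seq_of_def)
  next
    case False
    then obtain j i where m: "m = seq_pos n j i" "1 \<le> j" "1 \<le> i" "i \<le> n"
      using seq_pos_cases [of n m] n by auto
    have "psi n (flip n (tab n N)) m =
        (if i + j \<le> n + 1 then int (\<Sum>k = 1..i. zb n (flip n (tab n N)) (n + 2 - i - j) k) else 0)"
      using False m(2) iota_seq_pos [OF m(3,4), of j] seq_pos_div [OF m(3,4), of j]
      by (simp add: psi_def Let_def m(1))
    also have "\<dots> = int (N (n + 2 - i - j) (n + 2 - i))"
    proof (cases "i + j \<le> n + 1")
      case True
      have "1 \<le> n + 2 - i - j" "n + 2 - i - j < n + 2 - i" using True m by auto
      then have "(\<Sum>k = 1..i. zb n (flip n (tab n N)) (n + 2 - i - j) k) =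
          N (n + 2 - i - j) (n + 2 - i)"
        using m(3) by (rule sum_zb_tab [OF N])
      then show ?thesis using True by simp
    next
      case False
      then have "n + 2 - i - j = 0" by simp
      then show ?thesis using False profile_eq_0 [OF N, of 0] by simp
    qed
    also have "\<dots> = seq_of n N m" unfolding m(1) by (rule seq_of_seq_pos [OF m(3,4,2), symmetric])
    finally show ?thesis .
  qed
qed

lemma RMLT_wt_tab:
  assumes N: "N \<in> profiles n"
  shows "wt (RMLT_crystal n) (flip n (tab n N)) =
    - (\<Sum>i = 1..n. frag_cmul (boxes_above N (n + 1 - i)) (alpha n i))"
proof -
  have coeff: "int (\<Sum>j = 1..n + 1 - i. \<Sum>k = 1..i. zb n (flip n (tab n N)) j k) =
      boxes_above N (n + 1 - i)" if i: "i \<in> {1..n}" for i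
  proof -
    have "(\<Sum>j = 1..n + 1 - i. \<Sum>k = 1..i. zb n (flip n (tab n N)) j k) =
        (\<Sum>j = 1..n + 1 - i. N j (n + 2 - i))"
      using i by (intro sum.cong refl sum_zb_tab [OF N]) auto
    moreover have "n + 2 - i = Suc (n + 1 - i)" using i by auto
    ultimately show ?thesis by (simp add: boxes_above_def)
  qed
  show ?thesis
    unfolding RMLT_crystal_def crystal.simps
    by (intro arg_cong [where f = uminus] sum.cong refl arg_cong2 [where f = frag_cmul] coeff)
qed

theorem theorem3p4:
  fixes n :: nat
  assumes "n \<ge> 1"
  shows "crystal_iso n (RMLT_crystal n) (Sigma_crystal n) (map_option (psi n))"
proof -
  have n: "1 \<le> n" using assms .
  let ?T = "\<lambda>N. flip n (tab n N)"
  have elems: "elems (RMLT_crystal n) = ?T ` profiles n" "elems (Sigma_crystal n) = Sigma_iota n"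
    using RMLT_eq [OF n] by (simp_all add: RMLT_crystal_def Sigma_crystal_def)
  have index: "1 \<le> n + 1 - i" "n + 1 - i \<le> n" "1 \<le> i" "i \<le> n" if "i \<in> {1..n}" for i
    using that by auto
  have f: "\<exists>N'\<in>profiles n. f_op (RMLT_crystal n) i (?T N) = Some (?T N') \<and>
      Sigma_f n i (seq_of n N) = Some (seq_of n N')"
    if i: "i \<in> {1..n}" and N: "N \<in> profiles n" for i N
  proof -
    let ?a = "n + 1 - i"
    note a = index [OF i]
    obtain r where r: "argmax_last N ?a r" using ex_argmax_last a by blast
    let ?N' = "bump N r (Suc ?a)"
    have N': "?N' \<in> profiles n" using bump_in_profiles [OF N r a(2)] .
    have "f_op (RMLT_crystal n) i (?T N) = Some (?T ?N')"
      using MLT_f_argmax [OF N a(1,2) r] eta_inv_tab [OF n N']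
      by (simp add: RMLT_crystal_def eta_def flip_flip_tab [OF N])
    then show ?thesis using N' Sigma_f_seq_of [OF N a(3,4) r] by blast
  qed
  have e: "e_op (RMLT_crystal n) i (?T N) = None \<and> Sigma_e n i (seq_of n N) = None \<or>
      (\<exists>N'\<in>profiles n. e_op (RMLT_crystal n) i (?T N) = Some (?T N') \<and>
        Sigma_e n i (seq_of n N) = Some (seq_of n N'))"
    if i: "i \<in> {1..n}" and N: "N \<in> profiles n" for i N
  proof -
    let ?a = "n + 1 - i"
    note a = index [OF i]
    have op: "e_op (RMLT_crystal n) i (?T N) = map_option (eta_inv n) (MLT_e n ?a (tab n N))"
      by (simp add: RMLT_crystal_def eta_def flip_flip_tab [OF N])
    obtain r where r: "argmax_first N ?a r" using ex_argmax_first a by blast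
    show ?thesis
    proof (cases "0 < peak_height N ?a r")
      case True
      obtain N' where N': "N' \<in> profiles n" "N = bump N' r (Suc ?a)"
        using unbump_in_profiles [OF N r True] .
      have "MLT_e n ?a (tab n N) = Some (tab n N')"
        using MLT_e_argmax [OF N'(1) _ a(1,2), of r] N r True N'(2) by simp
      then have "e_op (RMLT_crystal n) i (?T N) = Some (?T N')"
        using op eta_inv_tab [OF n N'(1)] by simp
      then show ?thesis using N'(1) Sigma_e_seq_of [OF N a(3,4) r True N'(2)] by blast
    next
      case False
      then have "MLT_e n ?a (tab n N) = None" "Sigma_e n i (seq_of n N) = None"
        using MLT_e_None [OF N a(1,2) r] Sigma_e_seq_of_None [OF N a(3,4) r] by auto
      then show ?thesis using op by simp
    qed
  qed
  have Sigma: "Sigma_iota n = seq_of n ` profiles n"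
    using bij_betw_seq_of [OF n] by (simp add: bij_betw_def)
  have crystal: "is_crystal n (Sigma_crystal n)"
  proof (rule Sigma_crystal_is_crystal)
    show "y \<in> Sigma_iota n" if "i \<in> {1..n}" "x \<in> Sigma_iota n" "Sigma_f n i x = Some y" for i x y
      using that f [OF that(1)] unfolding Sigma by fastforce
    show "y \<in> Sigma_iota n" if "i \<in> {1..n}" "x \<in> Sigma_iota n" "Sigma_e n i x = Some y" for i x y
      using that e [OF that(1)] unfolding Sigma by fastforce
  qed
  have psi: "psi n (?T N) = seq_of n N" if "N \<in> profiles n" for N
    using psi_flip_tab [OF n that] .
  have bij: "bij_betw (psi n) (elems (RMLT_crystal n)) (elems (Sigma_crystal n))"
    unfolding elems bij_betw_def
  proof
    show "inj_on (psi n) (?T ` profiles n)"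
      using psi bij_betw_seq_of [OF n] by (auto simp: bij_betw_def inj_on_def)
    show "psi n ` ?T ` profiles n = Sigma_iota n"
      unfolding Sigma image_image using psi by simp
  qed
  have wt: "Sigma_wt n (seq_of n N) = wt (RMLT_crystal n) (?T N)" if "N \<in> profiles n" for N
    using Sigma_wt_seq_of [OF n that] RMLT_wt_tab [OF that] by simp
  have eps: "Fin (sigma_max n i (seq_of n N)) = MLT_eps (n + 1 - i) (tab n N)"
    if i: "i \<in> {1..n}" and N: "N \<in> profiles n" for i N
  proof -
    obtain r where r: "argmax_last N (n + 1 - i) r" using ex_argmax_last index [OF i] by blast
    then have "sigma_max n i (seq_of n N) = peak_height N (n + 1 - i) r"
      using sigma_max_seq_of [OF N index(3,4) [OF i]] unfolding argmax_last_def by blast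
    then show ?thesis using MLT_eps_tab [OF N index(1,2) [OF i] r] by simp
  qed
  have phi: "coroot i (Sigma_wt n (seq_of n N)) = coroot (n + 1 - i) (MLT_wt n (tab n N))"
    if i: "i \<in> {1..n}" and N: "N \<in> profiles n" for i N
    using coroot_diagram_symmetry [OF i, of "boxes_above N"]
    unfolding Sigma_wt_seq_of [OF n N] MLT_wt_tab [OF N] by simp
  show ?thesis
  proof (rule crystal_iso_transferI [OF crystal bij], unfold elems, safe)
    fix i N assume N: "N \<in> profiles n"
    show "wt (Sigma_crystal n) (psi n (?T N)) = wt (RMLT_crystal n) (?T N)"
      using wt [OF N] psi [OF N] by (simp add: Sigma_crystal_def)
    assume i: "i \<in> {1..n}"
    have veps: "veps (RMLT_crystal n) i (?T N) = MLT_eps (n + 1 - i) (tab n N)"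
      by (simp add: RMLT_crystal_def eta_def flip_flip_tab [OF N])
    show "veps (Sigma_crystal n) i (psi n (?T N)) = veps (RMLT_crystal n) i (?T N)"
      unfolding veps using eps [OF i N] psi [OF N] by (simp add: Sigma_crystal_def)
    have vphi: "vphi (RMLT_crystal n) i (?T N) = MLT_phi n (n + 1 - i) (tab n N)"
      by (simp add: RMLT_crystal_def eta_def flip_flip_tab [OF N])
    show "vphi (Sigma_crystal n) i (psi n (?T N)) = vphi (RMLT_crystal n) i (?T N)"
      unfolding vphi MLT_phi_def eps [OF i N, symmetric] phi [OF i N, symmetric]
      using psi [OF N] by (simp add: Sigma_crystal_def)
    show "e_op (RMLT_crystal n) i (?T N) \<in> with_zero (?T ` profiles n)"
      using e [OF i N] by (auto simp: with_zero_def)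
    show "f_op (RMLT_crystal n) i (?T N) \<in> with_zero (?T ` profiles n)"
      using f [OF i N] by (auto simp: with_zero_def)
    have op: "e_op (Sigma_crystal n) = Sigma_e n" "f_op (Sigma_crystal n) = Sigma_f n"
      by (simp_all add: Sigma_crystal_def)
    show "map_option (psi n) (e_op (RMLT_crystal n) i (?T N)) =
        e_op (Sigma_crystal n) i (psi n (?T N))"
      unfolding op psi [OF N] using e [OF i N] psi by auto
    show "map_option (psi n) (f_op (RMLT_crystal n) i (?T N)) =
        f_op (Sigma_crystal n) i (psi n (?T N))"
      unfolding op psi [OF N] using f [OF i N] psi by auto
  qed
qed

end
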